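(* Let $j_1,j_2$ be join-irreducible elements of the weak order on $B_n$. Then $j_1$ forces $j_2$ if and only if the symmetric arc or symmetric pair corresponding to $j_1$ is a subarc or subarc pair of the symmetric arc or symmetric pair corresponding to $j_2$.
   Context: $B_n$: signed permutations of $\{\pm1,\ldots,\pm n\}$ ($\pi(-i)=-\pi(i)$), long one-line notation $\pi_{-n}\cdots\pi_{-1}\pi_1\cdots\pi_n$. Weak order: $\sigma$ covers $\pi$ iff either $\pi_{-1}<\pi_1$ and $\sigma$ swaps $\pi_{-1},\pi_1$, or $\pi_i<\pi_{i+1}$ ($1\le i\le n-1$) and $\sigma$ swaps $\pi_i,\pi_{i+1}$ and $\pi_{-i-1},\pi_{-i}$; it is a finite lattice. $j$ is join-irreducible if it covers exactly one element $j_*$. A lattice congruence is an equivalence relation $\Theta$ with $x_1\equiv x_2,\ y_1\equiv y_2\Rightarrow x_1\wedge y_1\equiv x_2\wedge y_2$ and $x_1\vee y_1\equiv x_2\vee y_2$; $\Theta$ contracts $j$ if $j\equiv j_*$. $j_1$ forces $j_2$ if every congruence contracting $j_1$ contracts $j_2$. Arcs: $2n$ points on a vertical line labeled $-n,\ldots,-1,1,\ldots,n$ bottom to top, symmetric under the half-turn $x\mapsto -x$ ($i\mapsto -i$). An arc: monotone downward curve from a labeled point to a lower one, touching no other labeled point, passing left or right of each labeled point between; up to combinatorial equivalence. $L(\alpha),R(\alpha)$: labeled points strictly between the endpoints lying left/right of $\alpha$. Arcs are compatible if they intersect at most at a common endpoint and share no upper endpoint and no lower endpoint. A symmetric arc is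 an arc fixed by the half-turn (endpoints $\pm p$); a symmetric pair is a pair $\{\alpha,-\alpha\}$ of distinct compatible arcs exchanged by the half-turn; it is non-overlapping if one arc joins two positive points, overlapping if each joins a negative to a positive point (then one lies to the right of the other). The map $\delta$: for $\pi\in B_n$ and consecutive positions $a,b$ (order $-n<\cdots<-1<1<\cdots<n$) with $\pi_a>\pi_b$, an arc from $\pi_a$ to $\pi_b$ passing right of all $\pi_c$ with $\pi_b<\pi_c<\pi_a$, $c$ before $a$, and left of such $\pi_c$ with $c$ after $b$. For join-irreducible $j$, $\delta(j)$ is a single symmetric arc or single symmetric pair ("the arc/pair corresponding to $j$"), bijectively. Subarcs of a symmetric arc $\alpha$ with endpoints $-p<p$: a subarc is a symmetric arc $\alpha'$ with endpoints $-p'<p'$, $p'\le p$, $R(\alpha')=R(\alpha)\cap(-p',p')$; a subarc pair is a non-overlapping pair $\{\alpha',-\alpha'\}$ with $\alpha'$ having endpoints $0<p'<q'\le p$ and $R(\alpha')=R(\alpha)\cap(p',q')$. Subarcs of a symmetric pair $\{\alpha,-\alpha\}$, $\alpha$ with endpoints $p<q$: a subarc is a symmetric arc $\alpha'$ with endpoints $-p',p'$, $p\le -p'<p'\le q$, and $R(\alpha')=R(\alpha)\cap(-p',p')=R(-\alpha)\cap(-p',p')$. If the pair is overlapping, label so that $\alpha$ is right of $-\alpha$. A subarc pair is a symmetric pair $\{\alpha',-\alpha'\}$, $\alpha'$ with endpoints $p\le p'<q'\le q$ and $R(\alpha')=R(\alpha)\cap(p',q')$, such that if $\{\alpha',-\alpha'\}$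 is overlapping then $\alpha'$ is right of $-\alpha'$. (All intervals denote sets of labeled points.) *)

theory Defs
  imports Complex_Main "HOL-Algebra.Lattice" "HOL-Combinatorics.Permutations"
begin

section \<open>Signed permutations and the weak order\<close>

definition labels :: "nat \<Rightarrow> int set" where
  "labels n = {- int n..int n} - {0}"

definition signed_perms :: "nat \<Rightarrow> (int \<Rightarrow> int) set" where
  "signed_perms n = {\<pi>. \<pi> permutes labels n \<and> (\<forall>i. \<pi> (- i) = - \<pi> i)}"

text \<open>Composing with a transposition on the right swaps the entries in the two given positions
  of the long one-line notation.\<close>

definition covers :: "nat \<Rightarrow> (int \<Rightarrow> int) \<Rightarrow> (int \<Rightarrow> int) \<Rightarrow> bool" where
  "covers n \<sigma> \<pi> \<longleftrightarrow> \<pi> \<in> signed_perms n \<and> \<sigma> \<in> signed_perms n \<and>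
     (\<pi> (- 1) < \<pi> 1 \<and> \<sigma> = \<pi> \<circ> transpose (- 1) 1 \<or>
      (\<exists>i. 1 \<le> i \<and> i \<le> int n - 1 \<and> \<pi> i < \<pi> (i + 1) \<and>
           \<sigma> = \<pi> \<circ> transpose i (i + 1) \<circ> transpose (- i - 1) (- i)))"

definition weak_order :: "nat \<Rightarrow> (int \<Rightarrow> int) gorder" where
  "weak_order n = \<lparr>carrier = signed_perms n, eq = (=), le = (\<lambda>\<pi> \<sigma>. covers n \<sigma> \<pi>)\<^sup>*\<^sup>*\<rparr>"

definition join_irreducible :: "nat \<Rightarrow> (int \<Rightarrow> int) \<Rightarrow> bool" where
  "join_irreducible n j \<longleftrightarrow> j \<in> signed_perms n \<and> (\<exists>!\<pi>. covers n j \<pi>)"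

definition lower_cover :: "nat \<Rightarrow> (int \<Rightarrow> int) \<Rightarrow> (int \<Rightarrow> int)" where
  "lower_cover n j = (THE \<pi>. covers n j \<pi>)"

definition lattice_congruence :: "'a gorder \<Rightarrow> ('a \<times> 'a) set \<Rightarrow> bool" where
  "lattice_congruence L \<Theta> \<longleftrightarrow> equiv (carrier L) \<Theta> \<and>
     (\<forall>x\<^sub>1 x\<^sub>2 y\<^sub>1 y\<^sub>2. (x\<^sub>1, x\<^sub>2) \<in> \<Theta> \<longrightarrow> (y\<^sub>1, y\<^sub>2) \<in> \<Theta> \<longrightarrow>
        (x\<^sub>1 \<sqinter>\<^bsub>L\<^esub> y\<^sub>1, x\<^sub>2 \<sqinter>\<^bsub>L\<^esub> y\<^sub>2) \<in> \<Theta> \<and>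
        (x\<^sub>1 \<squnion>\<^bsub>L\<^esub> y\<^sub>1, x\<^sub>2 \<squnion>\<^bsub>L\<^esub> y\<^sub>2) \<in> \<Theta>)"

definition contracts :: "nat \<Rightarrow> ((int \<Rightarrow> int) \<times> (int \<Rightarrow> int)) set \<Rightarrow> (int \<Rightarrow> int) \<Rightarrow> bool" where
  "contracts n \<Theta> j \<longleftrightarrow> (j, lower_cover n j) \<in> \<Theta>"

definition forces :: "nat \<Rightarrow> (int \<Rightarrow> int) \<Rightarrow> (int \<Rightarrow> int) \<Rightarrow> bool" where
  "forces n j\<^sub>1 j\<^sub>2 \<longleftrightarrow>
     (\<forall>\<Theta>. lattice_congruence (weak_order n) \<Theta> \<longrightarrow> contracts n \<Theta> j\<^sub>1 \<longrightarrow> contracts n \<Theta> j\<^sub>2)"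

section \<open>Arcs\<close>

text \<open>An arc up to combinatorial equivalence is its two endpoints together with the set
  \<open>R(\<alpha>)\<close> of the labeled points between them that lie to the right of the arc; \<open>L(\<alpha>)\<close> is the
  set of the remaining labeled points between the endpoints.\<close>

datatype arc = Arc (lower: int) (upper: int) (right_pts: "int set")

definition left_pts :: "arc \<Rightarrow> int set" where
  "left_pts \<alpha> = {lower \<alpha><..<upper \<alpha>} - {0} - right_pts \<alpha>"

definition is_arc :: "nat \<Rightarrow> arc \<Rightarrow> bool" where
  "is_arc n \<alpha> \<longleftrightarrow> lower \<alpha> \<in> labels n \<and> upper \<alpha> \<in> labels n \<and> lower \<alpha> < upper \<alpha> \<and>
     right_pts \<alpha> \<subseteq> {lower \<alpha><..<upper \<alpha>} - {0}"

text \<open>The half-turn exchanges left and right as well as top and bottom.\<close>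

definition half_turn :: "arc \<Rightarrow> arc" where
  "half_turn \<alpha> = Arc (- upper \<alpha>) (- lower \<alpha>) (uminus ` left_pts \<alpha>)"

text \<open>The point labeled \<open>i\<close> is placed at \<open>(0, i)\<close>.  A curve \<open>f\<close> gives the horizontal coordinate
  as a function of the height; it represents \<open>\<alpha>\<close> if it joins the endpoints of \<open>\<alpha>\<close> and passes
  to the right of the points of \<open>L(\<alpha>)\<close> and to the left of those of \<open>R(\<alpha>)\<close>.\<close>

definition represents :: "(real \<Rightarrow> real) \<Rightarrow> arc \<Rightarrow> bool" where
  "represents f \<alpha> \<longleftrightarrow>
     continuous_on {real_of_int (lower \<alpha>)..real_of_int (upper \<alpha>)} f \<and>
     f (real_of_int (lower \<alpha>)) = 0 \<and> f (real_of_int (upper \<alpha>)) = 0 \<and>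
     (\<forall>i\<in>left_pts \<alpha>. f (real_of_int i) > 0) \<and>
     (\<forall>i\<in>right_pts \<alpha>. f (real_of_int i) < 0)"

definition common_heights :: "arc \<Rightarrow> arc \<Rightarrow> real set" where
  "common_heights \<alpha> \<beta> = {real_of_int (lower \<alpha>)..real_of_int (upper \<alpha>)} \<inter>
                          {real_of_int (lower \<beta>)..real_of_int (upper \<beta>)}"

definition compatible :: "arc \<Rightarrow> arc \<Rightarrow> bool" where
  "compatible \<alpha> \<beta> \<longleftrightarrow> lower \<alpha> \<noteq> lower \<beta> \<and> upper \<alpha> \<noteq> upper \<beta> \<and>
     (\<exists>f g. represents f \<alpha> \<and> represents g \<beta> \<and>
        (\<forall>y\<in>common_heights \<alpha> \<beta>. f y = g y \<longrightarrow>
           y \<in> real_of_int ` ({lower \<alpha>, upper \<alpha>} \<inter> {lower \<beta>, upper \<beta>})))"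

text \<open>Only used for the two arcs of an overlapping symmetric pair, which have no endpoint in
  common and hence have disjoint representatives.\<close>

definition right_of :: "arc \<Rightarrow> arc \<Rightarrow> bool" where
  "right_of \<alpha> \<beta> \<longleftrightarrow>
     (\<exists>f g. represents f \<alpha> \<and> represents g \<beta> \<and> (\<forall>y\<in>common_heights \<alpha> \<beta>. g y < f y))"

section \<open>Symmetric arcs, symmetric pairs and their subarcs\<close>

definition symmetric_arc :: "nat \<Rightarrow> arc \<Rightarrow> bool" where
  "symmetric_arc n \<alpha> \<longleftrightarrow> is_arc n \<alpha> \<and> half_turn \<alpha> = \<alpha>"

text \<open>States that \<open>{\<alpha>, -\<alpha>}\<close> is a symmetric pair.\<close>

definition symmetric_pair :: "nat \<Rightarrow> arc \<Rightarrow> bool" where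
  "symmetric_pair n \<alpha> \<longleftrightarrow> is_arc n \<alpha> \<and> half_turn \<alpha> \<noteq> \<alpha> \<and> compatible \<alpha> (half_turn \<alpha>)"

definition nonoverlapping :: "arc \<Rightarrow> bool" where
  "nonoverlapping \<alpha> \<longleftrightarrow> 0 < lower \<alpha> \<or> 0 < lower (half_turn \<alpha>)"

definition overlapping :: "arc \<Rightarrow> bool" where
  "overlapping \<alpha> \<longleftrightarrow> lower \<alpha> < 0 \<and> 0 < upper \<alpha>"

text \<open>The labeling convention: \<open>\<alpha>\<close> is the right-hand arc of \<open>{\<alpha>, -\<alpha>}\<close> if that pair overlaps.\<close>

definition labeled_pair :: "nat \<Rightarrow> arc \<Rightarrow> bool" where
  "labeled_pair n \<alpha> \<longleftrightarrow> symmetric_pair n \<alpha> \<and> (overlapping \<alpha> \<longrightarrow> right_of \<alpha> (half_turn \<alpha>))"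

definition arc_subarc_of_arc :: "nat \<Rightarrow> arc \<Rightarrow> arc \<Rightarrow> bool" where
  "arc_subarc_of_arc n \<alpha>' \<alpha> \<longleftrightarrow> symmetric_arc n \<alpha>' \<and> symmetric_arc n \<alpha> \<and>
     upper \<alpha>' \<le> upper \<alpha> \<and>
     right_pts \<alpha>' = right_pts \<alpha> \<inter> {lower \<alpha>'<..<upper \<alpha>'}"

definition pair_subarc_of_arc :: "nat \<Rightarrow> arc \<Rightarrow> arc \<Rightarrow> bool" where
  "pair_subarc_of_arc n \<alpha>' \<alpha> \<longleftrightarrow>
     symmetric_pair n \<alpha>' \<and> nonoverlapping \<alpha>' \<and> symmetric_arc n \<alpha> \<and>
     0 < lower \<alpha>' \<and> upper \<alpha>' \<le> upper \<alpha> \<and>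
     right_pts \<alpha>' = right_pts \<alpha> \<inter> {lower \<alpha>'<..<upper \<alpha>'}"

definition arc_subarc_of_pair :: "nat \<Rightarrow> arc \<Rightarrow> arc \<Rightarrow> bool" where
  "arc_subarc_of_pair n \<alpha>' \<alpha> \<longleftrightarrow> symmetric_arc n \<alpha>' \<and> labeled_pair n \<alpha> \<and>
     lower \<alpha> \<le> lower \<alpha>' \<and> upper \<alpha>' \<le> upper \<alpha> \<and>
     right_pts \<alpha>' = right_pts \<alpha> \<inter> {lower \<alpha>'<..<upper \<alpha>'} \<and>
     right_pts \<alpha>' = right_pts (half_turn \<alpha>) \<inter> {lower \<alpha>'<..<upper \<alpha>'}"

definition pair_subarc_of_pair :: "nat \<Rightarrow> arc \<Rightarrow> arc \<Rightarrow> bool" where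
  "pair_subarc_of_pair n \<alpha>' \<alpha> \<longleftrightarrow> labeled_pair n \<alpha>' \<and> labeled_pair n \<alpha> \<and>
     lower \<alpha> \<le> lower \<alpha>' \<and> upper \<alpha>' \<le> upper \<alpha> \<and>
     right_pts \<alpha>' = right_pts \<alpha> \<inter> {lower \<alpha>'<..<upper \<alpha>'}"

text \<open>A symmetric arc \<open>\<alpha>\<close> is given as the set \<open>{\<alpha>}\<close>, a symmetric pair as \<open>{\<alpha>, -\<alpha>}\<close>; in both
  cases this is the set \<open>{\<alpha>, -\<alpha>}\<close>.\<close>

definition subarc_or_subarc_pair :: "nat \<Rightarrow> arc set \<Rightarrow> arc set \<Rightarrow> bool" where
  "subarc_or_subarc_pair n A' A \<longleftrightarrow>
     (\<exists>\<alpha>' \<alpha>. A' = {\<alpha>', half_turn \<alpha>'} \<and> A = {\<alpha>, half_turn \<alpha>} \<and>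
        (arc_subarc_of_arc n \<alpha>' \<alpha> \<or> pair_subarc_of_arc n \<alpha>' \<alpha> \<or>
         arc_subarc_of_pair n \<alpha>' \<alpha> \<or> pair_subarc_of_pair n \<alpha>' \<alpha>))"

section \<open>The arc diagram of a signed permutation\<close>

definition consecutive :: "nat \<Rightarrow> int \<Rightarrow> int \<Rightarrow> bool" where
  "consecutive n a b \<longleftrightarrow>
     a \<in> labels n \<and> b \<in> labels n \<and> a < b \<and> (\<forall>c\<in>labels n. \<not> (a < c \<and> c < b))"

text \<open>The entries before position \<open>a\<close> end up to the left of the arc, those after position
  \<open>b\<close> to its right.\<close>

definition delta :: "nat \<Rightarrow> (int \<Rightarrow> int) \<Rightarrow> arc set" where
  "delta n \<pi> =
     {Arc (\<pi> b) (\<pi> a) {\<pi> c | c. c \<in> labels n \<and> b < c \<and> \<pi> b < \<pi> c \<and> \<pi> c < \<pi> a} | a b.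
        consecutive n a b \<and> \<pi> b < \<pi> a}"

end

(* The weak order is containment of inversion sets, and the inversion sets are the biclosed sets
   of pairs of labels; this gives the lattice, with negation as an anti-automorphism.  A cover
   y > x adds one inversion (q, p) and its negative, and is labeled by the arc from q to p whose
   right-hand points stand after q in y, together with its half-turn.

   Forcing implies subarc: a join-irreducible element j has at most three increasing runs, so if j is
   below y but not below x, then the label of the cover is a subarc of the arc or pair of j.  For a
   set U of arcs closed under subarcs, let f(x) be the set of join-irreducible elements below x with
   label in U, and g(x) dually with the meet-irreducible elements above x.  Then f, and also g, is
   constant on a cover exactly if the label of the cover is not in U, so f and g have the same
   fibers.  Since f turns meets and g turns joins into intersections, these fibers are the classes of
   a congruence that contracts exactly the join-irreducible elements with label outside U.

   Subarc implies forcing: covers with the same label are contracted together.  In a hexagon or an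
   octagon, contracting a bottom edge contracts all side edges, whose labels are larger arcs
   containing that of the bottom edge; every pair of a subarc and an arc is joined by such steps. *)

theory Submission
  imports Defs
begin

section \<open>Signed permutations and their inversions\<close>

text \<open>Most arguments use one arc per label, that of a descent at positive positions; in an
  overlapping pair it is the right-hand one. Its right-hand points stand at positive positions, so
  they never contain both c and -c. This condition on the set of right-hand points is all that
  remains of the curves, and a subarc is then the restriction of that set to a shorter interval of
  labels.

  The obstacle to forcing is a label c with c and -c both to the left of an overlapping arc. In an
  octagon the entries -b, -a, a, b fill the middle of the word, so exactly one of c and -c stands
  after them and such a c below a cannot occur. A hexagon at positive positions has room for both on
  the left, nearer to the middle than its three entries; but these have distinct absolute values, so
  its bottom edge never carries a symmetric arc. Hence octagons carry the arc up to the smallest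
  obstructing c, and a hexagon with c or -c as middle value does the rest.\<close>

lemma finite_labels [simp]: "finite (labels n)"
  by (simp add: labels_def)

lemma uminus_labels [simp]: "- c \<in> labels n \<longleftrightarrow> c \<in> labels n"
  by (auto simp: labels_def)

lemma zero_not_in_labels [simp]: "0 \<notin> labels n"
  by (simp add: labels_def)

lemma consecutive_iff:
  "consecutive n a b \<longleftrightarrow> a \<in> labels n \<and> b \<in> labels n \<and> (b = a + 1 \<or> (a = -1 \<and> b = 1))"
proof
  assume c: "consecutive n a b"
  have "b = a + 1 \<or> (a = -1 \<and> b = 1)"
  proof (cases "a = -1")
    case True
    have "\<not> 1 < b" using c True unfolding consecutive_def labels_def by auto
    then show ?thesis using c True unfolding consecutive_def labels_def by auto
  next
    case False
    then show ?thesis using c unfolding consecutive_def labels_def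
      by (auto dest: bspec[of _ _ "a + 1"])
  qed
  then show "a \<in> labels n \<and> b \<in> labels n \<and> (b = a + 1 \<or> (a = -1 \<and> b = 1))"
    using c unfolding consecutive_def by auto
qed (auto simp: consecutive_def labels_def)

lemma consecutive_uminus: "consecutive n a b \<Longrightarrow> consecutive n (- b) (- a)"
  by (auto simp: consecutive_iff)

text \<open>The steps are demanded only between a and b, so that the lemma applies inside a single
  increasing run of a join-irreducible element as well as to the whole word.\<close>

lemma consecutive_chain:
  assumes "a \<in> labels n" "b \<in> labels n" "a < b"
    and step: "\<And>c d. consecutive n c d \<Longrightarrow> a \<le> c \<Longrightarrow> d \<le> b \<Longrightarrow> R c d"
    and trans: "\<And>c d e. R c d \<Longrightarrow> R d e \<Longrightarrow> R c e"
  shows "R a b"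
  using assms(1-3) step
proof (induction "nat (b - a)" arbitrary: b rule: less_induct)
  case less
  \<comment> \<open>The label just below b; the gap at 0 makes it -1 for b = 1.\<close>
  define b' where "b' = (if b = 1 then -1 else b - 1)"
  show ?case
  proof (cases "a = b'")
    case True
    then have "consecutive n a b"
      using less.prems unfolding b'_def consecutive_iff by (auto split: if_splits)
    then show ?thesis using less.prems by auto
  next
    case False
    have b': "b' \<in> labels n" "a < b'" "b' < b"
      using less.prems False unfolding b'_def labels_def by (auto split: if_splits)
    have "R a b'"
      using less.hyps[of b'] less.prems b' by force
    moreover have "R b' b"
      using less.prems(4)[of b' b] b' less.prems(1-3) unfolding consecutive_iff b'_def by auto
    ultimately show ?thesis by (rule trans)
  qed
qed

lemma signed_permsD:
  assumes "\<pi> \<in> signed_perms n"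
  shows "\<pi> permutes labels n" "inv \<pi> permutes labels n" "\<pi> (- i) = - \<pi> i"
    "inv \<pi> (- i) = - inv \<pi> i" "\<pi> (inv \<pi> i) = i" "inv \<pi> (\<pi> i) = i"
    "\<pi> i \<in> labels n \<longleftrightarrow> i \<in> labels n" "inv \<pi> i \<in> labels n \<longleftrightarrow> i \<in> labels n"
proof -
  show p: "\<pi> permutes labels n" and odd: "\<pi> (- i) = - \<pi> i" for i
    using assms by (auto simp: signed_perms_def)
  show "inv \<pi> permutes labels n" using p by (rule permutes_inv)
  show a: "\<pi> (inv \<pi> i) = i" and b: "inv \<pi> (\<pi> i) = i" for i
    using p permutes_inverses by metis+
  show "inv \<pi> (- i) = - inv \<pi> i"
    using a[of i] b[of "- inv \<pi> i"] odd[of "inv \<pi> i"] by simp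
  show "\<pi> i \<in> labels n \<longleftrightarrow> i \<in> labels n" "inv \<pi> i \<in> labels n \<longleftrightarrow> i \<in> labels n"
    by (rule permutes_in_image[OF p], rule permutes_in_image[OF permutes_inv[OF p]])
qed

lemma inv_signed_perm_eq_iff: "\<pi> \<in> signed_perms n \<Longrightarrow> inv \<pi> u = inv \<pi> v \<longleftrightarrow> u = v"
  by (metis signed_permsD(5))

definition inversions :: "nat \<Rightarrow> (int \<Rightarrow> int) \<Rightarrow> (int \<times> int) set" where
  "inversions n \<pi> = {(q, p). p \<in> labels n \<and> q \<in> labels n \<and> p < q \<and> inv \<pi> q < inv \<pi> p}"

text \<open>The second and third conditions make T and its complement transitive, as they are for
  the inversions of any word; the mirror pair (-p, -q) in the first one is what being signed means
  for inversions.\<close>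

definition biclosed :: "nat \<Rightarrow> (int \<times> int) set \<Rightarrow> bool" where
  "biclosed n T \<longleftrightarrow>
     (\<forall>q p. (q, p) \<in> T \<longrightarrow> p \<in> labels n \<and> q \<in> labels n \<and> p < q \<and> (- p, - q) \<in> T) \<and>
     (\<forall>r q p. (r, q) \<in> T \<longrightarrow> (q, p) \<in> T \<longrightarrow> (r, p) \<in> T) \<and>
     (\<forall>r q p. (r, p) \<in> T \<longrightarrow> q \<in> labels n \<longrightarrow> p < q \<longrightarrow> q < r \<longrightarrow> (r, q) \<in> T \<or> (q, p) \<in> T)"

lemma biclosedD:
  assumes "biclosed n T"
  shows "(q, p) \<in> T \<Longrightarrow> p \<in> labels n" "(q, p) \<in> T \<Longrightarrow> q \<in> labels n" "(q, p) \<in> T \<Longrightarrow> p < q"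
    "(q, p) \<in> T \<Longrightarrow> (- p, - q) \<in> T"
    "(r, q) \<in> T \<Longrightarrow> (q, p) \<in> T \<Longrightarrow> (r, p) \<in> T"
    "(r, p) \<in> T \<Longrightarrow> q \<in> labels n \<Longrightarrow> p < q \<Longrightarrow> q < r \<Longrightarrow> (r, q) \<in> T \<or> (q, p) \<in> T"
  using assms unfolding biclosed_def by blast+

lemma biclosed_inversions: "\<pi> \<in> signed_perms n \<Longrightarrow> biclosed n (inversions n \<pi>)"
  unfolding biclosed_def inversions_def by (auto simp: signed_permsD)

text \<open>The relation "\<open>u\<close> stands before \<open>v\<close>" in a signed permutation with inversion set \<open>T\<close>.\<close>

definition before :: "nat \<Rightarrow> (int \<times> int) set \<Rightarrow> int \<Rightarrow> int \<Rightarrow> bool" where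
  "before n T u v \<longleftrightarrow> u \<in> labels n \<and> v \<in> labels n \<and>
     (u < v \<and> (v, u) \<notin> T \<or> v < u \<and> (u, v) \<in> T)"

text \<open>Either T or its complement supplies the transitivity, depending on how u, v, w are
  ordered as numbers. Thus a biclosed set amounts to a linear order of the labels.\<close>

lemma before_trans:
  assumes T: "biclosed n T" and "before n T u v" "before n T v w"
  shows "before n T u w"
proof -
  have "u \<noteq> w" using assms unfolding before_def by auto
  then consider "u < w" | "w < u" by linarith
  then show ?thesis
  proof cases
    case 1
    have "(w, u) \<notin> T"
      using biclosedD(5)[OF T, of w u v] biclosedD(6)[OF T, of w u v] biclosedD(5)[OF T, of v w u]
        assms(2,3) 1 unfolding before_def by auto
    then show ?thesis using assms(2,3) 1 unfolding before_def by blast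
  next
    case 2
    have "(u, w) \<in> T"
      using biclosedD(6)[OF T, of u v w] biclosedD(5)[OF T, of u v w] biclosedD(6)[OF T, of v w u]
        assms(2,3) 2 unfolding before_def by auto
    then show ?thesis using assms(2,3) 2 unfolding before_def by blast
  qed
qed

lemma before_inversions:
  assumes "\<pi> \<in> signed_perms n"
  shows "before n (inversions n \<pi>) u v \<longleftrightarrow> u \<in> labels n \<and> v \<in> labels n \<and> inv \<pi> u < inv \<pi> v"
  using inv_signed_perm_eq_iff[OF assms, of u v] unfolding before_def inversions_def by auto

lemma before_asym: "biclosed n T \<Longrightarrow> before n T u v \<Longrightarrow> \<not> before n T v u"
  unfolding before_def by auto

text \<open>Only neighbouring entries have to be compared: chaining spreads the agreement to all
  pairs, and a linear order contained in a strict order equals it. The contrapositive finds two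
  neighbours at which a word disagrees with T.\<close>

lemma inversions_eqI:
  assumes \<pi>: "\<pi> \<in> signed_perms n" and T: "biclosed n T"
    and step: "\<And>a b. consecutive n a b \<Longrightarrow> before n T (\<pi> a) (\<pi> b)"
  shows "inversions n \<pi> = T"
proof -
  have chain: "before n T (\<pi> a) (\<pi> b)" if "a \<in> labels n" "b \<in> labels n" "a < b" for a b
    by (rule consecutive_chain[OF that]) (use step before_trans[OF T] in blast)+
  have eq: "before n T u v \<longleftrightarrow> inv \<pi> u < inv \<pi> v" if "u \<in> labels n" "v \<in> labels n" for u v
  proof
    assume l: "inv \<pi> u < inv \<pi> v"
    show "before n T u v"
      using chain[of "inv \<pi> u" "inv \<pi> v"] l that by (simp add: signed_permsD[OF \<pi>])
  next
    assume bf: "before n T u v"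
    show "inv \<pi> u < inv \<pi> v"
    proof (rule ccontr)
      assume "\<not> inv \<pi> u < inv \<pi> v"
      moreover have "u \<noteq> v" using bf unfolding before_def by auto
      ultimately have "inv \<pi> v < inv \<pi> u" using inv_signed_perm_eq_iff[OF \<pi>, of u v] by linarith
      then have "before n T v u"
        using chain[of "inv \<pi> v" "inv \<pi> u"] that by (simp add: signed_permsD[OF \<pi>])
      then show False using before_asym[OF T bf] by simp
    qed
  qed
  have "(q, p) \<in> inversions n \<pi> \<longleftrightarrow> (q, p) \<in> T" for q p
  proof (cases "p \<in> labels n \<and> q \<in> labels n \<and> p < q")
    case True
    then show ?thesis using eq[of q p] unfolding inversions_def before_def by auto
  next
    case False
    then show ?thesis using biclosedD[OF T] unfolding inversions_def by auto
  qed
  then show ?thesis by auto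
qed

text \<open>A position is determined by the number of entries before it, and the inversions
  determine which entries those are.\<close>

lemma inversions_inject:
  assumes \<pi>: "\<pi> \<in> signed_perms n" and \<sigma>: "\<sigma> \<in> signed_perms n"
    and eq: "inversions n \<pi> = inversions n \<sigma>"
  shows "\<pi> = \<sigma>"
proof -
  have less: "inv \<pi> u < inv \<pi> v \<longleftrightarrow> inv \<sigma> u < inv \<sigma> v" if "u \<in> labels n" "v \<in> labels n" for u v
    using before_inversions[OF \<pi>, of u v] before_inversions[OF \<sigma>, of u v] eq that by simp
  have pos: "card {u \<in> labels n. inv \<rho> u < a} = card {c \<in> labels n. c < a}"
    if \<rho>: "\<rho> \<in> signed_perms n" for \<rho> a
  proof -
    have "{c \<in> labels n. c < a} = inv \<rho> ` {u \<in> labels n. inv \<rho> u < a}"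
    proof (intro Set.set_eqI iffI)
      fix c assume "c \<in> {c \<in> labels n. c < a}"
      then show "c \<in> inv \<rho> ` {u \<in> labels n. inv \<rho> u < a}"
        by (intro image_eqI[of _ _ "\<rho> c"]) (auto simp: signed_permsD[OF \<rho>])
    qed (auto simp: signed_permsD[OF \<rho>])
    moreover have "inj_on (inv \<rho>) X" for X
      using inv_signed_perm_eq_iff[OF \<rho>] by (auto simp: inj_on_def)
    ultimately show ?thesis by (simp add: card_image)
  qed
  have mono: "card {c \<in> labels n. c < a} < card {c \<in> labels n. c < b}"
    if "a < b" "a \<in> labels n" for a b
    by (rule psubset_card_mono) (use that in auto)
  have "inv \<pi> v = inv \<sigma> v" if v: "v \<in> labels n" for v
  proof -
    have "{u \<in> labels n. inv \<pi> u < inv \<pi> v} = {u \<in> labels n. inv \<sigma> u < inv \<sigma> v}"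
      using less v by auto
    then have "card {c \<in> labels n. c < inv \<pi> v} = card {c \<in> labels n. c < inv \<sigma> v}"
      using pos[OF \<pi>, of "inv \<pi> v"] pos[OF \<sigma>, of "inv \<sigma> v"] by simp
    then show ?thesis
      using mono[of "inv \<pi> v" "inv \<sigma> v"] mono[of "inv \<sigma> v" "inv \<pi> v"] v
        signed_permsD(8)[OF \<pi>, of v] signed_permsD(8)[OF \<sigma>, of v] by force
  qed
  moreover have "inv \<pi> v = inv \<sigma> v" if "v \<notin> labels n" for v
    using that signed_permsD(2)[OF \<pi>] signed_permsD(2)[OF \<sigma>] by (simp add: permutes_def)
  ultimately have "inv \<pi> v = inv \<sigma> v" for v by blast
  then have "\<pi> c = \<sigma> c" for c
    using signed_permsD(5)[OF \<sigma>, of "\<pi> c"] signed_permsD(6)[OF \<pi>, of c] by simp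
  then show ?thesis by (rule ext)
qed

section \<open>Covers and the order by containment of inversions\<close>

lemma covers_signed_perms: "covers n \<sigma> \<pi> \<Longrightarrow> \<sigma> \<in> signed_perms n" "covers n \<sigma> \<pi> \<Longrightarrow> \<pi> \<in> signed_perms n"
  by (auto simp: covers_def)

text \<open>An abstract involution t covers the swap in the middle and the double swap at
  once.\<close>

lemma inversions_swap:
  assumes \<pi>: "\<pi> \<in> signed_perms n" and ab: "consecutive n a b" and lt: "\<pi> a < \<pi> b"
    and t: "t permutes labels n" "\<And>c. t (t c) = c" "\<And>c. t (- c) = - t c" "t a = b" "t b = a"
    and fix_t: "\<And>c. c \<notin> {a, b, - a, - b} \<Longrightarrow> t c = c"
  shows "\<pi> \<circ> t \<in> signed_perms n"
    "inversions n (\<pi> \<circ> t) = inversions n \<pi> \<union> {(\<pi> b, \<pi> a), (- \<pi> a, - \<pi> b)}"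
    "(\<pi> b, \<pi> a) \<notin> inversions n \<pi>"
proof -
  show mem: "\<pi> \<circ> t \<in> signed_perms n"
    using t(1,3) \<pi> permutes_compose[OF t(1)] unfolding signed_perms_def by auto
  have inv: "inv (\<pi> \<circ> t) v = t (inv \<pi> v)" for v
    by (rule inv_f_eq[OF permutes_inj[OF signed_permsD(1)[OF mem]]])
      (simp add: t(2) signed_permsD(5)[OF \<pi>])
  have ab': "a \<in> labels n" "b \<in> labels n" "a < b" "b = a + 1 \<or> (a = -1 \<and> b = 1)"
    using ab by (auto simp: consecutive_iff)
  have t': "t (- a) = - b" "t (- b) = - a" using t by auto
  \<comment> \<open>As a and b are neighbours, t reverses the order of no positions other than a, b
    and -b, -a.\<close>
  have key: "t c < t d \<longleftrightarrow> (if (c, d) \<in> {(a, b), (- b, - a)} then False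
       else if (c, d) \<in> {(b, a), (- a, - b)} then True else c < d)"
    if "c \<in> labels n" "d \<in> labels n" for c d
  proof -
    have nz: "c \<noteq> 0" "d \<noteq> 0" using that by (auto simp: labels_def)
    consider "a = -1" "b = 1" | "b = a + 1" "a \<noteq> -1" "a \<noteq> 0" "b \<noteq> 0"
      using ab' by (auto simp: labels_def)
    then show ?thesis
    proof cases
      case 1
      have "t c = (if c = 1 then -1 else if c = -1 then 1 else c)" for c
        using fix_t[of c] t 1 by auto
      then show ?thesis using nz 1 by (auto simp: not_less_iff_gr_or_eq)
    next
      case 2
      have "t c = (if c = a then a + 1 else if c = a + 1 then a else if c = - a then - a - 1
              else if c = - a - 1 then - a else c)" for c
        using fix_t[of c] t(4,5) t' 2(1) by auto
      then show ?thesis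
        unfolding prod.inject insert_iff empty_iff using nz 2 by smt
    qed
  qed
  show "(\<pi> b, \<pi> a) \<notin> inversions n \<pi>"
    using ab' by (auto simp: inversions_def signed_permsD[OF \<pi>])
  show "inversions n (\<pi> \<circ> t) = inversions n \<pi> \<union> {(\<pi> b, \<pi> a), (- \<pi> a, - \<pi> b)}"
  proof (intro Set.set_eqI)
    fix x :: "int \<times> int"
    obtain q p where x: "x = (q, p)" by (cases x)
    have P: "inv \<pi> u = c \<longleftrightarrow> u = \<pi> c" for u c
      using signed_permsD(5)[OF \<pi>, of u] signed_permsD(6)[OF \<pi>, of c] by auto
    show "x \<in> inversions n (\<pi> \<circ> t) \<longleftrightarrow>
        x \<in> inversions n \<pi> \<union> {(\<pi> b, \<pi> a), (- \<pi> a, - \<pi> b)}"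
    proof (cases "p \<in> labels n \<and> q \<in> labels n \<and> p < q")
      case True
      have "inv (\<pi> \<circ> t) q < inv (\<pi> \<circ> t) p \<longleftrightarrow>
          (if (q, p) \<in> {(\<pi> a, \<pi> b), (- \<pi> b, - \<pi> a)} then False
           else if (q, p) \<in> {(\<pi> b, \<pi> a), (- \<pi> a, - \<pi> b)} then True else inv \<pi> q < inv \<pi> p)"
        unfolding inv
          using key[of "inv \<pi> q" "inv \<pi> p"] True
        by (simp add: signed_permsD(3,7,8)[OF \<pi>] P)
      then show ?thesis using True lt unfolding x inversions_def by auto
    next
      case False
      then show ?thesis
        using lt ab' unfolding x inversions_def by (auto simp: signed_permsD[OF \<pi>])
    qed
  qed
qed

lemma covers_swap_middle:
  assumes "consecutive n (- 1) 1"
  shows "transpose (- 1) 1 permutes labels n" "transpose (- 1) 1 (- c) = - transpose (- 1) (1::int) c"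
proof -
  have "- 1 \<in> labels n" "1 \<in> labels n" using assms by (simp_all add: consecutive_iff)
  then show "transpose (- 1) 1 permutes labels n" by (rule permutes_swap_id)
  show "transpose (- 1) 1 (- c) = - transpose (- 1) (1::int) c"
    by (auto simp: transpose_def)
qed

lemma covers_swap_pair:
  assumes "consecutive n i (i + 1)" "1 \<le> i"
  defines "t \<equiv> transpose i (i + 1) \<circ> transpose (- i - 1) (- i)"
  shows "t permutes labels n" "t (t c) = c" "t (- c) = - t c" "t i = i + 1" "t (i + 1) = i"
    "c \<notin> {i, i + 1, - i, - (i + 1)} \<Longrightarrow> t c = c"
proof -
  have l: "i \<in> labels n" "i + 1 \<in> labels n" "- i \<in> labels n" "- i - 1 \<in> labels n"
    using assms(1) uminus_labels[of "i + 1" n] by (auto simp: consecutive_iff)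
  show "t permutes labels n"
    unfolding t_def by (intro permutes_compose permutes_swap_id l)
  have t: "t c = (if c = i then i + 1 else if c = i + 1 then i else if c = - i then - i - 1
              else if c = - i - 1 then - i else c)" for c
    using \<open>1 \<le> i\<close> unfolding t_def transpose_def by auto
  show "t (t c) = c" "t (- c) = - t c" "t i = i + 1" "t (i + 1) = i"
    "c \<notin> {i, i + 1, - i, - (i + 1)} \<Longrightarrow> t c = c"
    unfolding t using \<open>1 \<le> i\<close> by auto
qed

lemma cover_exists:
  assumes \<pi>: "\<pi> \<in> signed_perms n" and ab: "consecutive n a b" and lt: "\<pi> a < \<pi> b"
  obtains \<sigma> where "covers n \<sigma> \<pi>"
    "inversions n \<sigma> = inversions n \<pi> \<union> {(\<pi> b, \<pi> a), (- \<pi> a, - \<pi> b)}"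
proof -
  \<comment> \<open>The case of positive positions. The added set X is a parameter because an ascent
    at negative positions is moved to its mirror image, which lists the same two pairs in the other
    order.\<close>
  have pos: thesis if ab: "consecutive n a b" and lt: "\<pi> a < \<pi> b" and "1 \<le> a"
    and eq: "X = {(\<pi> b, \<pi> a), (- \<pi> a, - \<pi> b)}"
    and th: "\<And>\<sigma>. covers n \<sigma> \<pi> \<Longrightarrow> inversions n \<sigma> = inversions n \<pi> \<union> X \<Longrightarrow> thesis" for a b X
  proof -
    have b: "b = a + 1" "a \<le> int n - 1" using ab \<open>1 \<le> a\<close> by (auto simp: consecutive_iff labels_def)
    define t where "t = transpose a (a + 1) \<circ> transpose (- a - 1) (- a)"
    note t = covers_swap_pair[OF ab[unfolded b] \<open>1 \<le> a\<close>, folded t_def]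
    have "\<pi> \<circ> t \<in> signed_perms n"
      "inversions n (\<pi> \<circ> t) = inversions n \<pi> \<union> {(\<pi> b, \<pi> a), (- \<pi> a, - \<pi> b)}"
      using inversions_swap[OF \<pi> ab lt t(1-3)] t(4-6) b by auto
    moreover have "\<pi> \<circ> t = \<pi> \<circ> transpose a (a + 1) \<circ> transpose (- a - 1) (- a)"
      by (simp add: t_def o_assoc)
    ultimately have "covers n (\<pi> \<circ> t) \<pi>"
      "inversions n (\<pi> \<circ> t) = inversions n \<pi> \<union> X"
      using \<pi> b lt \<open>1 \<le> a\<close> eq unfolding covers_def by (blast, metis)
    then show thesis by (rule th)
  qed
  have "a = -1 \<and> b = 1 \<or> 1 \<le> a \<or> 1 \<le> - b"
    using ab unfolding consecutive_iff labels_def by simp linarith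
  then consider "a = -1" "b = 1" | "1 \<le> a" | "1 \<le> - b"
    by blast
  then show thesis
  proof cases
    case 1
    note t = covers_swap_middle[OF ab[unfolded 1]]
    have "\<pi> \<circ> transpose (- 1) 1 \<in> signed_perms n"
      "inversions n (\<pi> \<circ> transpose (- 1) 1) = inversions n \<pi> \<union> {(\<pi> b, \<pi> a), (- \<pi> a, - \<pi> b)}"
      using inversions_swap[OF \<pi> ab lt t(1) _ t(2)] 1 by auto
    then show thesis using that \<pi> lt 1 unfolding covers_def by blast
  next
    case 2
    then show thesis using pos[OF ab lt 2 refl] that by blast
  next
    case 3
    show thesis
      by (rule pos[OF consecutive_uminus[OF ab] _ 3, of "{(\<pi> b, \<pi> a), (- \<pi> a, - \<pi> b)}"])
        (use lt that in \<open>auto simp: signed_permsD[OF \<pi>]\<close>)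
  qed
qed

lemma covers_obtain:
  assumes "covers n \<sigma> \<pi>"
  obtains a b where "consecutive n a b" "1 \<le> b" "\<pi> a < \<pi> b" "\<sigma> a = \<pi> b" "\<sigma> b = \<pi> a"
    "inversions n \<sigma> = inversions n \<pi> \<union> {(\<pi> b, \<pi> a), (- \<pi> a, - \<pi> b)}"
    "(\<pi> b, \<pi> a) \<notin> inversions n \<pi>"
proof -
  have \<pi>: "\<pi> \<in> signed_perms n" and \<sigma>: "\<sigma> \<in> signed_perms n"
    using assms by (auto simp: covers_def)
  consider "\<pi> (- 1) < \<pi> 1" "\<sigma> = \<pi> \<circ> transpose (- 1) 1"
    | i where "1 \<le> i" "i \<le> int n - 1" "\<pi> i < \<pi> (i + 1)"
        "\<sigma> = \<pi> \<circ> (transpose i (i + 1) \<circ> transpose (- i - 1) (- i))"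
    using assms by (auto simp: covers_def o_assoc)
  then show thesis
  proof cases
    case 1
    have "1 \<in> labels n"
    proof (rule ccontr)
      \<comment> \<open>Without the label 1, so for n = 0, the swap would move points that every
        signed permutation fixes.\<close>
      assume "1 \<notin> labels n"
      then have "\<pi> 1 = 1" "\<sigma> 1 = 1" "\<pi> (- 1) = - 1"
        using signed_permsD(1)[OF \<pi>] signed_permsD(1)[OF \<sigma>] uminus_labels[of 1 n]
        by (auto simp: permutes_def)
      then show False using 1 by simp
    qed
    then have ab: "consecutive n (- 1) 1" using uminus_labels[of 1 n] by (simp add: consecutive_iff)
    note t = covers_swap_middle[OF ab]
    note s = inversions_swap[OF \<pi> ab 1(1) t(1) _ t(2), folded 1(2)]
    show thesis
      by (rule that[OF ab]) (use 1 s in auto)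
  next
    case 2
    have ab: "consecutive n i (i + 1)" using 2 by (auto simp: consecutive_iff labels_def)
    define t where "t = transpose i (i + 1) \<circ> transpose (- i - 1) (- i)"
    note t = covers_swap_pair[OF ab 2(1), folded t_def]
    have \<sigma>t: "\<sigma> = \<pi> \<circ> t" using 2(4) unfolding t_def .
    note s = inversions_swap[OF \<pi> ab 2(3) t(1-6)]
    show thesis
      by (rule that[OF ab _ 2(3) _ _ s(2)[folded \<sigma>t] s(3)]) (use 2(1) t in \<open>simp_all add: \<sigma>t\<close>)
  qed
qed

text \<open>If the word disagrees with T, it does so at two neighbours. They form an ascent, since
  the inversions already present lie in T, and swapping them adds a pair of T and its mirror
  image.\<close>

lemma cover_below_biclosed:
  assumes \<pi>: "\<pi> \<in> signed_perms n" and T: "biclosed n T"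
    and sub: "inversions n \<pi> \<subseteq> T" and ne: "inversions n \<pi> \<noteq> T"
  obtains \<sigma> where "covers n \<sigma> \<pi>" "inversions n \<sigma> \<subseteq> T"
proof -
  obtain a b where ab: "consecutive n a b" and nb: "\<not> before n T (\<pi> a) (\<pi> b)"
    using inversions_eqI[OF \<pi> T] ne by blast
  have l: "a \<in> labels n" "b \<in> labels n" "a < b" using ab by (auto simp: consecutive_def)
  have lab: "\<pi> a \<in> labels n" "\<pi> b \<in> labels n" using l signed_permsD(7)[OF \<pi>] by auto
  have "(\<pi> a, \<pi> b) \<in> inversions n \<pi>" if "\<pi> b < \<pi> a"
    using that l by (simp add: inversions_def signed_permsD(6,7)[OF \<pi>])
  then have "\<not> \<pi> b < \<pi> a" using nb lab sub unfolding before_def by blast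
  moreover have "\<pi> a \<noteq> \<pi> b" using l(3) signed_permsD(6)[OF \<pi>] by (metis less_irrefl)
  ultimately have "\<pi> a < \<pi> b" "(\<pi> b, \<pi> a) \<in> T"
    using nb lab unfolding before_def by force+
  moreover have "(- \<pi> a, - \<pi> b) \<in> T" using biclosedD(4)[OF T] calculation by blast
  ultimately show thesis
    using cover_exists[OF \<pi> ab] sub that by (metis Un_subset_iff empty_subsetI insert_subset)
qed

lemma finite_biclosed: "biclosed n T \<Longrightarrow> finite T"
  using biclosedD(1,2) by (intro finite_subset[of T "labels n \<times> labels n"]) auto

lemma covers_inversions_psubset: "covers n \<sigma> \<pi> \<Longrightarrow> inversions n \<pi> \<subset> inversions n \<sigma>"
  by (erule covers_obtain) auto

text \<open>Started at the identity this realizes every biclosed set; started at any \<pi> it turns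
  containment of inversions into a chain of covers.\<close>

lemma biclosed_reachable:
  assumes "\<pi> \<in> signed_perms n" "biclosed n T" "inversions n \<pi> \<subseteq> T"
  obtains \<sigma> where "(\<lambda>\<pi> \<sigma>. covers n \<sigma> \<pi>)\<^sup>*\<^sup>* \<pi> \<sigma>" "\<sigma> \<in> signed_perms n" "inversions n \<sigma> = T"
proof -
  have "\<exists>\<sigma>. (\<lambda>\<pi> \<sigma>. covers n \<sigma> \<pi>)\<^sup>*\<^sup>* \<pi> \<sigma> \<and> \<sigma> \<in> signed_perms n \<and> inversions n \<sigma> = T"
    using assms
  proof (induction "card (T - inversions n \<pi>)" arbitrary: \<pi> rule: less_induct)
    case less
    show ?case
    proof (cases "inversions n \<pi> = T")
      case False
      then obtain \<rho> where \<rho>: "covers n \<rho> \<pi>" "inversions n \<rho> \<subseteq> T"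
        using cover_below_biclosed less.prems by blast
      have "T - inversions n \<rho> \<subset> T - inversions n \<pi>"
        using covers_inversions_psubset[OF \<rho>(1)] \<rho>(2) by blast
      then have "card (T - inversions n \<rho>) < card (T - inversions n \<pi>)"
        using finite_biclosed[OF less.prems(2)] by (intro psubset_card_mono) auto
      then obtain \<sigma> where "(\<lambda>\<pi> \<sigma>. covers n \<sigma> \<pi>)\<^sup>*\<^sup>* \<rho> \<sigma>" "\<sigma> \<in> signed_perms n" "inversions n \<sigma> = T"
        using less.hyps[of \<rho>] \<rho> less.prems covers_signed_perms by blast
      moreover have "(\<lambda>\<pi> \<sigma>. covers n \<sigma> \<pi>)\<^sup>*\<^sup>* \<pi> \<sigma>"
        by (rule converse_rtranclp_into_rtranclp[of _ \<pi> \<rho>]) (use \<rho>(1) calculation in auto)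
      ultimately show ?thesis by blast
    qed (use less.prems in auto)
  qed
  then show thesis using that by blast
qed

lemma id_signed_perms: "id \<in> signed_perms n"
  by (auto simp: signed_perms_def permutes_id)

lemma inversions_id: "inversions n id = {}"
  by (auto simp: inversions_def)

lemma biclosed_realize:
  assumes "biclosed n T"
  obtains \<sigma> where "\<sigma> \<in> signed_perms n" "inversions n \<sigma> = T"
  using biclosed_reachable[OF id_signed_perms assms] by (auto simp: inversions_id)

lemma le_iff_inversions:
  assumes \<pi>: "\<pi> \<in> signed_perms n" and \<sigma>: "\<sigma> \<in> signed_perms n"
  shows "(\<lambda>\<pi> \<sigma>. covers n \<sigma> \<pi>)\<^sup>*\<^sup>* \<pi> \<sigma> \<longleftrightarrow> inversions n \<pi> \<subseteq> inversions n \<sigma>"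
proof
  assume "(\<lambda>\<pi> \<sigma>. covers n \<sigma> \<pi>)\<^sup>*\<^sup>* \<pi> \<sigma>"
  then show "inversions n \<pi> \<subseteq> inversions n \<sigma>"
  proof induction
    case (step \<rho> \<sigma>)
    then show ?case using covers_inversions_psubset[of n \<sigma> \<rho>] by blast
  qed simp
next
  assume "inversions n \<pi> \<subseteq> inversions n \<sigma>"
  then obtain \<rho> where "(\<lambda>\<pi> \<sigma>. covers n \<sigma> \<pi>)\<^sup>*\<^sup>* \<pi> \<rho>" "\<rho> \<in> signed_perms n"
    "inversions n \<rho> = inversions n \<sigma>"
    using biclosed_reachable[OF \<pi> biclosed_inversions[OF \<sigma>]] by blast
  then show "(\<lambda>\<pi> \<sigma>. covers n \<sigma> \<pi>)\<^sup>*\<^sup>* \<pi> \<sigma>"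
    using inversions_inject \<sigma> by blast
qed

text \<open>A cover with one of its two new inversions singled out; the other is the mirror image
  (-p, -q), and the two coincide for q = -p.\<close>

definition edge :: "nat \<Rightarrow> (int \<Rightarrow> int) \<Rightarrow> (int \<Rightarrow> int) \<Rightarrow> int \<Rightarrow> int \<Rightarrow> bool" where
  "edge n x y q p \<longleftrightarrow> x \<in> signed_perms n \<and> y \<in> signed_perms n \<and> (q, p) \<notin> inversions n x \<and>
     inversions n y = inversions n x \<union> {(q, p), (- p, - q)}"

lemma inversionsD:
  assumes "\<pi> \<in> signed_perms n" "(q, p) \<in> inversions n \<pi>"
  shows "p \<in> labels n" "q \<in> labels n" "p < q" "(- p, - q) \<in> inversions n \<pi>"
  using biclosedD(1-4)[OF biclosed_inversions[OF assms(1)] assms(2)] by auto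

lemma edgeD:
  assumes "edge n x y q p"
  shows "x \<in> signed_perms n" "y \<in> signed_perms n" "(q, p) \<notin> inversions n x"
    "(- p, - q) \<notin> inversions n x"
    "inversions n y = inversions n x \<union> {(q, p), (- p, - q)}"
    "p \<in> labels n" "q \<in> labels n" "p < q" "(q, p) \<in> inversions n y"
proof -
  show x: "x \<in> signed_perms n" and y: "y \<in> signed_perms n" and nin: "(q, p) \<notin> inversions n x"
    and eq: "inversions n y = inversions n x \<union> {(q, p), (- p, - q)}"
    using assms by (auto simp: edge_def)
  show q: "(q, p) \<in> inversions n y" unfolding eq by simp
  show "p \<in> labels n" "q \<in> labels n" "p < q" by (fact inversionsD[OF y q])+
  show "(- p, - q) \<notin> inversions n x" using inversionsD(4)[OF x, of "- p" "- q"] nin by fastforce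
qed

lemma edge_uminus: "edge n x y q p \<Longrightarrow> edge n x y (- p) (- q)"
  using edgeD(4)[of n x y q p] unfolding edge_def by (simp add: insert_commute)

text \<open>A cover of x that stays below y must contain one of the two added pairs, hence by
  symmetry both, hence is y.\<close>

lemma covers_iff_edge: "covers n y x \<longleftrightarrow> (\<exists>q p. edge n x y q p)"
proof
  assume "covers n y x"
  then show "\<exists>q p. edge n x y q p"
    using covers_signed_perms[of n y x] unfolding edge_def by (metis covers_obtain)
next
  assume "\<exists>q p. edge n x y q p"
  then obtain q p where e: "edge n x y q p" by blast
  note D = edgeD[OF e]
  have "inversions n x \<noteq> inversions n y" using D by blast
  then obtain z where z: "covers n z x" "inversions n z \<subseteq> inversions n y"
    using cover_below_biclosed[OF D(1) biclosed_inversions[OF D(2)]] D(5) by blast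
  have zs: "z \<in> signed_perms n" using z covers_signed_perms by blast
  obtain r where r: "r \<in> inversions n z" "r \<notin> inversions n x"
    using covers_inversions_psubset[OF z(1)] by blast
  then have "r = (q, p) \<or> r = (- p, - q)" using z(2) D(5) by blast
  then have "(q, p) \<in> inversions n z"
    using r(1) inversionsD(4)[OF zs, of "- p" "- q"] by auto
  then have "inversions n z = inversions n y"
    using z D(5) covers_inversions_psubset[OF z(1)] inversionsD(4)[OF zs, of q p] by blast
  then show "covers n y x" using inversions_inject[OF zs D(2)] z by blast
qed

section \<open>Negation, an anti-automorphism of the weak order\<close>

definition neg :: "nat \<Rightarrow> (int \<Rightarrow> int) \<Rightarrow> int \<Rightarrow> int" where
  "neg n x i = (if i \<in> labels n then - x i else i)"

lemma neg_signed_perms: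
  assumes x: "x \<in> signed_perms n"
  shows "neg n x \<in> signed_perms n" "inversions n (neg n x) =
    {(q, p). p \<in> labels n \<and> q \<in> labels n \<and> p < q \<and> (q, p) \<notin> inversions n x}"
proof -
  \<comment> \<open>As x is odd, negating its values is the same as reversing its positions, so
    membership follows by composition.\<close>
  define w where "w i = (if i \<in> labels n then - i else i)" for i
  have ww: "w (w i) = i" for i by (simp add: w_def)
  have bij: "bij_betw w (labels n) (labels n)"
    by (rule bij_betwI[of _ _ _ w]) (simp_all add: ww, simp_all add: w_def)
  have w: "w permutes labels n"
    by (rule bij_imp_permutes[OF bij]) (simp add: w_def)
  have eq: "neg n x = x \<circ> w"
    using signed_permsD(1,3)[OF x] by (auto simp: neg_def w_def permutes_def)
  show mem: "neg n x \<in> signed_perms n"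
    using permutes_compose[OF w signed_permsD(1)[OF x]] signed_permsD(3)[OF x]
    by (auto simp: signed_perms_def eq w_def)
  have "inv (neg n x) v = - inv x v" if "v \<in> labels n" for v
  proof (rule inv_f_eq[OF permutes_inj[OF signed_permsD(1)[OF mem]]])
    show "neg n x (- inv x v) = v"
      using that by (simp add: neg_def signed_permsD(3,5,8)[OF x])
  qed
  then have "(q, p) \<in> inversions n (neg n x) \<longleftrightarrow>
      p \<in> labels n \<and> q \<in> labels n \<and> p < q \<and> (q, p) \<notin> inversions n x" for q p
    using inv_signed_perm_eq_iff[OF x, of p q] by (auto simp: inversions_def)
  then show "inversions n (neg n x) =
    {(q, p). p \<in> labels n \<and> q \<in> labels n \<and> p < q \<and> (q, p) \<notin> inversions n x}" by auto
qed

lemma neg_neg: "x \<in> signed_perms n \<Longrightarrow> neg n (neg n x) = x"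
proof -
  assume x: "x \<in> signed_perms n"
  have "neg n (neg n x) i = x i" for i
    using signed_permsD(1)[OF x] by (cases "i \<in> labels n") (auto simp: neg_def permutes_def)
  then show ?thesis by auto
qed

lemma inversions_neg_iff:
  assumes "x \<in> signed_perms n"
  shows "(q, p) \<in> inversions n (neg n x) \<longleftrightarrow>
    p \<in> labels n \<and> q \<in> labels n \<and> p < q \<and> (q, p) \<notin> inversions n x"
  using neg_signed_perms(2)[OF assms] by auto

lemma inversions_neg_subset_iff:
  assumes "x \<in> signed_perms n" "y \<in> signed_perms n"
  shows "inversions n (neg n x) \<subseteq> inversions n (neg n y) \<longleftrightarrow> inversions n y \<subseteq> inversions n x"
proof -
  have "inversions n z \<subseteq> {(q, p). p \<in> labels n \<and> q \<in> labels n \<and> p < q}" for z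
    by (auto simp: inversions_def)
  from this[of x] this[of y] show ?thesis
    unfolding neg_signed_perms(2)[OF assms(1)] neg_signed_perms(2)[OF assms(2)] by blast
qed

lemma edge_neg: "edge n x y q p \<Longrightarrow> edge n (neg n y) (neg n x) q p"
proof -
  assume e: "edge n x y q p"
  note D = edgeD[OF e]
  have "inversions n x \<subseteq> {(q, p). p \<in> labels n \<and> q \<in> labels n \<and> p < q}"
    by (auto simp: inversions_def)
  then show ?thesis
    using D neg_signed_perms[OF D(1)] neg_signed_perms[OF D(2)] unfolding edge_def by auto
qed

lemma edge_ascent:
  assumes "x \<in> signed_perms n" "consecutive n a b" "x a < x b"
  obtains y where "edge n x y (x b) (x a)"
proof -
  obtain y where y: "covers n y x"
    "inversions n y = inversions n x \<union> {(x b, x a), (- x a, - x b)}"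
    using cover_exists[OF assms] by metis
  have "a < b" using assms(2) by (simp add: consecutive_def)
  then have "(x b, x a) \<notin> inversions n x" by (simp add: inversions_def signed_permsD(6)[OF assms(1)])
  then show thesis using that y covers_signed_perms[OF y(1)] unfolding edge_def by blast
qed

lemma edge_descent:
  assumes x: "x \<in> signed_perms n" and ab: "consecutive n a b" and lt: "x b < x a"
  obtains y where "edge n y x (x a) (x b)"
proof -
  have l: "a \<in> labels n" "b \<in> labels n" using ab by (auto simp: consecutive_def)
  obtain y where "edge n (neg n x) y (neg n x b) (neg n x a)"
    by (rule edge_ascent[OF neg_signed_perms(1)[OF x] ab]) (use l lt in \<open>auto simp: neg_def\<close>)
  then have "edge n (neg n y) x (- x b) (- x a)"
    using edge_neg l x by (fastforce simp: neg_def[of n x b] neg_def[of n x a] neg_neg)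
  then show thesis using edge_uminus that by fastforce
qed

section \<open>The lattice\<close>

text \<open>A chain from r down to p either meets q or has one step across q; splitting that step by
  \<open>cotrans\<close> connects q to r or to p.\<close>

lemma biclosed_trancl:
  assumes S: "\<And>q p. (q, p) \<in> S \<Longrightarrow> p \<in> labels n \<and> q \<in> labels n \<and> p < q \<and> (- p, - q) \<in> S"
    and cotrans: "\<And>r q p. (r, p) \<in> S \<Longrightarrow> q \<in> labels n \<Longrightarrow> p < q \<Longrightarrow> q < r \<Longrightarrow> (r, q) \<in> S \<or> (q, p) \<in> S"
  shows "biclosed n (S\<^sup>+)"
  unfolding biclosed_def
proof (intro conjI allI impI)
  have basic: "p \<in> labels n \<and> q \<in> labels n \<and> p < q \<and> (- p, - q) \<in> S\<^sup>+"
    if "(q, p) \<in> S\<^sup>+" for q p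
    using that
  proof (induction rule: trancl_induct)
    case (base y)
    then show ?case using S[of q y] by blast
  next
    case (step y z)
    have "z \<in> labels n" "z < y" "(- z, - y) \<in> S"
      using step(2) S[of y z] by blast+
    then show ?case using step(3) by (meson less_trans trancl_into_trancl2)
  qed
  fix q p assume "(q, p) \<in> S\<^sup>+"
  then show "p \<in> labels n" "q \<in> labels n" "p < q" "(- p, - q) \<in> S\<^sup>+"
    using basic by auto
next
  fix r q p assume "(r, q) \<in> S\<^sup>+" "(q, p) \<in> S\<^sup>+"
  then show "(r, p) \<in> S\<^sup>+" by (rule trancl_trans)
next
  fix r q p assume rp: "(r, p) \<in> S\<^sup>+" and q: "q \<in> labels n"
  assume "p < q" "q < r"
  then show "(r, q) \<in> S\<^sup>+ \<or> (q, p) \<in> S\<^sup>+"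
    using rp
  proof (induction arbitrary: rule: trancl_induct[OF rp])
    case (1 y)
    then show ?case using cotrans[of r y, OF _ q] by blast
  next
    case (2 y z)
    consider "y < q" | "y = q" | "q < y" by linarith
    then show ?case
    proof cases
      case 1
      then show ?thesis using 2 by (meson trancl_into_trancl)
    next
      case y: 2
      then show ?thesis using 2 by blast
    next
      case 3
      then have "(y, q) \<in> S \<or> (q, z) \<in> S" using cotrans[of y z, OF _ q] 2 by blast
      then show ?thesis using 2(1) by (meson r_into_trancl' trancl_into_trancl)
    qed
  qed
qed

text \<open>The inversions of the join are the transitive closure of the union: a union of biclosed
  sets still satisfies the splitting condition, and every upper bound is transitive.\<close>

lemma join_exists:
  assumes x: "x \<in> signed_perms n" and y: "y \<in> signed_perms n"
  obtains z where "z \<in> signed_perms n"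
    "\<And>w. w \<in> signed_perms n \<Longrightarrow> inversions n z \<subseteq> inversions n w \<longleftrightarrow>
        inversions n x \<subseteq> inversions n w \<and> inversions n y \<subseteq> inversions n w"
proof -
  obtain z where z: "z \<in> signed_perms n" "inversions n z = (inversions n x \<union> inversions n y)\<^sup>+"
  proof (rule biclosed_realize[OF biclosed_trancl])
    note X = biclosedD[OF biclosed_inversions[OF x]] and Y = biclosedD[OF biclosed_inversions[OF y]]
    show "p \<in> labels n \<and> q \<in> labels n \<and> p < q \<and> (- p, - q) \<in> inversions n x \<union> inversions n y"
      if "(q, p) \<in> inversions n x \<union> inversions n y" for q p
      using that X(1-4)[of q p] Y(1-4)[of q p] by blast
    show "(r, q) \<in> inversions n x \<union> inversions n y \<or> (q, p) \<in> inversions n x \<union> inversions n y"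
      if "(r, p) \<in> inversions n x \<union> inversions n y" "q \<in> labels n" "p < q" "q < r" for r q p
      using that X(6)[of r p q] Y(6)[of r p q] by blast
  qed
  have "inversions n z \<subseteq> inversions n w"
    if w: "w \<in> signed_perms n" and "inversions n x \<union> inversions n y \<subseteq> inversions n w" for w
  proof -
    have "trans (inversions n w)"
      using biclosedD(5)[OF biclosed_inversions[OF w]] by (auto intro: transI)
    then have "(inversions n w)\<^sup>+ = inversions n w" by (rule trancl_id)
    then show ?thesis using z(2) trancl_mono_subset[OF that(2)] by simp
  qed
  moreover have "inversions n x \<union> inversions n y \<subseteq> inversions n z"
    using z(2) by auto
  ultimately show thesis by (intro that[of z]) (use z in blast)+
qed

lemma meet_exists:
  assumes x: "x \<in> signed_perms n" and y: "y \<in> signed_perms n"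
  obtains z where "z \<in> signed_perms n"
    "\<And>w. w \<in> signed_perms n \<Longrightarrow> inversions n w \<subseteq> inversions n z \<longleftrightarrow>
        inversions n w \<subseteq> inversions n x \<and> inversions n w \<subseteq> inversions n y"
proof -
  note N = neg_signed_perms(1)
  obtain z where z: "z \<in> signed_perms n" and le: "\<And>w. w \<in> signed_perms n \<Longrightarrow>
      inversions n z \<subseteq> inversions n w \<longleftrightarrow>
        inversions n (neg n x) \<subseteq> inversions n w \<and> inversions n (neg n y) \<subseteq> inversions n w"
    using join_exists[OF N[OF x] N[OF y]] by blast
  have "inversions n w \<subseteq> inversions n (neg n z) \<longleftrightarrow>
        inversions n w \<subseteq> inversions n x \<and> inversions n w \<subseteq> inversions n y"
    if w: "w \<in> signed_perms n" for w
    using le[OF N[OF w]] inversions_neg_subset_iff[OF x w] inversions_neg_subset_iff[OF y w]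
      inversions_neg_subset_iff[OF N[OF z] w] neg_neg[OF z] by simp
  then show thesis using that N[OF z] by blast
qed

lemma weak_order_simps [simp]:
  "carrier (weak_order n) = signed_perms n"
  "x \<in> signed_perms n \<Longrightarrow> y \<in> signed_perms n \<Longrightarrow>
     le (weak_order n) x y \<longleftrightarrow> inversions n x \<subseteq> inversions n y"
  by (simp_all add: weak_order_def le_iff_inversions)

lemma lattice_weak_order: "lattice (weak_order n)"
proof -
  have eq: "eq (weak_order n) = (=)" by (simp add: weak_order_def)
  interpret partial_order "weak_order n"
    by unfold_locales (auto simp: eq intro: inversions_inject)
  show ?thesis
  proof
    fix x y assume x: "x \<in> carrier (weak_order n)" and y: "y \<in> carrier (weak_order n)"
    obtain z where z: "z \<in> signed_perms n" "\<And>w. w \<in> signed_perms n \<Longrightarrow>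
        inversions n z \<subseteq> inversions n w \<longleftrightarrow>
        inversions n x \<subseteq> inversions n w \<and> inversions n y \<subseteq> inversions n w"
      using join_exists[of x n y] x y by auto
    have "w \<in> Upper (weak_order n) {x, y} \<longleftrightarrow> w \<in> signed_perms n \<and> inversions n z \<subseteq> inversions n w"
      for w
      using x y z(2)[of w] by (cases "w \<in> signed_perms n") (simp_all add: Upper_def, blast)
    then have "is_lub (weak_order n) z {x, y}"
      using z(1) unfolding least_def by (simp add: subset_iff[of "Upper _ _"])
    then show "\<exists>s. is_lub (weak_order n) s {x, y}" by blast
    obtain z where z: "z \<in> signed_perms n" "\<And>w. w \<in> signed_perms n \<Longrightarrow>
        inversions n w \<subseteq> inversions n z \<longleftrightarrow>
        inversions n w \<subseteq> inversions n x \<and> inversions n w \<subseteq> inversions n y"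
      using meet_exists[of x n y] x y by auto
    have "w \<in> Lower (weak_order n) {x, y} \<longleftrightarrow> w \<in> signed_perms n \<and> inversions n w \<subseteq> inversions n z"
      for w
      using x y z(2)[of w] by (cases "w \<in> signed_perms n") (simp_all add: Lower_def, blast)
    then have "is_glb (weak_order n) z {x, y}"
      using z(1) unfolding greatest_def by (simp add: subset_iff[of "Lower _ _"])
    then show "\<exists>s. is_glb (weak_order n) s {x, y}" by blast
  qed
qed

lemma weak_order_join:
  assumes "x \<in> signed_perms n" "y \<in> signed_perms n"
  shows "join (weak_order n) x y \<in> signed_perms n"
    "w \<in> signed_perms n \<Longrightarrow> inversions n (join (weak_order n) x y) \<subseteq> inversions n w \<longleftrightarrow>
       inversions n x \<subseteq> inversions n w \<and> inversions n y \<subseteq> inversions n w"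
proof -
  interpret lattice "weak_order n" by (rule lattice_weak_order)
  show J: "join (weak_order n) x y \<in> signed_perms n" using join_closed[of x y] assms by simp
  show "inversions n (join (weak_order n) x y) \<subseteq> inversions n w \<longleftrightarrow>
       inversions n x \<subseteq> inversions n w \<and> inversions n y \<subseteq> inversions n w"
    if "w \<in> signed_perms n"
    using join_left[of x y] join_right[of x y] join_le[of x w y] assms that J
    by (auto simp del: subset_iff)
qed

lemma weak_order_meet:
  assumes "x \<in> signed_perms n" "y \<in> signed_perms n"
  shows "meet (weak_order n) x y \<in> signed_perms n"
    "w \<in> signed_perms n \<Longrightarrow> inversions n w \<subseteq> inversions n (meet (weak_order n) x y) \<longleftrightarrow>
       inversions n w \<subseteq> inversions n x \<and> inversions n w \<subseteq> inversions n y"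
proof -
  interpret lattice "weak_order n" by (rule lattice_weak_order)
  show J: "meet (weak_order n) x y \<in> signed_perms n" using meet_closed[of x y] assms by simp
  show "inversions n w \<subseteq> inversions n (meet (weak_order n) x y) \<longleftrightarrow>
       inversions n w \<subseteq> inversions n x \<and> inversions n w \<subseteq> inversions n y"
    if "w \<in> signed_perms n"
    using meet_left[of x y] meet_right[of x y] meet_le[of w x y] assms that J
    by (auto simp del: subset_iff)
qed

section \<open>Congruences and polygons\<close>

lemma congruenceD:
  assumes "lattice_congruence (weak_order n) \<Theta>"
  shows "(x, y) \<in> \<Theta> \<Longrightarrow> x \<in> signed_perms n" "(x, y) \<in> \<Theta> \<Longrightarrow> y \<in> signed_perms n"
    "x \<in> signed_perms n \<Longrightarrow> (x, x) \<in> \<Theta>" "(x, y) \<in> \<Theta> \<Longrightarrow> (y, x) \<in> \<Theta>"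
    "(x, y) \<in> \<Theta> \<Longrightarrow> (y, z) \<in> \<Theta> \<Longrightarrow> (x, z) \<in> \<Theta>"
    "(x, y) \<in> \<Theta> \<Longrightarrow> z \<in> signed_perms n \<Longrightarrow>
       (join (weak_order n) x z, join (weak_order n) y z) \<in> \<Theta>"
    "(x, y) \<in> \<Theta> \<Longrightarrow> z \<in> signed_perms n \<Longrightarrow>
       (meet (weak_order n) x z, meet (weak_order n) y z) \<in> \<Theta>"
proof -
  have e: "equiv (signed_perms n) \<Theta>" and c: "\<And>x\<^sub>1 x\<^sub>2 y\<^sub>1 y\<^sub>2. (x\<^sub>1, x\<^sub>2) \<in> \<Theta> \<Longrightarrow> (y\<^sub>1, y\<^sub>2) \<in> \<Theta> \<Longrightarrow>
        (meet (weak_order n) x\<^sub>1 y\<^sub>1, meet (weak_order n) x\<^sub>2 y\<^sub>2) \<in> \<Theta> \<and>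
        (join (weak_order n) x\<^sub>1 y\<^sub>1, join (weak_order n) x\<^sub>2 y\<^sub>2) \<in> \<Theta>"
    using assms by (auto simp: lattice_congruence_def)
  show "(x, y) \<in> \<Theta> \<Longrightarrow> x \<in> signed_perms n" "(x, y) \<in> \<Theta> \<Longrightarrow> y \<in> signed_perms n"
    using e by (blast dest: equiv_class_eq_iff[THEN iffD1])+
  show r: "(x, x) \<in> \<Theta>" if "x \<in> signed_perms n" for x
    using e that by (auto simp: equiv_def refl_on_def)
  show "(x, y) \<in> \<Theta> \<Longrightarrow> (y, x) \<in> \<Theta>" using e by (auto simp: equiv_def dest: symD)
  show "(x, y) \<in> \<Theta> \<Longrightarrow> (y, z) \<in> \<Theta> \<Longrightarrow> (x, z) \<in> \<Theta>" using e by (auto simp: equiv_def dest: transD)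
  show "(x, y) \<in> \<Theta> \<Longrightarrow> z \<in> signed_perms n \<Longrightarrow>
       (join (weak_order n) x z, join (weak_order n) y z) \<in> \<Theta>"
    "(x, y) \<in> \<Theta> \<Longrightarrow> z \<in> signed_perms n \<Longrightarrow>
       (meet (weak_order n) x z, meet (weak_order n) y z) \<in> \<Theta>"
    using c r by blast+
qed

lemma join_eqI:
  assumes "x \<in> signed_perms n" "y \<in> signed_perms n" "z \<in> signed_perms n"
    "inversions n x \<subseteq> inversions n z" "inversions n y \<subseteq> inversions n z"
    "\<And>w. w \<in> signed_perms n \<Longrightarrow> inversions n x \<subseteq> inversions n w \<Longrightarrow>
       inversions n y \<subseteq> inversions n w \<Longrightarrow> inversions n z \<subseteq> inversions n w"
  shows "join (weak_order n) x y = z"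
proof (rule inversions_inject)
  note J = weak_order_join[OF assms(1,2)]
  show "join (weak_order n) x y \<in> signed_perms n" by (rule J)
  show "inversions n (join (weak_order n) x y) = inversions n z"
    using J(2)[OF assms(3)] J(2)[OF J(1)] assms(3-6) J(1) by blast
qed (fact assms(3))

lemma meet_eqI:
  assumes "x \<in> signed_perms n" "y \<in> signed_perms n" "z \<in> signed_perms n"
    "inversions n z \<subseteq> inversions n x" "inversions n z \<subseteq> inversions n y"
    "\<And>w. w \<in> signed_perms n \<Longrightarrow> inversions n w \<subseteq> inversions n x \<Longrightarrow>
       inversions n w \<subseteq> inversions n y \<Longrightarrow> inversions n w \<subseteq> inversions n z"
  shows "meet (weak_order n) x y = z"
proof (rule inversions_inject)
  note J = weak_order_meet[OF assms(1,2)]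
  show "meet (weak_order n) x y \<in> signed_perms n" by (rule J)
  show "inversions n (meet (weak_order n) x y) = inversions n z"
    using J(2)[OF assms(3)] J(2)[OF J(1)] assms(3-6) J(1) by blast
qed (fact assms(3))

text \<open>y and w differ in (q, p) and its mirror image, and an element below c can contain
  neither.\<close>

lemma edge_meet:
  assumes e: "edge n w y q p" and c: "c \<in> signed_perms n"
    and "inversions n w \<subseteq> inversions n c" "(q, p) \<notin> inversions n c"
  shows "meet (weak_order n) y c = w"
proof (rule meet_eqI)
  note D = edgeD[OF e]
  show "inversions n v \<subseteq> inversions n w"
    if v: "v \<in> signed_perms n" "inversions n v \<subseteq> inversions n y" "inversions n v \<subseteq> inversions n c" for v
  proof -
    have "(q, p) \<notin> inversions n v" using that(3) assms(4) by blast
    moreover have "(- p, - q) \<notin> inversions n v"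
      using inversionsD(4)[OF v(1), of "- p" "- q"] calculation by fastforce
    ultimately show ?thesis using that(2) D(5) by blast
  qed
qed (use edgeD[OF e] assms in auto)

text \<open>Joining with \<open>y\<^sub>2\<close> shows that \<open>y\<^sub>2\<close> is congruent
  to the join J of the two upper elements. An element between w and J is then congruent to J if it
  contains the inversion \<open>(q\<^sub>2, p\<^sub>2)\<close>, because it lies above
  \<open>y\<^sub>2\<close>, and to w otherwise, because its meet with \<open>y\<^sub>2\<close> is w.
  So c and d are congruent if they agree on this inversion; the hypothesis \<open>top\<close> places
  d below J without computing J.\<close>

lemma polygon:
  assumes cong: "lattice_congruence (weak_order n) \<Theta>"
    and e1: "edge n w y\<^sub>1 q\<^sub>1 p\<^sub>1" and e2: "edge n w y\<^sub>2 q\<^sub>2 p\<^sub>2" and con: "(w, y\<^sub>1) \<in> \<Theta>"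
    and cd: "c \<in> signed_perms n" "d \<in> signed_perms n"
      "inversions n w \<subseteq> inversions n c" "inversions n c \<subseteq> inversions n d"
    and top: "\<And>z. z \<in> signed_perms n \<Longrightarrow> inversions n y\<^sub>1 \<subseteq> inversions n z \<Longrightarrow>
       inversions n y\<^sub>2 \<subseteq> inversions n z \<Longrightarrow> inversions n d \<subseteq> inversions n z"
    and side: "(q\<^sub>2, p\<^sub>2) \<in> inversions n c \<or> (q\<^sub>2, p\<^sub>2) \<notin> inversions n d"
  shows "(c, d) \<in> \<Theta>"
proof -
  note C = congruenceD[OF cong]
  note D1 = edgeD[OF e1] and D2 = edgeD[OF e2]
  define J where "J = join (weak_order n) y\<^sub>1 y\<^sub>2"
  note J = weak_order_join[OF D1(2) D2(2), folded J_def]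
  have "join (weak_order n) w y\<^sub>2 = y\<^sub>2"
    by (rule join_eqI) (use D1 D2 in auto)
  then have y2J: "(y\<^sub>2, J) \<in> \<Theta>" using C(6)[OF con D2(2)] J_def by simp
  have dJ: "inversions n d \<subseteq> inversions n J" using top J(1) J(2)[OF J(1)] by blast
  have above: "(e, J) \<in> \<Theta>"
    if e: "e \<in> signed_perms n" "inversions n w \<subseteq> inversions n e" "inversions n e \<subseteq> inversions n J"
      and "(q\<^sub>2, p\<^sub>2) \<in> inversions n e" for e
  proof -
    have "inversions n y\<^sub>2 \<subseteq> inversions n e"
      using that D2(5) inversionsD(4)[OF e(1), of q\<^sub>2 p\<^sub>2] by blast
    then have "join (weak_order n) y\<^sub>2 e = e" "join (weak_order n) J e = J"
      by (intro join_eqI; use D2 e J in auto)+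
    then show ?thesis using C(6)[OF y2J e(1)] by simp
  qed
  have below: "(w, e) \<in> \<Theta>"
    if e: "e \<in> signed_perms n" "inversions n w \<subseteq> inversions n e" "inversions n e \<subseteq> inversions n J"
      and "(q\<^sub>2, p\<^sub>2) \<notin> inversions n e" for e
  proof -
    have "meet (weak_order n) J e = e"
      by (intro meet_eqI; use e J in auto)
    then show ?thesis using C(7)[OF y2J e(1)] edge_meet[OF e2 e(1,2) that(4)] by simp
  qed
  show ?thesis
  proof (cases "(q\<^sub>2, p\<^sub>2) \<in> inversions n c")
    case True
    then show ?thesis using above[of c] above[of d] cd dJ C(4,5) by blast
  next
    case False
    then show ?thesis using below[of c] below[of d] cd dJ side C(4,5) by blast
  qed
qed

section \<open>Arcs of covers\<close>

text \<open>Encoded by inversions, the arcs of comparable elements can be compared by monotonicity,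
  see \<open>inv_arc_eqI\<close>; \<open>right_pts_inv_arc\<close> gives the reading by
  positions.\<close>

definition inv_arc :: "nat \<Rightarrow> (int \<Rightarrow> int) \<Rightarrow> int \<Rightarrow> int \<Rightarrow> arc" where
  "inv_arc n y q p = Arc p q {c \<in> labels n. p < c \<and> c < q \<and> (q, c) \<in> inversions n y}"

lemma inv_arc_simps [simp]:
  "lower (inv_arc n y q p) = p" "upper (inv_arc n y q p) = q"
  "c \<in> right_pts (inv_arc n y q p) \<longleftrightarrow> c \<in> labels n \<and> p < c \<and> c < q \<and> (q, c) \<in> inversions n y"
  by (auto simp: inv_arc_def)

text \<open>c cannot stand between the neighbours q and p of y. In terms of inversions: one of the
  two pairs is present by splitting (q, p), and if both were, they would already belong to x and
  force (q, p) into x.\<close>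

lemma edge_between:
  assumes e: "edge n x y q p" and c: "c \<in> labels n" "p < c" "c < q"
  shows "(q, c) \<in> inversions n y \<longleftrightarrow> (c, p) \<notin> inversions n y"
proof -
  note D = edgeD[OF e]
  have "(q, c) \<in> inversions n y \<or> (c, p) \<in> inversions n y"
    using biclosedD(6)[OF biclosed_inversions[OF D(2)] D(9)] c by blast
  moreover have False if "(q, c) \<in> inversions n y" "(c, p) \<in> inversions n y"
  proof -
    have "(q, c) \<in> inversions n x" "(c, p) \<in> inversions n x"
      using that D(5) c by auto
    then show False using biclosedD(5)[OF biclosed_inversions[OF D(1)]] D(3) by blast
  qed
  ultimately show ?thesis by blast
qed

text \<open>By \<open>edge_between\<close> the left-hand points are those inverted with p, and
  mirroring such an inversion gives a right-hand point of the mirrored edge.\<close>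

lemma half_turn_inv_arc:
  assumes e: "edge n x y q p"
  shows "half_turn (inv_arc n y q p) = inv_arc n y (- p) (- q)"
proof -
  note D = edgeD[OF e]
  note S = inversionsD(4)[OF D(2)]
  have lab: "c \<in> labels n" if "p < c" "c < q" "c \<noteq> 0" for c
    using that D(6,7) by (auto simp: labels_def)
  have "c \<in> uminus ` left_pts (inv_arc n y q p) \<longleftrightarrow> c \<in> right_pts (inv_arc n y (- p) (- q))" for c
  proof -
    have "c \<in> uminus ` left_pts (inv_arc n y q p) \<longleftrightarrow> - c \<in> left_pts (inv_arc n y q p)"
      by (force simp: image_iff)
    also have "\<dots> \<longleftrightarrow> - c \<in> labels n \<and> p < - c \<and> - c < q \<and> (q, - c) \<notin> inversions n y"
      using lab[of "- c"] by (auto simp: left_pts_def)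
    also have "\<dots> \<longleftrightarrow> - c \<in> labels n \<and> p < - c \<and> - c < q \<and> (- c, p) \<in> inversions n y"
      using edge_between[OF e, of "- c"] by blast
    also have "\<dots> \<longleftrightarrow> c \<in> labels n \<and> - q < c \<and> c < - p \<and> (- p, c) \<in> inversions n y"
      using S[of "- c" p] S[of "- p" c] by auto
    finally show ?thesis by simp
  qed
  then have "uminus ` left_pts (inv_arc n y q p) = right_pts (inv_arc n y (- p) (- q))" by blast
  then show ?thesis by (simp add: half_turn_def inv_arc_def)
qed

lemma edge_consecutive:
  assumes e: "edge n x y q p"
  shows "consecutive n (inv y q) (inv y p)"
proof -
  note D = edgeD[OF e]
  have "covers n y x" using e covers_iff_edge by blast
  then obtain a b where ab: "consecutive n a b" "y a = x b" "y b = x a"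
    "inversions n y = inversions n x \<union> {(x b, x a), (- x a, - x b)}"
    by (rule covers_obtain)
  have "(q, p) = (y a, y b) \<or> (q, p) = (- y b, - y a)"
    using D(3,9) ab(2-4) by auto
  then show ?thesis
    using ab(1) consecutive_uminus[OF ab(1)] signed_permsD(4,6)[OF D(2)] by auto
qed

lemma edge_inv_less:
  assumes e: "edge n x y q p" and c: "c \<in> labels n"
  shows "inv y q < inv y c \<longleftrightarrow> c = p \<or> inv y p < inv y c"
    "inv y c < inv y p \<longleftrightarrow> c = q \<or> inv y c < inv y q"
proof -
  note D = edgeD[OF e]
  have k: "consecutive n (inv y q) (inv y p)" by (rule edge_consecutive[OF e])
  have "\<not> (inv y q < inv y c \<and> inv y c < inv y p)" "inv y q < inv y p"
    using k c signed_permsD(8)[OF D(2), of c] unfolding consecutive_def by blast+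
  then show "inv y q < inv y c \<longleftrightarrow> c = p \<or> inv y p < inv y c"
    "inv y c < inv y p \<longleftrightarrow> c = q \<or> inv y c < inv y q"
    using inv_signed_perm_eq_iff[OF D(2), of c p] inv_signed_perm_eq_iff[OF D(2), of c q] by auto
qed

lemma right_pts_inv_arc:
  assumes e: "edge n x y q p"
  shows "c \<in> right_pts (inv_arc n y q p) \<longleftrightarrow> c \<in> labels n \<and> p < c \<and> c < q \<and> inv y p < inv y c"
  using edge_inv_less(1)[OF e, of c] edgeD(7)[OF e] by (auto simp: inversions_def)

lemma delta_eq:
  assumes y: "y \<in> signed_perms n"
  shows "delta n y = {inv_arc n y (y a) (y b) | a b. consecutive n a b \<and> y b < y a}"
proof -
  have "Arc (y b) (y a) {y c | c. c \<in> labels n \<and> b < c \<and> y b < y c \<and> y c < y a} = inv_arc n y (y a) (y b)"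
    if ab: "consecutive n a b" and lt: "y b < y a" for a b
  proof -
    obtain x where e: "edge n x y (y a) (y b)" by (rule edge_descent[OF y ab lt])
    have "{y c | c. c \<in> labels n \<and> b < c \<and> y b < y c \<and> y c < y a} = right_pts (inv_arc n y (y a) (y b))"
    proof (intro Set.set_eqI)
      fix v
      have "v = y c \<longleftrightarrow> c = inv y v" for c
        using signed_permsD(5)[OF y, of v] signed_permsD(6)[OF y, of c] by auto
      then have "v \<in> {y c | c. c \<in> labels n \<and> b < c \<and> y b < y c \<and> y c < y a} \<longleftrightarrow>
          v \<in> labels n \<and> b < inv y v \<and> y b < v \<and> v < y a"
        using signed_permsD(5,8)[OF y, of v] by auto
      then show "v \<in> {y c | c. c \<in> labels n \<and> b < c \<and> y b < y c \<and> y c < y a} \<longleftrightarrow>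
          v \<in> right_pts (inv_arc n y (y a) (y b))"
        unfolding right_pts_inv_arc[OF e] signed_permsD(6)[OF y] by blast
    qed
    then show ?thesis by (simp add: inv_arc_def)
  qed
  then have "(A = Arc (y b) (y a) {y c | c. c \<in> labels n \<and> b < c \<and> y b < y c \<and> y c < y a} \<and>
      consecutive n a b \<and> y b < y a) =
    (A = inv_arc n y (y a) (y b) \<and> consecutive n a b \<and> y b < y a)" for A a b
    by (cases "consecutive n a b \<and> y b < y a") auto
  then show ?thesis unfolding delta_def by simp
qed

lemma inv_arc_mem_delta:
  assumes e: "edge n x y q p"
  shows "inv_arc n y q p \<in> delta n y"
proof -
  note D = edgeD[OF e]
  show ?thesis
    unfolding delta_eq[OF D(2)] mem_Collect_eq using edge_consecutive[OF e] D(8)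
    by (intro exI[of _ "inv y q"] exI[of _ "inv y p"]) (simp add: signed_permsD(5)[OF D(2)])
qed

section \<open>Join-irreducible elements\<close>

lemma lower_cover_covers: "join_irreducible n j \<Longrightarrow> covers n j (lower_cover n j)"
  unfolding join_irreducible_def lower_cover_def by (metis theI')

lemma lower_cover_eqI: "join_irreducible n j \<Longrightarrow> covers n j x \<Longrightarrow> x = lower_cover n j"
  using lower_cover_covers unfolding join_irreducible_def by blast

text \<open>Every descent yields a lower cover, so there is no descent but the one at a, b and its
  mirror image, and away from these the word increases. The middle run is empty for b = 1.\<close>

lemma join_irreducible_structure:
  assumes ji: "join_irreducible n j"
  obtains a b where "consecutive n a b" "1 \<le> b" "edge n (lower_cover n j) j (j a) (j b)"
    "delta n j = {inv_arc n j (j a) (j b), half_turn (inv_arc n j (j a) (j b))}"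
    "\<And>c d. c \<in> labels n \<Longrightarrow> d \<in> labels n \<Longrightarrow> c < d \<Longrightarrow> b \<le> c \<or> d \<le> - b \<or> - b < c \<and> d < b \<Longrightarrow> j c < j d"
proof -
  have j: "j \<in> signed_perms n" using ji by (simp add: join_irreducible_def)
  let ?x = "lower_cover n j"
  obtain a b where ab: "consecutive n a b" "1 \<le> b" "?x a < ?x b" "j a = ?x b" "j b = ?x a"
    "inversions n j = inversions n ?x \<union> {(?x b, ?x a), (- ?x a, - ?x b)}"
    "(?x b, ?x a) \<notin> inversions n ?x"
    by (rule covers_obtain[OF lower_cover_covers[OF ji]])
  have e: "edge n ?x j (j a) (j b)"
    using ab j covers_signed_perms[OF lower_cover_covers[OF ji]] by (simp add: edge_def)
  have desc: "(c = a \<and> d = b) \<or> (c = - b \<and> d = - a)" if cd: "consecutive n c d" and lt: "j d < j c" for c d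
  proof -
    obtain x where x: "edge n x j (j c) (j d)" by (rule edge_descent[OF j cd lt])
    then have "x = ?x" using lower_cover_eqI[OF ji] covers_iff_edge by blast
    then have "(j c, j d) \<in> {(j a, j b), (- j b, - j a)}"
      using edgeD(3,9)[OF x] edgeD(5)[OF e] by blast
    then have "(inv j (j c), inv j (j d)) \<in> {(inv j (j a), inv j (j b)), (inv j (- j b), inv j (- j a))}"
      by auto
    then show ?thesis by (simp add: signed_permsD(4,6)[OF j])
  qed
  have "delta n j = {inv_arc n j (j a) (j b), inv_arc n j (- j b) (- j a)}"
  proof
    show "delta n j \<subseteq> {inv_arc n j (j a) (j b), inv_arc n j (- j b) (- j a)}"
    proof
      fix A assume "A \<in> delta n j"
      then obtain c d where cd: "consecutive n c d" "j d < j c" "A = inv_arc n j (j c) (j d)"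
        unfolding delta_eq[OF j] by blast
      show "A \<in> {inv_arc n j (j a) (j b), inv_arc n j (- j b) (- j a)}"
        using desc[OF cd(1,2)] cd(3) signed_permsD(3)[OF j] by auto
    qed
    show "{inv_arc n j (j a) (j b), inv_arc n j (- j b) (- j a)} \<subseteq> delta n j"
      using inv_arc_mem_delta[OF e] inv_arc_mem_delta[OF edge_uminus[OF e]] by simp
  qed
  then have d: "delta n j = {inv_arc n j (j a) (j b), half_turn (inv_arc n j (j a) (j b))}"
    using half_turn_inv_arc[OF e] by simp
  show thesis
  proof (rule that[OF ab(1,2) e d])
    fix c d assume cd: "c \<in> labels n" "d \<in> labels n" "c < d"
      and r: "b \<le> c \<or> d \<le> - b \<or> - b < c \<and> d < b"
    show "j c < j d"
    proof (rule consecutive_chain[OF cd])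
      fix c' d' assume *: "consecutive n c' d'" "c \<le> c'" "d' \<le> d"
      have lt: "c' < d'" using *(1) by (simp add: consecutive_def)
      have "\<not> j d' < j c'"
        using desc[OF *(1)] r *(2,3) ab(1) \<open>1 \<le> b\<close> lt by (auto simp: consecutive_iff)
      moreover have "j c' \<noteq> j d'" using lt signed_permsD(6)[OF j] by (metis less_irrefl)
      ultimately show "j c' < j d'" by linarith
    qed (rule less_trans)
  qed
qed

section \<open>Subarcs, combinatorially\<close>

text \<open>For overlapping \<open>\<alpha>\<close> the conditions on \<open>right_pts\<close> say that \<open>\<alpha>\<close> lies to the right of
  \<open>-\<alpha>\<close>: the good arcs are the symmetric arcs and the arcs of symmetric pairs obeying the labeling
  convention, see \<open>symmetric_arc_iff\<close> and \<open>labeled_pair_iff\<close>.  The last condition in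
  \<open>good_subarc\<close> is there because an overlapping pair is never a subarc pair of a symmetric arc.\<close>

definition good_arc :: "nat \<Rightarrow> arc \<Rightarrow> bool" where
  "good_arc n \<alpha> \<longleftrightarrow> is_arc n \<alpha> \<and> (lower \<alpha> = - upper \<alpha> \<longrightarrow> half_turn \<alpha> = \<alpha>) \<and>
     (\<forall>c\<in>right_pts \<alpha>. - c \<notin> right_pts \<alpha>) \<and> - lower \<alpha> \<notin> right_pts \<alpha> \<and> - upper \<alpha> \<notin> right_pts \<alpha>"

definition good_subarc :: "nat \<Rightarrow> arc \<Rightarrow> arc \<Rightarrow> bool" where
  "good_subarc n \<beta> \<alpha> \<longleftrightarrow> good_arc n \<beta> \<and> good_arc n \<alpha> \<and> lower \<alpha> \<le> lower \<beta> \<and> upper \<beta> \<le> upper \<alpha> \<and>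
     right_pts \<beta> = right_pts \<alpha> \<inter> {lower \<beta><..<upper \<beta>} \<and>
     (half_turn \<alpha> = \<alpha> \<and> overlapping \<beta> \<longrightarrow> half_turn \<beta> = \<beta>)"

text \<open>Both choices are left open: either arc of a non-overlapping pair is good, but at most
  one arc of an overlapping pair, see \<open>good_arc_half_turn\<close>.\<close>

definition subarc_set :: "nat \<Rightarrow> arc set \<Rightarrow> arc set \<Rightarrow> bool" where
  "subarc_set n B A \<longleftrightarrow> (\<exists>\<beta>\<in>B. \<exists>\<alpha>\<in>A. good_subarc n \<beta> \<alpha>)"

lemma half_turn_simps [simp]:
  "lower (half_turn \<alpha>) = - upper \<alpha>" "upper (half_turn \<alpha>) = - lower \<alpha>"
  "c \<in> right_pts (half_turn \<alpha>) \<longleftrightarrow> - upper \<alpha> < c \<and> c < - lower \<alpha> \<and> c \<noteq> 0 \<and> - c \<notin> right_pts \<alpha>"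
  by (auto simp: half_turn_def left_pts_def image_iff intro: bexI[of _ "- c"])

lemma arc_eqI: "lower \<alpha> = lower \<beta> \<Longrightarrow> upper \<alpha> = upper \<beta> \<Longrightarrow> right_pts \<alpha> = right_pts \<beta> \<Longrightarrow> \<alpha> = \<beta>"
  by (cases \<alpha>; cases \<beta>) simp

lemma is_arcD:
  assumes "is_arc n \<alpha>"
  shows "lower \<alpha> \<in> labels n" "upper \<alpha> \<in> labels n" "lower \<alpha> < upper \<alpha>" "lower \<alpha> \<noteq> 0" "upper \<alpha> \<noteq> 0"
    "c \<in> right_pts \<alpha> \<Longrightarrow> lower \<alpha> < c" "c \<in> right_pts \<alpha> \<Longrightarrow> c < upper \<alpha>" "c \<in> right_pts \<alpha> \<Longrightarrow> c \<noteq> 0"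
  using assms by (auto simp: is_arc_def)

lemma half_turn_half_turn: "is_arc n \<alpha> \<Longrightarrow> half_turn (half_turn \<alpha>) = \<alpha>"
  by (rule arc_eqI) (auto dest: is_arcD)

lemma is_arc_half_turn: "is_arc n \<alpha> \<Longrightarrow> is_arc n (half_turn \<alpha>)"
  unfolding is_arc_def by auto

lemma good_subarcD:
  assumes "good_subarc n \<beta> \<alpha>"
  shows "good_arc n \<beta>" "good_arc n \<alpha>" "lower \<alpha> \<le> lower \<beta>" "upper \<beta> \<le> upper \<alpha>"
    "right_pts \<beta> = right_pts \<alpha> \<inter> {lower \<beta><..<upper \<beta>}"
    "half_turn \<alpha> = \<alpha> \<Longrightarrow> overlapping \<beta> \<Longrightarrow> half_turn \<beta> = \<beta>"
  using assms unfolding good_subarc_def by blast+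

lemma good_subarc_trans:
  assumes "good_subarc n \<gamma> \<beta>" "good_subarc n \<beta> \<alpha>"
  shows "good_subarc n \<gamma> \<alpha>"
proof -
  note g = good_subarcD[OF assms(1)] and b = good_subarcD[OF assms(2)]
  have o: "overlapping \<gamma> \<Longrightarrow> overlapping \<beta>"
    using g(3,4) unfolding overlapping_def by auto
  have R: "right_pts \<gamma> = right_pts \<alpha> \<inter> {lower \<gamma><..<upper \<gamma>}"
    using g(3,4) by (subst g(5), subst b(5)) auto
  show ?thesis
    unfolding good_subarc_def using g(1,3,4,6) b(2,3,4,6) o R order_trans by blast
qed

lemma good_arc_nonoverlapping: "is_arc n \<alpha> \<Longrightarrow> \<not> overlapping \<alpha> \<Longrightarrow> good_arc n \<alpha>"
  using is_arcD[of n \<alpha>] unfolding good_arc_def overlapping_def by (smt (verit))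

text \<open>Let e be the endpoint of smaller absolute value. Then -e lies within the heights of
  \<alpha>. It is to the left of \<alpha>, as \<alpha> is good, so e is to the right of -\<alpha>,
  which goodness of -\<alpha> forbids.\<close>

lemma good_arc_half_turn:
  assumes "good_arc n \<alpha>" "good_arc n (half_turn \<alpha>)" "half_turn \<alpha> \<noteq> \<alpha>"
  shows "\<not> overlapping \<alpha>"
proof
  assume o: "overlapping \<alpha>"
  have a: "is_arc n \<alpha>" using assms by (simp add: good_arc_def)
  note D = is_arcD[OF a]
  have ne: "lower \<alpha> \<noteq> - upper \<alpha>" using assms by (auto simp: good_arc_def)
  have "- lower \<alpha> \<notin> right_pts \<alpha>" "- upper \<alpha> \<notin> right_pts \<alpha>"
    "lower \<alpha> \<notin> right_pts (half_turn \<alpha>)" "upper \<alpha> \<notin> right_pts (half_turn \<alpha>)"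
    using assms unfolding good_arc_def by auto
  then show False using ne o D(3) unfolding overlapping_def by auto
qed

text \<open>Without overlap every arc is good, so turning loses nothing; of an overlapping pair,
  turning would produce the left-hand arc.\<close>

lemma good_subarc_half_turn:
  assumes s: "good_subarc n \<beta> \<alpha>" and no: "\<not> overlapping \<alpha>"
  shows "good_subarc n (half_turn \<beta>) (half_turn \<alpha>)"
proof -
  have a: "is_arc n \<alpha>" "is_arc n \<beta>" using s by (auto simp: good_subarc_def good_arc_def)
  note D = is_arcD[OF a(1)] is_arcD[OF a(2)]
  note S = good_subarcD[OF s]
  have nb: "\<not> overlapping (half_turn \<beta>)" and na: "\<not> overlapping (half_turn \<alpha>)"
    using no S(3,4) unfolding overlapping_def by auto
  have "right_pts (half_turn \<beta>) =
      right_pts (half_turn \<alpha>) \<inter> {lower (half_turn \<beta>)<..<upper (half_turn \<beta>)}"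
  proof (intro Set.set_eqI)
    fix c
    have "- c \<in> right_pts \<beta> \<longleftrightarrow> - c \<in> right_pts \<alpha> \<and> lower \<beta> < - c \<and> - c < upper \<beta>"
      by (subst S(5)) auto
    then show "c \<in> right_pts (half_turn \<beta>) \<longleftrightarrow>
        c \<in> right_pts (half_turn \<alpha>) \<inter> {lower (half_turn \<beta>)<..<upper (half_turn \<beta>)}"
      using S(3,4) by auto
  qed
  then show ?thesis
    using nb S(3,4) good_arc_nonoverlapping[OF is_arc_half_turn[OF a(1)] na]
      good_arc_nonoverlapping[OF is_arc_half_turn[OF a(2)] nb]
    unfolding good_subarc_def half_turn_simps(1,2) by simp
qed

text \<open>The two hypotheses may use different arcs of the middle pair. Then both of its arcs are
  good, so it does not overlap, and the first subarc relation can be turned.\<close>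

lemma subarc_set_trans:
  assumes \<gamma>: "is_arc n \<gamma>" and \<beta>: "is_arc n \<beta>"
    and 1: "subarc_set n {\<gamma>, half_turn \<gamma>} {\<beta>, half_turn \<beta>}" and 2: "subarc_set n {\<beta>, half_turn \<beta>} A"
  shows "subarc_set n {\<gamma>, half_turn \<gamma>} A"
proof -
  obtain \<gamma>' \<beta>\<^sub>1 where g: "\<gamma>' \<in> {\<gamma>, half_turn \<gamma>}" "\<beta>\<^sub>1 \<in> {\<beta>, half_turn \<beta>}" "good_subarc n \<gamma>' \<beta>\<^sub>1"
    using 1 unfolding subarc_set_def by blast
  obtain \<beta>\<^sub>2 \<alpha> where b: "\<beta>\<^sub>2 \<in> {\<beta>, half_turn \<beta>}" "\<alpha> \<in> A" "good_subarc n \<beta>\<^sub>2 \<alpha>"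
    using 2 unfolding subarc_set_def by blast
  show ?thesis
  proof (cases "\<beta>\<^sub>1 = \<beta>\<^sub>2")
    case True
    then show ?thesis using g b good_subarc_trans unfolding subarc_set_def by blast
  next
    case False
    have good: "good_arc n \<beta>\<^sub>1" "good_arc n \<beta>\<^sub>2"
      using g b by (auto simp: good_subarc_def)
    have h: "half_turn \<beta>\<^sub>1 = \<beta>\<^sub>2" using False g(2) b(1) half_turn_half_turn[OF \<beta>] by auto
    have "\<not> overlapping \<beta>\<^sub>1" using good_arc_half_turn[of n \<beta>\<^sub>1] good h False by auto
    then have "good_subarc n (half_turn \<gamma>') \<alpha>"
      using good_subarc_half_turn[OF g(3)] h good_subarc_trans b(3) by auto
    moreover have "half_turn \<gamma>' \<in> {\<gamma>, half_turn \<gamma>}"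
      using g(1) half_turn_half_turn[OF \<gamma>] by auto
    ultimately show ?thesis using b(2) unfolding subarc_set_def by blast
  qed
qed

text \<open>Reflection in a horizontal line, which unlike \<open>half_turn\<close> keeps the sides.
  It is the effect of \<open>neg\<close> on labels, see \<open>flip_arcs_of\<close>, and it
  exchanges the roles of upper and lower endpoints.\<close>

definition flip :: "arc \<Rightarrow> arc" where
  "flip \<alpha> = Arc (- upper \<alpha>) (- lower \<alpha>) (uminus ` right_pts \<alpha>)"

lemma flip_simps [simp]:
  "lower (flip \<alpha>) = - upper \<alpha>" "upper (flip \<alpha>) = - lower \<alpha>"
  "c \<in> right_pts (flip \<alpha>) \<longleftrightarrow> - c \<in> right_pts \<alpha>"
  by (auto simp: flip_def image_iff intro: bexI[of _ "- c"])

lemma flip_flip [simp]: "flip (flip \<alpha>) = \<alpha>"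
  by (rule arc_eqI) auto

lemma is_arc_flip: "is_arc n \<alpha> \<Longrightarrow> is_arc n (flip \<alpha>)"
  by (auto simp: is_arc_def subset_iff)

lemma flip_half_turn: "is_arc n \<alpha> \<Longrightarrow> flip (half_turn \<alpha>) = half_turn (flip \<alpha>)"
  by (rule arc_eqI) auto

lemma flip_sym_iff: "is_arc n \<alpha> \<Longrightarrow> half_turn (flip \<alpha>) = flip \<alpha> \<longleftrightarrow> half_turn \<alpha> = \<alpha>"
  using flip_half_turn flip_flip by metis

lemma good_arc_flip: "good_arc n \<alpha> \<Longrightarrow> good_arc n (flip \<alpha>)"
  unfolding good_arc_def using is_arc_flip flip_sym_iff[of n \<alpha>] by auto

lemma good_subarc_flip:
  assumes "good_subarc n \<beta> \<alpha>"
  shows "good_subarc n (flip \<beta>) (flip \<alpha>)"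
proof -
  note S = good_subarcD[OF assms]
  have "is_arc n \<alpha>" "is_arc n \<beta>" using S(1,2) by (auto simp: good_arc_def)
  note f = flip_sym_iff[OF this(1)] flip_sym_iff[OF this(2)]
  have "overlapping (flip \<beta>) \<longleftrightarrow> overlapping \<beta>" by (auto simp: overlapping_def)
  moreover have "right_pts (flip \<beta>) = right_pts (flip \<alpha>) \<inter> {lower (flip \<beta>)<..<upper (flip \<beta>)}"
  proof (intro Set.set_eqI)
    fix c
    have "- c \<in> right_pts \<beta> \<longleftrightarrow> - c \<in> right_pts \<alpha> \<and> lower \<beta> < - c \<and> - c < upper \<beta>"
      by (subst S(5)) auto
    then show "c \<in> right_pts (flip \<beta>) \<longleftrightarrow>
        c \<in> right_pts (flip \<alpha>) \<inter> {lower (flip \<beta>)<..<upper (flip \<beta>)}" by auto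
  qed
  ultimately show ?thesis
    using S(3,4,6) good_arc_flip[OF S(1)] good_arc_flip[OF S(2)] f
    unfolding good_subarc_def flip_simps(1,2) by simp
qed

lemma subarc_set_flip: "subarc_set n (flip ` B) (flip ` A) \<longleftrightarrow> subarc_set n B A"
proof -
  have "subarc_set n (flip ` B) (flip ` A)" if "subarc_set n B A" for A B
    using that good_subarc_flip unfolding subarc_set_def by blast
  from this[of B A] this[of "flip ` B" "flip ` A"] show ?thesis by (auto simp: image_image)
qed

section \<open>Labels of covers\<close>

definition arcs_of :: "nat \<Rightarrow> (int \<Rightarrow> int) \<Rightarrow> int \<Rightarrow> int \<Rightarrow> arc set" where
  "arcs_of n y q p = {inv_arc n y q p, inv_arc n y (- p) (- q)}"

lemma arcs_of_uminus: "arcs_of n y (- p) (- q) = arcs_of n y q p"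
  by (auto simp: arcs_of_def)

lemma is_arc_inv_arc: "edge n x y q p \<Longrightarrow> is_arc n (inv_arc n y q p)"
  using edgeD(6-8)[of n x y q p] by (auto simp: is_arc_def)

lemma arcs_of_eq: "edge n x y q p \<Longrightarrow> arcs_of n y q p = {inv_arc n y q p, half_turn (inv_arc n y q p)}"
  by (simp add: arcs_of_def half_turn_inv_arc)

text \<open>Negation reverses the edge, so its new top is \<open>neg n x\<close>. By
  \<open>edge_between\<close> a right-hand point is one not inverted with p, and negation makes this
  an inversion.\<close>

lemma flip_inv_arc:
  assumes e: "edge n x y q p"
  shows "flip (inv_arc n y q p) = inv_arc n (neg n x) (- p) (- q)"
proof (rule arc_eqI)
  note D = edgeD[OF e]
  show "right_pts (flip (inv_arc n y q p)) = right_pts (inv_arc n (neg n x) (- p) (- q))"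
  proof (intro Set.set_eqI)
    fix c
    have "- c \<in> labels n \<and> p < - c \<and> - c < q \<and> (q, - c) \<in> inversions n y \<longleftrightarrow>
        - c \<in> labels n \<and> p < - c \<and> - c < q \<and> (- c, p) \<notin> inversions n x"
      using edge_between[OF e, of "- c"] D(5) by fastforce
    moreover have "(- c, p) \<in> inversions n x \<longleftrightarrow> (- p, c) \<in> inversions n x"
      using inversionsD(4)[OF D(1), of "- c" p] inversionsD(4)[OF D(1), of "- p" c] by auto
    ultimately show "c \<in> right_pts (flip (inv_arc n y q p)) \<longleftrightarrow>
        c \<in> right_pts (inv_arc n (neg n x) (- p) (- q))"
      using D(6,7) by (auto simp: inversions_neg_iff[OF D(1)])
  qed
qed simp_all

lemma flip_arcs_of:
  assumes e: "edge n x y q p"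
  shows "flip ` arcs_of n y q p = arcs_of n (neg n x) q p"
  using flip_inv_arc[OF e] flip_inv_arc[OF edge_uminus[OF e]] by (auto simp: arcs_of_def)

lemma delta_join_irreducible:
  assumes ji: "join_irreducible n j" and e: "edge n x j q p"
  shows "delta n j = arcs_of n j q p" "x = lower_cover n j"
proof -
  show x: "x = lower_cover n j" using lower_cover_eqI[OF ji] e covers_iff_edge by blast
  obtain a b where e': "edge n (lower_cover n j) j (j a) (j b)" and
    d: "delta n j = {inv_arc n j (j a) (j b), half_turn (inv_arc n j (j a) (j b))}"
    by (rule join_irreducible_structure[OF ji])
  have "(q, p) = (j a, j b) \<or> (q, p) = (- j b, - j a)"
    using edgeD(3,9)[OF e] edgeD(5)[OF e'] x by blast
  then show "delta n j = arcs_of n j q p"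
    using d arcs_of_eq[OF e'] arcs_of_uminus[of n j "j b" "j a"] by auto
qed

text \<open>Unless the arc lies on one side of 0, p stands at a positive position. The right-hand
  points stand after p, so their negatives, like -p, stand at negative positions and are not on the
  right.\<close>

lemma good_arc_inv_arc:
  assumes e: "edge n x y q p" and c: "0 < p \<or> q < 0 \<or> q = - p \<or> 0 < inv y q"
  shows "good_arc n (inv_arc n y q p)"
proof (cases "0 < p \<or> q < 0")
  case True
  then show ?thesis
    by (intro good_arc_nonoverlapping is_arc_inv_arc[OF e]) (auto simp: overlapping_def)
next
  case False
  note D = edgeD[OF e]
  note R = right_pts_inv_arc[OF e]
  note odd = signed_permsD(4)[OF D(2)]
  have lt: "inv y q < inv y p" using D(9) by (auto simp: inversions_def)
  then have pos: "0 < inv y p" using c False odd[of p] by auto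
  have "half_turn (inv_arc n y q p) = inv_arc n y q p" if "p = - q"
    using half_turn_inv_arc[OF e] that by simp
  moreover have "- q \<notin> right_pts (inv_arc n y q p)"
    using c False pos lt odd[of q] unfolding R by auto
  moreover have pc: "0 < inv y c" if "c \<in> right_pts (inv_arc n y q p)" for c
    using that pos unfolding R by simp
  then have "- c \<notin> right_pts (inv_arc n y q p)" if "c \<in> right_pts (inv_arc n y q p) \<or> c = p" for c
    using that pos odd[of c] by (metis less_asym neg_less_0_iff_less)
  ultimately show ?thesis
    using is_arc_inv_arc[OF e] unfolding good_arc_def inv_arc_simps(1,2) by blast
qed

text \<open>The long one-line notation of a join-irreducible element consists of three increasing runs
  (two if it corresponds to a symmetric arc).  The cases below are the possible pairs of runs
  containing the inverted values \<open>q\<close> and \<open>p\<close>.\<close>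

lemma join_irreducible_above_edge:
  assumes ji: "join_irreducible n j" and e: "edge n x y q p"
    and qp: "(q, p) \<in> inversions n j" and le: "inversions n j \<subseteq> inversions n y"
  shows "subarc_set n (arcs_of n y q p) (delta n j)"
proof -
  have j: "j \<in> signed_perms n" using ji by (simp add: join_irreducible_def)
  obtain a b where ab: "consecutive n a b" "1 \<le> b" and ej: "edge n (lower_cover n j) j (j a) (j b)"
    and del: "delta n j = {inv_arc n j (j a) (j b), half_turn (inv_arc n j (j a) (j b))}"
    and mono: "\<And>c d. c \<in> labels n \<Longrightarrow> d \<in> labels n \<Longrightarrow> c < d \<Longrightarrow>
        b \<le> c \<or> d \<le> - b \<or> - b < c \<and> d < b \<Longrightarrow> j c < j d"
    by (rule join_irreducible_structure[OF ji]) blast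
  define P where "P = inv j"
  define s where "s = j a"
  define t where "t = j b"
  define \<alpha> where "\<alpha> = inv_arc n j s t"
  note ej = ej[folded s_def t_def]
  have \<alpha>: "\<alpha> \<in> delta n j" unfolding del \<alpha>_def s_def t_def by simp
  have Pst: "P s = a" "P t = b" by (simp_all add: P_def s_def t_def signed_permsD(6)[OF j])
  have Podd: "P (- v) = - P v" for v by (simp add: P_def signed_permsD(4)[OF j])
  have Plab: "P v \<in> labels n \<longleftrightarrow> v \<in> labels n" for v by (simp add: P_def signed_permsD(8)[OF j])
  have Pinj: "P u = P v \<longleftrightarrow> u = v" for u v by (simp add: P_def inv_signed_perm_eq_iff[OF j])
  have st: "s \<in> labels n" "t \<in> labels n" "t < s" using edgeD[OF ej] by auto
  have a_cases: "a = b - 1 \<and> 1 \<le> a \<or> a = -1 \<and> b = 1"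
    using ab unfolding consecutive_iff labels_def by auto
  have pmono: "u < v" if "u \<in> labels n" "v \<in> labels n" "P u < P v"
    "b \<le> P u \<or> P v \<le> - b \<or> - b < P u \<and> P v < b" for u v
    using mono[of "P u" "P v"] that Plab by (simp add: P_def signed_permsD(5)[OF j])
  have good\<alpha>: "good_arc n \<alpha>"
    unfolding \<alpha>_def
    by (rule good_arc_inv_arc[OF ej]) (use a_cases Pst Podd[of t] Pinj[of s "- t"] in \<open>auto simp: P_def\<close>)
  have inv_y: "inv y u < inv y v" if "u \<in> labels n" "v \<in> labels n" "v < u" "P u < P v" for u v
    using that le by (auto simp: inversions_def P_def)
  \<comment> \<open>The main case: p in the last run of j and q before it. Inversions of j persist
    in y, so a point c between p and q that stands after p in y is in the last run of j, and one
    that stands before q in y is not; hence c is on the same side of both arcs.\<close>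
  have core: "good_subarc n (inv_arc n y q p) \<alpha>"
    if e: "edge n x y q p" and ts: "t \<le> p" "q \<le> s" and Ppq: "b \<le> P p" "P q < b"
      and good: "0 < p \<or> q < 0 \<or> q = - p \<or> 0 < inv y q"
      and sym: "a = -1 \<Longrightarrow> p < 0 \<Longrightarrow> 0 < q \<Longrightarrow> q = - p" for q p
  proof -
    note D = edgeD[OF e]
    have "right_pts (inv_arc n y q p) = right_pts \<alpha> \<inter> {p<..<q}"
    proof (intro Set.set_eqI)
      fix c
      show "c \<in> right_pts (inv_arc n y q p) \<longleftrightarrow> c \<in> right_pts \<alpha> \<inter> {p<..<q}"
      proof (cases "c \<in> labels n \<and> p < c \<and> c < q")
        case True
        have R: "c \<in> right_pts \<alpha> \<longleftrightarrow> P t < P c"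
          unfolding \<alpha>_def right_pts_inv_arc[OF ej] using True ts by (auto simp: P_def)
        have L: "c \<in> right_pts (inv_arc n y q p) \<longleftrightarrow> inv y p < inv y c"
          unfolding right_pts_inv_arc[OF e] using True by auto
        have "P p \<le> P c" if "inv y p < inv y c"
          using that inv_y[of c p] True D(6,7) by force
        moreover have "P c \<le> P q" if "\<not> inv y p < inv y c"
          using that inv_y[of q c] edge_inv_less(1)[OF e, of c] True D(6,7) by force
        moreover have "P p \<noteq> P c" using Pinj True by auto
        ultimately show ?thesis using True R L Ppq Pst by auto
      next
        case False
        then show ?thesis by (auto simp: \<alpha>_def)
      qed
    qed
    moreover have "half_turn (inv_arc n y q p) = inv_arc n y q p"
      if "half_turn \<alpha> = \<alpha>" "overlapping (inv_arc n y q p)"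
    proof -
      have "t = - s" using arg_cong[OF that(1), of lower] by (simp add: \<alpha>_def)
      then have "a = -1" using Podd[of s] Pst a_cases by auto
      then have "q = - p" using sym that(2) by (simp add: overlapping_def)
      then show ?thesis using half_turn_inv_arc[OF e] by simp
    qed
    ultimately show ?thesis
      using good_arc_inv_arc[OF e good] good\<alpha> ts by (simp add: good_subarc_def \<alpha>_def)
  qed
  have coreI: "subarc_set n (arcs_of n y q p) (delta n j)"
    if "good_subarc n (inv_arc n y q p) \<alpha> \<or> good_subarc n (inv_arc n y (- p) (- q)) \<alpha>"
    using that \<alpha> unfolding subarc_set_def arcs_of_def by blast
  note D = edgeD[OF e]
  note Yodd = signed_permsD(4)[OF D(2)]
  have adj: "inv y c < inv y q \<or> inv y p < inv y c" if "c \<in> labels n" "c \<noteq> p" "c \<noteq> q" for c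
    using edge_inv_less[OF e that(1)] inv_signed_perm_eq_iff[OF D(2), of c q] that by auto
  have Pqp: "P q < P p" using qp by (simp add: inversions_def P_def)
  have ex_pos: "\<not> (- b < P q \<and> P p < b)" "\<not> b \<le> P q" "\<not> P p \<le> - b"
    using pmono[of q p] Pqp D(6-8) by auto
  \<comment> \<open>q in the middle run and p in the last; q in the first run and p in the middle
    one is the mirror image.\<close>
  have II: "subarc_set n (arcs_of n y q p) (delta n j)"
    if e: "edge n x y q p" and *: "- b < P q" "P q < b" "b \<le> P p"
      and pr: "good_subarc n (inv_arc n y q p) \<alpha> \<Longrightarrow> subarc_set n (arcs_of n y q p) (delta n j)" for q p
  proof (rule pr, rule core[OF e])
    note D = edgeD[OF e]
    have adj: "inv y c < inv y q \<or> inv y p < inv y c" if "c \<in> labels n" "c \<noteq> p" "c \<noteq> q" for c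
      using edge_inv_less[OF e that(1)] inv_signed_perm_eq_iff[OF D(2), of c q] that by auto
    have "P q \<noteq> 0" using Plab[of q] D(7) by (metis zero_not_in_labels)
    then have a: "a = b - 1" "1 \<le> a" using * a_cases by auto
    show "t \<le> p" using pmono[of t p] st D(6) * Pst Pinj[of t p] by force
    show "q \<le> s" using pmono[of q s] st D(7) * Pst Pinj[of q s] a by force
    show "b \<le> P p" "P q < b" by (fact *)+
    show "a = -1 \<Longrightarrow> p < 0 \<Longrightarrow> 0 < q \<Longrightarrow> q = - p" using a by simp
    \<comment> \<open>If p < 0 < q, then p stands at a positive position of y. With q at a negative
      one, these neighbours would be the two middle entries, forcing q = -p.\<close>
    show "0 < p \<or> q < 0 \<or> q = - p \<or> 0 < inv y q"
    proof (rule ccontr)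
      assume "\<not> (0 < p \<or> q < 0 \<or> q = - p \<or> 0 < inv y q)"
      then have c: "p < 0" "0 < q" "q \<noteq> - p" "inv y q \<le> 0"
        using D(6,7) by (auto simp: labels_def)
      have "inv y q \<noteq> 0" using signed_permsD(8)[OF D(2), of q] D(7) by (metis zero_not_in_labels)
      then have qn: "inv y q < 0" using c by simp
      have "inv y (- p) < inv y p"
        by (rule inv_y) (use D(6) c * \<open>1 \<le> b\<close> Podd in auto)
      then have "0 < inv y p" by (simp add: Yodd)
      then have "inv y p < inv y (- q)" "inv y (- p) < inv y q"
        using adj[of "- q"] adj[of "- p"] c qn D(6,7) by (auto simp: Yodd)
      then show False by (simp add: Yodd)
    qed
  qed
  consider "- b < P q" "P q < b" "b \<le> P p" | "P q \<le> - b" "- b < P p" "P p < b" | "P q \<le> - b" "b \<le> P p"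
    using ex_pos by linarith
  then show ?thesis
  proof cases
    case 1
    then show ?thesis using II[OF e] coreI by blast
  next
    case 2
    have "subarc_set n (arcs_of n y (- p) (- q)) (delta n j)"
      by (rule II[OF edge_uminus[OF e]]) (use 2 Podd coreI arcs_of_uminus[of n y p q] in auto)
    then show ?thesis using arcs_of_uminus by simp
  next
    case 3
    \<comment> \<open>Here q stands at a negative and p at a positive position of y, so as
      neighbours they are the two middle entries.\<close>
    have overlap: "q = - p" if "p < 0" "0 < q"
    proof (rule ccontr)
      assume ne: "q \<noteq> - p"
      have "inv y q < inv y (- q)" "inv y (- p) < inv y p"
        by (rule inv_y; use D(6,7) that 3 \<open>1 \<le> b\<close> Podd in auto)+
      then have "inv y q < 0" "0 < inv y p" by (auto simp: Yodd)
      then have "inv y p < inv y (- q)" "inv y (- p) < inv y q"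
        using adj[of "- q"] adj[of "- p"] ne D(6,7) that by (auto simp: Yodd)
      then show False by (simp add: Yodd)
    qed
    \<comment> \<open>An entry of the middle run of j with value between p and q would stand between
      the neighbours q and p in y.\<close>
    have outside: "c \<le> p \<or> q \<le> c" if c: "c \<in> labels n" "- b < P c" "P c < b" for c
    proof (rule ccontr)
      assume "\<not> (c \<le> p \<or> q \<le> c)"
      then have "inv y q < inv y c" "inv y c < inv y p"
        using inv_y[of q c] inv_y[of c p] c D(6,7) 3 by auto
      then show False using edge_inv_less(1)[OF e c(1)] \<open>\<not> (c \<le> p \<or> q \<le> c)\<close> by auto
    qed
    have tp: "t \<le> p" using pmono[of t p] st D(6) 3 Pst Pinj[of t p] by force
    have tq: "t \<le> - q" using pmono[of t "- q"] st D(7) 3 Pst Pinj[of t "- q"] Podd by force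
    have sq: "q \<le> s" if "a = -1"
      using pmono[of q s] st D(7) 3 Pst Pinj[of q s] that a_cases by force
    have spos: "0 < s" if "1 \<le> a"
    proof -
      have "- s < s" by (rule pmono) (use st Pst Podd that a_cases in auto)
      then show ?thesis by simp
    qed
    have "p \<noteq> 0" "q \<noteq> 0" using D(6,7) by auto
    \<comment> \<open>For 1 \<le> a the upper endpoint s of \<alpha> is positive. So a negative q is
      below s at once, and for positive p the mirrored arc, with upper endpoint -p, is compared
      instead.\<close>
    then consider "a = -1" | "1 \<le> a" "p < 0" "0 < q" | "1 \<le> a" "q < 0" | "1 \<le> a" "0 < p"
      using a_cases by linarith
    then show ?thesis
    proof cases
      case 1
      show ?thesis
        by (rule coreI, rule disjI1, rule core[OF e])
          (use 3 tp sq 1 overlap D(6,7) \<open>1 \<le> b\<close> in \<open>auto simp: labels_def\<close>)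
    next
      case c2: 2
      have "q \<le> s" using outside[OF st(1)] c2 Pst a_cases spos by auto
      show ?thesis
        by (rule coreI, rule disjI1, rule core[OF e]) (use 3 tp \<open>q \<le> s\<close> c2 overlap \<open>1 \<le> b\<close> in auto)
    next
      case c3: 3
      show ?thesis
        by (rule coreI, rule disjI1, rule core[OF e]) (use 3 tp c3 spos \<open>1 \<le> b\<close> in auto)
    next
      case c4: 4
      show ?thesis
        by (rule coreI, rule disjI2, rule core[OF edge_uminus[OF e]])
          (use 3 tq c4 spos \<open>1 \<le> b\<close> Podd in auto)
    qed
  qed
qed

section \<open>The congruence of a down-set of arcs\<close>

lemma biclosed_pairs: "biclosed n {(q, p). p \<in> labels n \<and> q \<in> labels n \<and> p < q}"
  by (auto simp: biclosed_def)

lemma edge_below: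
  assumes z: "z \<in> signed_perms n" and ne: "inversions n z \<noteq> {}"
  obtains u q p where "edge n u z q p"
proof -
  let ?T = "{(q, p). p \<in> labels n \<and> q \<in> labels n \<and> p < q}"
  note N = neg_signed_perms[OF z]
  have "inversions n z \<subseteq> ?T" by (auto simp: inversions_def)
  then have "inversions n (neg n z) \<subseteq> ?T" "inversions n (neg n z) \<noteq> ?T"
    using ne unfolding N(2) by auto
  then obtain \<sigma> where "covers n \<sigma> (neg n z)"
    by (rule cover_below_biclosed[OF N(1) biclosed_pairs])
  then obtain q p where "edge n (neg n z) \<sigma> q p" using covers_iff_edge by blast
  then have "edge n (neg n \<sigma>) z q p" using edge_neg neg_neg[OF z] by metis
  then show thesis by (rule that)
qed

text \<open>Both sides of the arc are described by inversions: the right one with q, the left one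
  with p. Passing from j up to y can only enlarge each of them, and they are complementary, so
  neither changes.\<close>

lemma inv_arc_eqI:
  assumes ej: "edge n u j q p" and e: "edge n x y q p" and le: "inversions n j \<subseteq> inversions n y"
  shows "inv_arc n j q p = inv_arc n y q p"
proof (rule arc_eqI)
  show "right_pts (inv_arc n j q p) = right_pts (inv_arc n y q p)"
  proof (intro Set.set_eqI)
    fix c
    show "c \<in> right_pts (inv_arc n j q p) \<longleftrightarrow> c \<in> right_pts (inv_arc n y q p)"
      using edge_between[OF e, of c] edge_between[OF ej, of c] le by auto
  qed
qed simp_all

text \<open>Take an element below y that is minimal with inversion (q, p). Each of its lower covers
  loses this inversion, and besides it only the mirror image, so there is one lower cover.\<close>

lemma join_irreducible_of_edge:
  assumes e: "edge n x y q p"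
  obtains j where "join_irreducible n j" "(q, p) \<in> inversions n j" "inversions n j \<subseteq> inversions n y"
    "edge n (lower_cover n j) j q p" "inversions n (lower_cover n j) \<subseteq> inversions n x"
    "delta n j = arcs_of n y q p"
proof -
  note D = edgeD[OF e]
  define Z where "Z = {z \<in> signed_perms n. inversions n z \<subseteq> inversions n y \<and> (q, p) \<in> inversions n z}"
  have "y \<in> Z" using D by (simp add: Z_def)
  then obtain j where jZ: "j \<in> Z" and min: "\<And>z. z \<in> Z \<Longrightarrow> card (inversions n j) \<le> card (inversions n z)"
    using ex_has_least_nat[of "\<lambda>z. z \<in> Z" y "\<lambda>z. card (inversions n z)"] by blast
  then have j: "j \<in> signed_perms n" "inversions n j \<subseteq> inversions n y" "(q, p) \<in> inversions n j"
    by (auto simp: Z_def)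
  have low: "edge n u j q p" if c: "covers n j u" for u
  proof -
    obtain q' p' where e': "edge n u j q' p'" using c covers_iff_edge by blast
    note D' = edgeD[OF e']
    have "card (inversions n u) < card (inversions n j)"
      using covers_inversions_psubset[OF c] finite_biclosed[OF biclosed_inversions[OF j(1)]]
      by (rule psubset_card_mono[rotated])
    then have "u \<notin> Z" using min leD by blast
    then have "(q, p) \<notin> inversions n u"
      using D'(1,5) j(2) unfolding Z_def by blast
    then have "(q, p) = (q', p') \<or> (q, p) = (- p', - q')" using D'(5) j(3) by blast
    then show ?thesis using e' edge_uminus[OF e'] by auto
  qed
  have "inversions n j \<noteq> {}" using j(3) by auto
  then obtain u q' p' where "edge n u j q' p'" by (rule edge_below[OF j(1)])
  then have cu: "covers n j u" using covers_iff_edge by blast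
  have "v = u" if "covers n j v" for v
  proof (rule inversions_inject)
    note U = edgeD[OF low[OF cu]] and V = edgeD[OF low[OF that]]
    show "inversions n v = inversions n u" using U(3-5) V(3-5) by blast
    show "v \<in> signed_perms n" "u \<in> signed_perms n" by (rule U V)+
  qed
  then have ji: "join_irreducible n j"
    using j(1) cu unfolding join_irreducible_def by blast
  have ej: "edge n (lower_cover n j) j q p" using low[OF lower_cover_covers[OF ji]] .
  have "delta n j = arcs_of n y q p"
    using delta_join_irreducible(1)[OF ji ej] inv_arc_eqI[OF ej e j(2)]
      inv_arc_eqI[OF edge_uminus[OF ej] edge_uminus[OF e] j(2)]
    by (simp add: arcs_of_def)
  moreover have "inversions n (lower_cover n j) \<subseteq> inversions n x"
    using edgeD(3-5)[OF ej] D(5) j(2) by blast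
  ultimately show thesis using that ji j ej by blast
qed

text \<open>This is the map f; the map g is represented by its value at \<open>neg n x\<close>, with
  U composed with \<open>flip\<close>.\<close>

definition join_irreducibles_below ::
    "nat \<Rightarrow> (arc set \<Rightarrow> bool) \<Rightarrow> (int \<Rightarrow> int) \<Rightarrow> (int \<Rightarrow> int) set" where
  "join_irreducibles_below n U x =
     {j. join_irreducible n j \<and> U (delta n j) \<and> inversions n j \<subseteq> inversions n x}"

definition down_closed :: "nat \<Rightarrow> (arc set \<Rightarrow> bool) \<Rightarrow> bool" where
  "down_closed n U \<longleftrightarrow> (\<forall>\<beta> \<alpha>. is_arc n \<beta> \<longrightarrow> is_arc n \<alpha> \<longrightarrow>
     subarc_set n {\<beta>, half_turn \<beta>} {\<alpha>, half_turn \<alpha>} \<longrightarrow> U {\<alpha>, half_turn \<alpha>} \<longrightarrow> U {\<beta>, half_turn \<beta>})"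

lemma down_closed_arcs_of:
  assumes "down_closed n U" "edge n x y q p" "edge n x' y' q' p'"
    "subarc_set n (arcs_of n y q p) (arcs_of n y' q' p')" "U (arcs_of n y' q' p')"
  shows "U (arcs_of n y q p)"
  using assms is_arc_inv_arc unfolding down_closed_def arcs_of_eq[OF assms(2)] arcs_of_eq[OF assms(3)]
  by blast

lemma edge_of_join_irreducible:
  assumes "join_irreducible n j"
  obtains q p where "edge n (lower_cover n j) j q p" "delta n j = arcs_of n j q p"
  using lower_cover_covers[OF assms] delta_join_irreducible[OF assms] unfolding covers_iff_edge by blast

text \<open>The element found by \<open>join_irreducible_of_edge\<close> has the label of the cover
  and is below y but not below x. Any element that enters here has the label of the cover as a
  subarc, so its label is outside U if that of the cover is.\<close>

lemma join_irreducibles_below_edge: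
  assumes U: "down_closed n U" and e: "edge n x y q p"
  shows "join_irreducibles_below n U x = join_irreducibles_below n U y \<longleftrightarrow> \<not> U (arcs_of n y q p)"
proof
  assume eq: "join_irreducibles_below n U x = join_irreducibles_below n U y"
  obtain j where j: "join_irreducible n j" "(q, p) \<in> inversions n j" "inversions n j \<subseteq> inversions n y"
    "delta n j = arcs_of n y q p"
    by (rule join_irreducible_of_edge[OF e])
  have "j \<notin> join_irreducibles_below n U x"
    using j(2) edgeD(3)[OF e] by (auto simp: join_irreducibles_below_def)
  then have "j \<notin> join_irreducibles_below n U y" using eq by simp
  then show "\<not> U (arcs_of n y q p)"
    using j by (simp add: join_irreducibles_below_def)
next
  assume nU: "\<not> U (arcs_of n y q p)"
  have "inversions n j \<subseteq> inversions n x"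
    if ji: "join_irreducible n j" and Uj: "U (delta n j)" and le: "inversions n j \<subseteq> inversions n y" for j
  proof (rule ccontr)
    assume "\<not> inversions n j \<subseteq> inversions n x"
    then have "(q, p) \<in> inversions n j \<or> (- p, - q) \<in> inversions n j"
      using le edgeD(5)[OF e] by blast
    then have "(q, p) \<in> inversions n j"
      using inversionsD(4)[of j n "- p" "- q"] ji by (auto simp: join_irreducible_def)
    then have s: "subarc_set n (arcs_of n y q p) (delta n j)"
      by (rule join_irreducible_above_edge[OF ji e _ le])
    obtain q' p' where e': "edge n (lower_cover n j) j q' p'" "delta n j = arcs_of n j q' p'"
      by (rule edge_of_join_irreducible[OF ji])
    show False using down_closed_arcs_of[OF U e e'(1)] s Uj nU unfolding e'(2) by blast
  qed
  then show "join_irreducibles_below n U x = join_irreducibles_below n U y"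
    using edgeD(5)[OF e] unfolding join_irreducibles_below_def by blast
qed

lemma join_irreducibles_below_mono:
  "inversions n x \<subseteq> inversions n y \<Longrightarrow> join_irreducibles_below n U x \<subseteq> join_irreducibles_below n U y"
  unfolding join_irreducibles_below_def by blast

lemma down_closed_flip:
  assumes U: "down_closed n U"
  shows "down_closed n (\<lambda>A. U (flip ` A))"
  unfolding down_closed_def
proof (intro allI impI)
  fix \<beta> \<alpha>
  assume arc: "is_arc n \<beta>" "is_arc n \<alpha>" and s: "subarc_set n {\<beta>, half_turn \<beta>} {\<alpha>, half_turn \<alpha>}"
    and u: "U (flip ` {\<alpha>, half_turn \<alpha>})"
  have "flip ` {\<alpha>, half_turn \<alpha>} = {flip \<alpha>, half_turn (flip \<alpha>)}"
    "flip ` {\<beta>, half_turn \<beta>} = {flip \<beta>, half_turn (flip \<beta>)}"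
    using flip_half_turn[OF arc(1)] flip_half_turn[OF arc(2)] by auto
  then show "U (flip ` {\<beta>, half_turn \<beta>})"
    using U u s[folded subarc_set_flip[of n "{\<beta>, half_turn \<beta>}"]] is_arc_flip[OF arc(1)] is_arc_flip[OF arc(2)]
    unfolding down_closed_def by metis
qed

text \<open>By \<open>join_irreducibles_below_edge\<close>, both for \<open>U\<close> and for its image under \<open>flip\<close>, the
  uncontracted join-irreducible elements below and the uncontracted meet-irreducible elements
  above distinguish the same covers.\<close>

lemma join_irreducibles_below_neg:
  assumes U: "down_closed n U" and "x \<in> signed_perms n" "y \<in> signed_perms n"
    and le: "inversions n x \<subseteq> inversions n y"
    and eq: "join_irreducibles_below n U x = join_irreducibles_below n U y"
  shows "join_irreducibles_below n (\<lambda>A. U (flip ` A)) (neg n x) =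
    join_irreducibles_below n (\<lambda>A. U (flip ` A)) (neg n y)"
proof -
  let ?f = "join_irreducibles_below n U" and ?g = "join_irreducibles_below n (\<lambda>A. U (flip ` A))"
  have "(\<lambda>\<pi> \<sigma>. covers n \<sigma> \<pi>)\<^sup>*\<^sup>* x y" using le_iff_inversions assms by blast
  then show ?thesis
    using eq
  proof induction
    case (step z w)
    obtain q p where e: "edge n z w q p" using step(2) covers_iff_edge by blast
    have "inversions n x \<subseteq> inversions n z"
      using step(1) le_iff_inversions[OF assms(2) edgeD(1)[OF e]] by blast
    \<comment> \<open>f is monotone, so equal values at the ends of the chain make it constant on
      every cover in between.\<close>
    then have fx: "?f x \<subseteq> ?f z" "?f z \<subseteq> ?f w"
      using edgeD(5)[OF e] by (intro join_irreducibles_below_mono; auto)+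
    then have "?f z = ?f w" "?f x = ?f z" using step(4) by auto
    then have "\<not> U (arcs_of n w q p)" using join_irreducibles_below_edge[OF U e] by blast
    moreover have "flip ` arcs_of n (neg n z) q p = arcs_of n w q p"
      using flip_arcs_of[OF e] by (metis (no_types, lifting) flip_flip image_cong image_ident image_image)
    ultimately have "?g (neg n w) = ?g (neg n z)"
      using join_irreducibles_below_edge[OF down_closed_flip[OF U] edge_neg[OF e]] by simp
    then show ?case using step(3) \<open>?f x = ?f z\<close> by simp
  qed simp
qed

lemma inversions_subset_neg_iff:
  assumes "x \<in> signed_perms n" "y \<in> signed_perms n"
  shows "inversions n x \<subseteq> inversions n (neg n y) \<longleftrightarrow> inversions n y \<subseteq> inversions n (neg n x)"
  using inversions_neg_subset_iff[OF neg_signed_perms(1)[OF assms(1)] assms(2)] neg_neg[OF assms(1)] by simp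

lemma congruence_of_down_closed:
  assumes U: "down_closed n U"
  shows "lattice_congruence (weak_order n) {(x, y). x \<in> signed_perms n \<and> y \<in> signed_perms n \<and>
    join_irreducibles_below n U x = join_irreducibles_below n U y}"
    (is "lattice_congruence _ ?\<Theta>")
proof -
  let ?U' = "\<lambda>A. U (flip ` A)"
  let ?f = "join_irreducibles_below n U" and ?g = "\<lambda>x. join_irreducibles_below n ?U' (neg n x)"
  \<comment> \<open>As \<open>flip\<close> is an involution, the comparison of f with g can also be
    used with their roles exchanged.\<close>
  have UU: "(\<lambda>A. ?U' (flip ` A)) = U" by (simp add: image_image)
  note M = weak_order_meet and J = weak_order_join
  have f_meet: "?f (meet (weak_order n) x y) = ?f x \<inter> ?f y"
    if "x \<in> signed_perms n" "y \<in> signed_perms n" for x y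
    using M(2)[OF that] unfolding join_irreducibles_below_def join_irreducible_def by blast
  have g: "?g x = {j. join_irreducible n j \<and> ?U' (delta n j) \<and> inversions n x \<subseteq> inversions n (neg n j)}"
    if "x \<in> signed_perms n" for x
    using inversions_subset_neg_iff[OF _ that] unfolding join_irreducibles_below_def join_irreducible_def
    by blast
  have g_join: "?g (join (weak_order n) x y) = ?g x \<inter> ?g y"
    if "x \<in> signed_perms n" "y \<in> signed_perms n" for x y
    using J(2)[OF that neg_signed_perms(1)]
    unfolding g[OF J(1)[OF that]] g[OF that(1)] g[OF that(2)] join_irreducible_def by blast
  have fg_le: "?f x = ?f y \<longleftrightarrow> ?g x = ?g y"
    if xy: "x \<in> signed_perms n" "y \<in> signed_perms n" "inversions n x \<subseteq> inversions n y" for x y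
    using join_irreducibles_below_neg[OF U xy]
      join_irreducibles_below_neg[OF down_closed_flip[OF U] neg_signed_perms(1)[OF xy(2)] neg_signed_perms(1)[OF xy(1)]]
      inversions_neg_subset_iff[OF xy(2,1)] xy
    unfolding UU neg_neg[OF xy(1)] neg_neg[OF xy(2)] by blast
  have le_meet: "inversions n (meet (weak_order n) x y) \<subseteq> inversions n x"
    "inversions n (meet (weak_order n) x y) \<subseteq> inversions n y"
    "inversions n x \<subseteq> inversions n (join (weak_order n) x y)"
    "inversions n y \<subseteq> inversions n (join (weak_order n) x y)"
    if "x \<in> signed_perms n" "y \<in> signed_perms n" for x y
    using M(2)[OF that M(1)[OF that]] J(2)[OF that J(1)[OF that]] by blast+
  \<comment> \<open>Incomparable elements are linked through their meet if f agrees on them, and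
    through their join if g does, because f and g keep their values there.\<close>
  have fg: "?f x = ?f y \<longleftrightarrow> ?g x = ?g y"
    if x: "x \<in> signed_perms n" and y: "y \<in> signed_perms n" for x y
  proof
    assume eq: "?f x = ?f y"
    let ?m = "meet (weak_order n) x y"
    have "?f ?m = ?f x" "?f ?m = ?f y" using f_meet[OF x y] eq by auto
    then show "?g x = ?g y"
      using fg_le[OF M(1)[OF x y] x] fg_le[OF M(1)[OF x y] y] le_meet[OF x y] by simp
  next
    assume eq: "?g x = ?g y"
    let ?m = "join (weak_order n) x y"
    have "?g ?m = ?g x" "?g ?m = ?g y" using g_join[OF x y] eq by auto
    then show "?f x = ?f y"
      using fg_le[OF x J(1)[OF x y]] fg_le[OF y J(1)[OF x y]] le_meet[OF x y] by simp
  qed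
  have eqv: "equiv (carrier (weak_order n)) ?\<Theta>"
    by (auto simp: equiv_def refl_on_def sym_def trans_def)
  moreover have "(meet (weak_order n) x\<^sub>1 y\<^sub>1, meet (weak_order n) x\<^sub>2 y\<^sub>2) \<in> ?\<Theta>"
    "(join (weak_order n) x\<^sub>1 y\<^sub>1, join (weak_order n) x\<^sub>2 y\<^sub>2) \<in> ?\<Theta>"
    if "(x\<^sub>1, x\<^sub>2) \<in> ?\<Theta>" "(y\<^sub>1, y\<^sub>2) \<in> ?\<Theta>" for x\<^sub>1 x\<^sub>2 y\<^sub>1 y\<^sub>2
  proof -
    have s: "x\<^sub>1 \<in> signed_perms n" "x\<^sub>2 \<in> signed_perms n" "y\<^sub>1 \<in> signed_perms n" "y\<^sub>2 \<in> signed_perms n"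
      and eq: "?f x\<^sub>1 = ?f x\<^sub>2" "?f y\<^sub>1 = ?f y\<^sub>2" using that by simp_all
    have "?f (meet (weak_order n) x\<^sub>1 y\<^sub>1) = ?f (meet (weak_order n) x\<^sub>2 y\<^sub>2)"
      using f_meet[OF s(1,3)] f_meet[OF s(2,4)] eq by simp
    then show "(meet (weak_order n) x\<^sub>1 y\<^sub>1, meet (weak_order n) x\<^sub>2 y\<^sub>2) \<in> ?\<Theta>"
      using M(1)[OF s(1,3)] M(1)[OF s(2,4)] by simp
    have "?g (join (weak_order n) x\<^sub>1 y\<^sub>1) = ?g (join (weak_order n) x\<^sub>2 y\<^sub>2)"
      using g_join[OF s(1,3)] g_join[OF s(2,4)] eq fg[OF s(1,2)] fg[OF s(3,4)] by simp
    then show "(join (weak_order n) x\<^sub>1 y\<^sub>1, join (weak_order n) x\<^sub>2 y\<^sub>2) \<in> ?\<Theta>"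
      using fg[OF J(1)[OF s(1,3)] J(1)[OF s(2,4)]] J(1)[OF s(1,3)] J(1)[OF s(2,4)] by simp
  qed
  ultimately show ?thesis unfolding lattice_congruence_def by (intro conjI allI impI)
qed

text \<open>The descent with 1 \<le> b supplies the good arc: its positions are positive, or they
  are -1 and 1 and the arc is symmetric.\<close>

lemma good_arc_join_irreducible:
  assumes ji: "join_irreducible n j"
  obtains \<alpha> where "good_arc n \<alpha>" "delta n j = {\<alpha>, half_turn \<alpha>}"
proof -
  have j: "j \<in> signed_perms n" using ji by (simp add: join_irreducible_def)
  obtain a b where ab: "consecutive n a b" "1 \<le> b" and e: "edge n (lower_cover n j) j (j a) (j b)"
    and d: "delta n j = {inv_arc n j (j a) (j b), half_turn (inv_arc n j (j a) (j b))}"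
    by (rule join_irreducible_structure[OF ji]) blast
  have "1 \<le> a \<or> a = - 1 \<and> b = 1" using ab unfolding consecutive_iff labels_def by auto
  then have "good_arc n (inv_arc n j (j a) (j b))"
    by (intro good_arc_inv_arc[OF e]) (auto simp: signed_permsD(3,6)[OF j])
  then show thesis using that d by blast
qed

text \<open>For the test congruence, U consists of the labels that do not contain the label of
  \<open>j\<^sub>1\<close>: it contracts \<open>j\<^sub>1\<close>, and it contracts
  \<open>j\<^sub>2\<close> only if the label of \<open>j\<^sub>1\<close> is a subarc of that of
  \<open>j\<^sub>2\<close>.\<close>

lemma forces_imp_subarc_set:
  assumes 1: "join_irreducible n j\<^sub>1" and 2: "join_irreducible n j\<^sub>2" and forces: "forces n j\<^sub>1 j\<^sub>2"
  shows "subarc_set n (delta n j\<^sub>1) (delta n j\<^sub>2)"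
proof -
  obtain \<alpha> where \<alpha>: "good_arc n \<alpha>" "delta n j\<^sub>1 = {\<alpha>, half_turn \<alpha>}"
    by (rule good_arc_join_irreducible[OF 1])
  have arc: "is_arc n \<alpha>" using \<alpha>(1) by (simp add: good_arc_def)
  define U where "U A \<longleftrightarrow> \<not> subarc_set n (delta n j\<^sub>1) A" for A
  have U: "down_closed n U"
    unfolding down_closed_def U_def \<alpha>(2) using subarc_set_trans[OF arc] by blast
  define \<Theta> where "\<Theta> = {(x, y). x \<in> signed_perms n \<and> y \<in> signed_perms n \<and>
    join_irreducibles_below n U x = join_irreducibles_below n U y}"
  have con: "contracts n \<Theta> j \<longleftrightarrow> \<not> U (delta n j)" if ji: "join_irreducible n j" for j
  proof -
    obtain q p where e: "edge n (lower_cover n j) j q p" "delta n j = arcs_of n j q p"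
      by (rule edge_of_join_irreducible[OF ji])
    show ?thesis
      using join_irreducibles_below_edge[OF U e(1)] edgeD(1,2)[OF e(1)] e(2)
      unfolding contracts_def \<Theta>_def by auto
  qed
  have "right_pts \<alpha> \<subseteq> {lower \<alpha><..<upper \<alpha>}" using is_arcD(6,7)[OF arc] by auto
  then have "good_subarc n \<alpha> \<alpha>"
    using \<alpha>(1) unfolding good_subarc_def by auto
  then have "subarc_set n (delta n j\<^sub>1) (delta n j\<^sub>1)"
    using \<alpha>(2) unfolding subarc_set_def by blast
  then have "contracts n \<Theta> j\<^sub>1" using con[OF 1] by (simp add: U_def)
  then have "contracts n \<Theta> j\<^sub>2"
    using forces congruence_of_down_closed[OF U] unfolding forces_def \<Theta>_def by blast
  then show ?thesis using con[OF 2] by (simp add: U_def)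
qed

section \<open>Covers with the same arc are contracted together\<close>

text \<open>I collects inversions forced by the arc: q and the left-hand points stand before p and
  the right-hand points. A label between the two ends of such a pair belongs to one of these groups,
  which gives the splitting.\<close>

lemma inv_arc_trancl_biclosed:
  assumes A: "is_arc n (Arc p q R)"
  defines "I \<equiv> {(l, r). l \<in> labels n \<and> r \<in> labels n \<and> p \<le> r \<and> r < l \<and> l \<le> q \<and>
    l \<notin> R \<and> l \<noteq> p \<and> (r \<in> R \<or> r = p)}"
  shows "biclosed n ((I \<union> (\<lambda>(l, r). (- r, - l)) ` I)\<^sup>+)"
proof (rule biclosed_trancl)
  let ?J = "(\<lambda>(l, r). (- r, - l)) ` I"
  have J: "(l, r) \<in> ?J \<longleftrightarrow> (- r, - l) \<in> I" for l r
    by (force simp: image_iff)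
  fix l r assume lr: "(l, r) \<in> I \<union> ?J"
  then show "r \<in> labels n \<and> l \<in> labels n \<and> r < l \<and> (- r, - l) \<in> I \<union> ?J"
    unfolding Un_iff J by (auto simp: I_def)
  fix c assume c: "c \<in> labels n" "r < c" "c < l"
  have cot: "(l, c) \<in> I \<or> (c, r) \<in> I" if "(l, r) \<in> I" "c \<in> labels n" "r < c" "c < l" for l r c
    using that unfolding I_def by auto
  show "(l, c) \<in> I \<union> ?J \<or> (c, r) \<in> I \<union> ?J"
    using lr cot[of l r c] cot[of "- r" "- l" "- c"] c unfolding Un_iff J by auto
qed

text \<open>A join-irreducible element is determined by its arc. The closure of the forced
  inversions realizes an element z below the top of every edge with this arc, in particular below j;
  it contains (q, p), which the only lower cover of j lacks, so z = j.\<close>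

lemma join_irreducible_le:
  assumes ji: "join_irreducible n j" and ej: "edge n (lower_cover n j) j q p"
    and e: "edge n x y q p" and eq: "inv_arc n j q p = inv_arc n y q p"
  shows "inversions n j \<subseteq> inversions n y"
proof -
  define R where "R = right_pts (inv_arc n y q p)"
  define I where "I = {(l, r). l \<in> labels n \<and> r \<in> labels n \<and> p \<le> r \<and> r < l \<and> l \<le> q \<and>
    l \<notin> R \<and> l \<noteq> p \<and> (r \<in> R \<or> r = p)}"
  have "is_arc n (Arc p q R)"
    using is_arc_inv_arc[OF e] by (simp add: R_def inv_arc_def)
  then have "biclosed n ((I \<union> (\<lambda>(l, r). (- r, - l)) ` I)\<^sup>+)"
    unfolding I_def by (rule inv_arc_trancl_biclosed)
  then obtain z where z: "z \<in> signed_perms n" "inversions n z = (I \<union> (\<lambda>(l, r). (- r, - l)) ` I)\<^sup>+"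
    by (rule biclosed_realize)
  have least: "inversions n z \<subseteq> inversions n w"
    if e: "edge n u w q p" and R: "right_pts (inv_arc n w q p) = R" for u w
  proof -
    note D = edgeD[OF e]
    note B = biclosedD[OF biclosed_inversions[OF D(2)]]
    have qr: "(q, r) \<in> inversions n w" if "r \<in> R \<or> r = p" for r
      using that D(9) unfolding R[symmetric] by auto
    have lp: "(l, p) \<in> inversions n w" if "l \<notin> R" "l \<in> labels n" "p < l" "l \<le> q" for l
      using that edge_between[OF e, of l] D(9) unfolding R[symmetric] by (cases "l = q") auto
    have "(l, r) \<in> inversions n w" if "(l, r) \<in> I" for l r
    proof -
      have l: "l \<in> labels n" "r \<in> labels n" "p \<le> r" "r < l" "l \<le> q" "l \<notin> R" "r \<in> R \<or> r = p"
        using that by (auto simp: I_def)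
      have "inv w l \<le> inv w q"
        using l lp[of l] edge_inv_less(2)[OF e l(1)] by (auto simp: inversions_def)
      moreover have "inv w q < inv w r" using qr[OF l(7)] by (simp add: inversions_def)
      ultimately show ?thesis using l by (simp add: inversions_def)
    qed
    then have "I \<union> (\<lambda>(l, r). (- r, - l)) ` I \<subseteq> inversions n w" using B(4) by auto
    moreover have "trans (inversions n w)" using B(5) by (auto intro: transI)
    ultimately show ?thesis using z(2) trancl_mono_subset trancl_id by metis
  qed
  note Dj = edgeD[OF ej]
  have zj: "inversions n z \<subseteq> inversions n j" using least[OF ej] eq R_def by simp
  have qp: "(q, p) \<in> inversions n z"
  proof -
    have "q \<notin> R" "q \<noteq> p" using Dj(8) by (auto simp: R_def)
    then have "(q, p) \<in> I" using Dj(6-8) by (simp add: I_def)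
    then show ?thesis unfolding z(2) by blast
  qed
  have "inversions n z = inversions n j"
  proof (rule ccontr)
    assume "inversions n z \<noteq> inversions n j"
    then have "(\<lambda>\<pi> \<sigma>. covers n \<sigma> \<pi>)\<^sup>*\<^sup>* z j" "z \<noteq> j"
      using le_iff_inversions[OF z(1) Dj(2)] zj by auto
    then obtain u where u: "(\<lambda>\<pi> \<sigma>. covers n \<sigma> \<pi>)\<^sup>*\<^sup>* z u" "covers n j u"
      by (metis rtranclp.cases)
    then have "u = lower_cover n j" using lower_cover_eqI[OF ji] by blast
    then have "inversions n z \<subseteq> inversions n (lower_cover n j)"
      using u le_iff_inversions[OF z(1) Dj(1)] by simp
    then show False using qp Dj(3) by blast
  qed
  then show ?thesis using least[OF e] R_def by simp
qed

lemma meet_comm: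
  assumes "x \<in> signed_perms n" "y \<in> signed_perms n"
  shows "meet (weak_order n) x y = meet (weak_order n) y x"
proof (rule meet_eqI[OF assms])
  note M = weak_order_meet[OF assms(2,1)]
  show "meet (weak_order n) y x \<in> signed_perms n" by (rule M)
  then show "inversions n (meet (weak_order n) y x) \<subseteq> inversions n x"
    "inversions n (meet (weak_order n) y x) \<subseteq> inversions n y" using M(2) by blast+
  show "inversions n w \<subseteq> inversions n (meet (weak_order n) y x)"
    if "w \<in> signed_perms n" "inversions n w \<subseteq> inversions n x" "inversions n w \<subseteq> inversions n y" for w
    using M(2) that by blast
qed

text \<open>The two covers are perspective: the meets of x and y with j are the lower cover of j and
  j, and the joins of these with x are x and y again.\<close>

lemma contract_edge_iff_join_irreducible:
  assumes cong: "lattice_congruence (weak_order n) \<Theta>"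
    and ej: "edge n (lower_cover n j) j q p"
    and e: "edge n x y q p" and le: "inversions n j \<subseteq> inversions n y"
  shows "(x, y) \<in> \<Theta> \<longleftrightarrow> (lower_cover n j, j) \<in> \<Theta>"
proof
  note C = congruenceD[OF cong] and D = edgeD[OF e] and Dj = edgeD[OF ej]
  have lx: "inversions n (lower_cover n j) \<subseteq> inversions n x"
    using Dj(3-5) D(5) le by blast
  show "(lower_cover n j, j) \<in> \<Theta>" if "(x, y) \<in> \<Theta>"
  proof -
    have "meet (weak_order n) y j = j" by (rule meet_eqI) (use D Dj le in auto)
    moreover have "meet (weak_order n) x j = lower_cover n j"
      using edge_meet[OF ej D(1) lx D(3)] meet_comm[OF D(1) Dj(2)] by simp
    ultimately show ?thesis using C(7)[OF that Dj(2)] by simp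
  qed
  show "(x, y) \<in> \<Theta>" if "(lower_cover n j, j) \<in> \<Theta>"
  proof -
    have "join (weak_order n) (lower_cover n j) x = x" by (rule join_eqI) (use D Dj lx in auto)
    moreover have "join (weak_order n) j x = y"
    proof (rule join_eqI)
      show "inversions n y \<subseteq> inversions n w"
        if "w \<in> signed_perms n" "inversions n j \<subseteq> inversions n w" "inversions n x \<subseteq> inversions n w" for w
        using that Dj(5) D(5) by blast
    qed (use D Dj le in auto)
    ultimately show ?thesis using C(6)[OF that D(1)] by simp
  qed
qed

section \<open>Contraction and forcing of single arcs\<close>

definition contracted :: "nat \<Rightarrow> ((int \<Rightarrow> int) \<times> (int \<Rightarrow> int)) set \<Rightarrow> arc \<Rightarrow> bool" where
  "contracted n \<Theta> \<alpha> \<longleftrightarrow> (\<exists>x y q p. edge n x y q p \<and> inv_arc n y q p = \<alpha> \<and> (x, y) \<in> \<Theta>)"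

lemma contractedI: "edge n x y q p \<Longrightarrow> (x, y) \<in> \<Theta> \<Longrightarrow> inv_arc n y q p = \<alpha> \<Longrightarrow> contracted n \<Theta> \<alpha>"
  unfolding contracted_def by blast

text \<open>All covers with one arc are perspective to the cover of a common join-irreducible
  element, so contracting one of them contracts all.\<close>

lemma contractedD:
  assumes cong: "lattice_congruence (weak_order n) \<Theta>" and c: "contracted n \<Theta> \<alpha>"
    and e: "edge n x y q p" and a: "inv_arc n y q p = \<alpha>"
  shows "(x, y) \<in> \<Theta>"
proof -
  obtain x' y' q' p' where e'': "edge n x' y' q' p'" and a': "inv_arc n y' q' p' = \<alpha>" and m: "(x', y') \<in> \<Theta>"
    using c unfolding contracted_def by blast
  have "q' = q" "p' = p" using a a' by (auto simp: inv_arc_def)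
  then have e': "edge n x' y' q p" and eq: "inv_arc n y' q p = inv_arc n y q p" using e'' a a' by auto
  obtain j where j: "join_irreducible n j" "(q, p) \<in> inversions n j" "inversions n j \<subseteq> inversions n y'"
    "edge n (lower_cover n j) j q p" "inversions n (lower_cover n j) \<subseteq> inversions n x'"
    by (rule join_irreducible_of_edge[OF e'])
  have "inv_arc n j q p = inv_arc n y' q p" by (rule inv_arc_eqI[OF j(4) e' j(3)])
  then have "inversions n j \<subseteq> inversions n y"
    using join_irreducible_le[OF j(1,4) e] eq by simp
  then show ?thesis
    using contract_edge_iff_join_irreducible[OF cong j(4) e] m
      contract_edge_iff_join_irreducible[OF cong j(4) e' j(3)] by blast
qed

lemma contracts_iff_contracted:
  assumes cong: "lattice_congruence (weak_order n) \<Theta>" and ji: "join_irreducible n j"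
    and a: "\<alpha> \<in> delta n j"
  shows "contracts n \<Theta> j \<longleftrightarrow> contracted n \<Theta> \<alpha>"
proof -
  obtain q p where e: "edge n (lower_cover n j) j q p" "delta n j = arcs_of n j q p"
    by (rule edge_of_join_irreducible[OF ji])
  have "contracted n \<Theta> \<alpha> \<longleftrightarrow> (lower_cover n j, j) \<in> \<Theta>"
    if "edge n (lower_cover n j) j q p" "\<alpha> = inv_arc n j q p" for q p
    using contractedD[OF cong _ that(1)] contractedI[OF that(1)] that(2) by blast
  then have "contracted n \<Theta> \<alpha> \<longleftrightarrow> (lower_cover n j, j) \<in> \<Theta>"
    using a e edge_uminus unfolding arcs_of_def by blast
  then show ?thesis
    using congruenceD(4)[OF cong] unfolding contracts_def by blast
qed

definition arc_forces :: "nat \<Rightarrow> arc \<Rightarrow> arc \<Rightarrow> bool" where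
  "arc_forces n \<beta> \<alpha> \<longleftrightarrow>
     (\<forall>\<Theta>. lattice_congruence (weak_order n) \<Theta> \<longrightarrow> contracted n \<Theta> \<beta> \<longrightarrow> contracted n \<Theta> \<alpha>)"

lemma arc_forces_refl: "arc_forces n \<alpha> \<alpha>"
  by (simp add: arc_forces_def)

lemma arc_forces_trans: "arc_forces n \<gamma> \<beta> \<Longrightarrow> arc_forces n \<beta> \<alpha> \<Longrightarrow> arc_forces n \<gamma> \<alpha>"
  by (simp add: arc_forces_def)

lemma congruence_neg:
  assumes cong: "lattice_congruence (weak_order n) \<Theta>"
  shows "lattice_congruence (weak_order n)
    {(x, y). x \<in> signed_perms n \<and> y \<in> signed_perms n \<and> (neg n x, neg n y) \<in> \<Theta>}" (is "lattice_congruence _ ?\<Psi>")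
proof -
  note C = congruenceD[OF cong] and N = neg_signed_perms(1)
  have nm: "neg n (meet (weak_order n) x y) = join (weak_order n) (neg n x) (neg n y)"
    if "x \<in> signed_perms n" "y \<in> signed_perms n" for x y
  proof (rule join_eqI[symmetric])
    note M = weak_order_meet[OF that]
    have le: "inversions n (meet (weak_order n) x y) \<subseteq> inversions n x"
      "inversions n (meet (weak_order n) x y) \<subseteq> inversions n y" using M(2)[OF M(1)] by blast+
    show "neg n x \<in> signed_perms n" "neg n y \<in> signed_perms n"
      "neg n (meet (weak_order n) x y) \<in> signed_perms n" by (intro N that M)+
    show "inversions n (neg n x) \<subseteq> inversions n (neg n (meet (weak_order n) x y))"
      "inversions n (neg n y) \<subseteq> inversions n (neg n (meet (weak_order n) x y))"
      using inversions_neg_subset_iff[OF that(1) M(1)] inversions_neg_subset_iff[OF that(2) M(1)] le by auto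
    fix w assume w: "w \<in> signed_perms n" "inversions n (neg n x) \<subseteq> inversions n w"
      "inversions n (neg n y) \<subseteq> inversions n w"
    then have "inversions n (neg n w) \<subseteq> inversions n (meet (weak_order n) x y)"
      using M(2)[OF N[OF w(1)]] inversions_neg_subset_iff[OF w(1) N[OF that(1)]]
        inversions_neg_subset_iff[OF w(1) N[OF that(2)]] neg_neg that by simp
    then show "inversions n (neg n (meet (weak_order n) x y)) \<subseteq> inversions n w"
      using inversions_neg_subset_iff[OF M(1) N[OF w(1)]] neg_neg[OF w(1)] by simp
  qed
  have nj: "neg n (join (weak_order n) x y) = meet (weak_order n) (neg n x) (neg n y)"
    if "x \<in> signed_perms n" "y \<in> signed_perms n" for x y
    using arg_cong[OF nm[OF N[OF that(1)] N[OF that(2)]], of "neg n"]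
      neg_neg[OF that(1)] neg_neg[OF that(2)] neg_neg[OF weak_order_meet(1)[OF N[OF that(1)] N[OF that(2)]]]
    by simp
  have eqv: "equiv (carrier (weak_order n)) ?\<Psi>"
  proof (rule equivI)
    show "refl_on (carrier (weak_order n)) ?\<Psi>" using C(3) N by (auto simp: refl_on_def)
    show "sym ?\<Psi>" using C(4) by (auto simp: sym_def)
    show "trans ?\<Psi>" using C(5) by (intro transI) blast
    show "?\<Psi> \<subseteq> carrier (weak_order n) \<times> carrier (weak_order n)" by auto
  qed
  have c: "(meet (weak_order n) x\<^sub>1 y\<^sub>1, meet (weak_order n) x\<^sub>2 y\<^sub>2) \<in> \<Theta>"
    "(join (weak_order n) x\<^sub>1 y\<^sub>1, join (weak_order n) x\<^sub>2 y\<^sub>2) \<in> \<Theta>"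
    if "(x\<^sub>1, x\<^sub>2) \<in> \<Theta>" "(y\<^sub>1, y\<^sub>2) \<in> \<Theta>" for x\<^sub>1 x\<^sub>2 y\<^sub>1 y\<^sub>2
    using that cong unfolding lattice_congruence_def by blast+
  show ?thesis
    unfolding lattice_congruence_def
  proof (intro conjI allI impI)
    show "equiv (carrier (weak_order n)) ?\<Psi>" by (rule eqv)
    fix x\<^sub>1 x\<^sub>2 y\<^sub>1 y\<^sub>2 assume "(x\<^sub>1, x\<^sub>2) \<in> ?\<Psi>" "(y\<^sub>1, y\<^sub>2) \<in> ?\<Psi>"
    then have s: "x\<^sub>1 \<in> signed_perms n" "x\<^sub>2 \<in> signed_perms n" "y\<^sub>1 \<in> signed_perms n" "y\<^sub>2 \<in> signed_perms n"
      and t: "(neg n x\<^sub>1, neg n x\<^sub>2) \<in> \<Theta>" "(neg n y\<^sub>1, neg n y\<^sub>2) \<in> \<Theta>" by simp_all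
    show "(meet (weak_order n) x\<^sub>1 y\<^sub>1, meet (weak_order n) x\<^sub>2 y\<^sub>2) \<in> ?\<Psi>"
      using c[OF t] nm[OF s(1,3)] nm[OF s(2,4)] weak_order_meet(1)[OF s(1,3)] weak_order_meet(1)[OF s(2,4)]
      by simp
    show "(join (weak_order n) x\<^sub>1 y\<^sub>1, join (weak_order n) x\<^sub>2 y\<^sub>2) \<in> ?\<Psi>"
      using c[OF t] nj[OF s(1,3)] nj[OF s(2,4)] weak_order_join(1)[OF s(1,3)] weak_order_join(1)[OF s(2,4)]
      by simp
  qed
qed

text \<open>Negation carries congruences to congruences and labels to their reflections; this spares
  the mirror image of each forcing step below.\<close>

lemma arc_forces_flip:
  assumes f: "arc_forces n \<beta> \<alpha>"
  shows "arc_forces n (flip \<beta>) (flip \<alpha>)"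
  unfolding arc_forces_def
proof (intro allI impI)
  fix \<Theta> assume cong: "lattice_congruence (weak_order n) \<Theta>" and c: "contracted n \<Theta> (flip \<beta>)"
  define \<Psi> where "\<Psi> = {(x, y). x \<in> signed_perms n \<and> y \<in> signed_perms n \<and> (neg n x, neg n y) \<in> \<Theta>}"
  have cong': "lattice_congruence (weak_order n) \<Psi>" unfolding \<Psi>_def by (rule congruence_neg[OF cong])
  have mem: "(neg n y, neg n x) \<in> \<Psi> \<longleftrightarrow> (x, y) \<in> \<Theta>" if "x \<in> signed_perms n" "y \<in> signed_perms n" for x y
    using that neg_neg neg_signed_perms(1) congruenceD(4)[OF cong] unfolding \<Psi>_def by auto
  have mem': "(neg n y, neg n x) \<in> \<Theta> \<longleftrightarrow> (x, y) \<in> \<Psi>" if "x \<in> signed_perms n" "y \<in> signed_perms n" for x y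
    using that congruenceD(4)[OF cong] unfolding \<Psi>_def by auto
  obtain x y q p where e: "edge n x y q p" "inv_arc n y q p = flip \<beta>" "(x, y) \<in> \<Theta>"
    using c unfolding contracted_def by blast
  have "edge n (neg n y) (neg n x) (- p) (- q)" "inv_arc n (neg n x) (- p) (- q) = \<beta>"
    "(neg n y, neg n x) \<in> \<Psi>"
    using edge_uminus[OF edge_neg[OF e(1)]] flip_inv_arc[OF e(1)] e mem edgeD(1,2)[OF e(1)] by auto
  then have "contracted n \<Psi> \<beta>" unfolding contracted_def by blast
  then have "contracted n \<Psi> \<alpha>" using f cong' unfolding arc_forces_def by blast
  then obtain x y q p where e: "edge n x y q p" "inv_arc n y q p = \<alpha>" "(x, y) \<in> \<Psi>"
    unfolding contracted_def by blast
  have "edge n (neg n y) (neg n x) (- p) (- q)" "inv_arc n (neg n x) (- p) (- q) = flip \<alpha>"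
    "(neg n y, neg n x) \<in> \<Theta>"
    using edge_uminus[OF edge_neg[OF e(1)]] flip_inv_arc[OF e(1)] e mem' edgeD(1,2)[OF e(1)] by auto
  then show "contracted n \<Theta> (flip \<alpha>)" unfolding contracted_def by blast
qed

section \<open>Hexagons and octagons\<close>

lemma inv_less_edge:
  assumes e: "edge n x y q p" and c: "c \<in> labels n" and d: "d \<in> labels n"
    and ne: "(c, d) \<notin> {(p, q), (q, p), (- p, - q), (- q, - p)}"
  shows "inv y c < inv y d \<longleftrightarrow> inv x c < inv x d"
proof -
  note D = edgeD[OF e]
  have "(u, v) \<in> inversions n y \<longleftrightarrow> (u, v) \<in> inversions n x" if "(u, v) \<in> {(c, d), (d, c)}" for u v
    using D(5) ne that by auto
  then have "before n (inversions n y) c d \<longleftrightarrow> before n (inversions n x) c d"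
    by (simp add: before_def)
  then show ?thesis
    unfolding before_inversions[OF D(1)] before_inversions[OF D(2)] using c d by simp
qed

lemma edge_of_consecutive:
  assumes x: "x \<in> signed_perms n" and "consecutive n (inv x u) (inv x v)" "u < v"
  obtains y where "edge n x y v u"
  using edge_ascent[OF x assms(2)] assms(3) by (auto simp: signed_permsD(5)[OF x])

lemma consecutive_inv_iff:
  assumes x: "x \<in> signed_perms n"
  shows "consecutive n (inv x u) (inv x v) \<longleftrightarrow> u \<in> labels n \<and> v \<in> labels n \<and> inv x u < inv x v \<and>
    (\<forall>c\<in>labels n. \<not> (inv x u < inv x c \<and> inv x c < inv x v))"
proof -
  have "(\<forall>c\<in>labels n. \<not> (inv x u < c \<and> c < inv x v)) \<longleftrightarrow>
      (\<forall>c\<in>labels n. \<not> (inv x u < inv x c \<and> inv x c < inv x v))" (is "?l \<longleftrightarrow> ?r")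
  proof
    assume ?l then show ?r using signed_permsD(8)[OF x] by blast
  next
    assume r: ?r
    show ?l
    proof
      fix c assume "c \<in> labels n"
      then have "x c \<in> labels n" by (simp add: signed_permsD(7)[OF x])
      then show "\<not> (inv x u < c \<and> c < inv x v)" using r signed_permsD(6)[OF x, of c] by auto
    qed
  qed
  then show ?thesis unfolding consecutive_def by (simp add: signed_permsD(8)[OF x])
qed

lemma contracted_edge:
  assumes cong: "lattice_congruence (weak_order n) \<Theta>" and e: "edge n x y q p"
    and R: "\<And>c. c \<in> labels n \<Longrightarrow> p < c \<Longrightarrow> c < q \<Longrightarrow> c \<in> R \<longleftrightarrow> inv y p < inv y c"
    and sub: "R \<subseteq> labels n \<inter> {p<..<q}"
  shows "contracted n \<Theta> (Arc p q R) \<longleftrightarrow> (x, y) \<in> \<Theta>"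
proof -
  have "inv_arc n y q p = Arc p q R"
  proof (rule arc_eqI)
    have "c \<in> right_pts (inv_arc n y q p) \<longleftrightarrow> c \<in> R" for c
    proof -
      have "c \<in> labels n \<and> p < c \<and> c < q" if "c \<in> R" using that sub by auto
      then show ?thesis unfolding right_pts_inv_arc[OF e] using R[of c] by blast
    qed
    then show "right_pts (inv_arc n y q p) = right_pts (Arc p q R)" unfolding arc.sel by blast
  qed simp_all
  then show ?thesis using contractedD[OF cong _ e] contractedI[OF e] by blast
qed

text \<open>Above x the word u v w runs through v u w, v w u, w v u in one chain and through u w v,
  w u v, w v u in the other. The two middle edges carry the arc from w to u, with v to the left in
  the first chain and to the right in the second, and \<open>polygon\<close> contracts both. As no
  two of u, v, w are opposite, the mirrored swaps do not interfere.\<close>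

lemma hexagon:
  assumes cong: "lattice_congruence (weak_order n) \<Theta>" and x: "x \<in> signed_perms n"
    and uv: "consecutive n (inv x u) (inv x v)" and vw: "consecutive n (inv x v) (inv x w)"
    and less: "u < v" "v < w" and abs: "u \<noteq> - v" "v \<noteq> - w" "u \<noteq> - w"
    and con: "contracted n \<Theta> (Arc u v {c \<in> labels n. u < c \<and> c < v \<and> inv x u < inv x c})"
  shows "contracted n \<Theta> (Arc u w {c \<in> labels n. u < c \<and> c < w \<and> inv x u < inv x c \<and> c \<noteq> v})"
    "contracted n \<Theta> (Arc u w {c \<in> labels n. u < c \<and> c < w \<and> inv x u < inv x c})"
proof -
  note U = uv[unfolded consecutive_inv_iff[OF x]] and V = vw[unfolded consecutive_inv_iff[OF x]]
  have l: "u \<in> labels n" "v \<in> labels n" "w \<in> labels n" using U V by auto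
  then have nz: "u \<noteq> 0" "v \<noteq> 0" "w \<noteq> 0" by auto
  have ord: "inv x u < inv x v" "inv x v < inv x w" using U V by auto
  have btw: "inv x c \<le> inv x u \<or> c = v \<or> inv x w \<le> inv x c" if "c \<in> labels n" for c
    using U V that inv_signed_perm_eq_iff[OF x, of c v] by (metis linorder_less_linear not_le)
  obtain y\<^sub>1 where e1: "edge n x y\<^sub>1 v u" by (rule edge_of_consecutive[OF x uv less(1)])
  obtain y\<^sub>2 where e2: "edge n x y\<^sub>2 w v" by (rule edge_of_consecutive[OF x vw less(2)])
  note D1 = edgeD[OF e1] and D2 = edgeD[OF e2]
  have v1: "inv y\<^sub>1 v < inv y\<^sub>1 u" and v2: "inv y\<^sub>2 w < inv y\<^sub>2 v"
    using D1(9) D2(9) by (auto simp: inversions_def)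
  have pres1: "inv y\<^sub>1 u < inv y\<^sub>1 c \<longleftrightarrow> inv x u < inv x c" "inv y\<^sub>1 c < inv y\<^sub>1 w \<longleftrightarrow> inv x c < inv x w"
    if "c \<in> labels n" "c \<noteq> v" for c
    using inv_less_edge[OF e1 l(1) that(1)] inv_less_edge[OF e1 that(1) l(3)] that abs less nz by auto
  have pres2: "inv y\<^sub>2 u < inv y\<^sub>2 c \<longleftrightarrow> inv x u < inv x c" "c \<noteq> v \<Longrightarrow> inv y\<^sub>2 c < inv y\<^sub>2 w \<longleftrightarrow> inv x c < inv x w"
    if "c \<in> labels n" for c
    using inv_less_edge[OF e2 l(1) that(1)] inv_less_edge[OF e2 that(1) l(3)] that abs less nz by auto
  have "consecutive n (inv y\<^sub>1 u) (inv y\<^sub>1 w)"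
    unfolding consecutive_inv_iff[OF D1(2)]
  proof (intro conjI ballI notI)
    show "inv y\<^sub>1 u < inv y\<^sub>1 w" using pres1(1)[OF l(3)] less ord by simp
    fix c assume c: "c \<in> labels n" "inv y\<^sub>1 u < inv y\<^sub>1 c \<and> inv y\<^sub>1 c < inv y\<^sub>1 w"
    then have "c \<noteq> v" using v1 by auto
    then show False using btw[OF c(1)] pres1[OF c(1)] c(2) by auto
  qed (fact l)+
  then obtain d\<^sub>1 where f1: "edge n y\<^sub>1 d\<^sub>1 w u"
    by (rule edge_of_consecutive[OF D1(2)]) (use less in auto)
  have "consecutive n (inv y\<^sub>2 u) (inv y\<^sub>2 w)"
    unfolding consecutive_inv_iff[OF D2(2)]
  proof (intro conjI ballI notI)
    show "inv y\<^sub>2 u < inv y\<^sub>2 w" using pres2(1)[OF l(3)] less ord by simp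
    fix c assume c: "c \<in> labels n" "inv y\<^sub>2 u < inv y\<^sub>2 c \<and> inv y\<^sub>2 c < inv y\<^sub>2 w"
    then have "c \<noteq> v" using v2 by auto
    then show False using btw[OF c(1)] pres2[OF c(1)] c(2) by auto
  qed (fact l)+
  then obtain d\<^sub>2 where f2: "edge n y\<^sub>2 d\<^sub>2 w u"
    by (rule edge_of_consecutive[OF D2(2)]) (use less in auto)
  note F1 = edgeD[OF f1] and F2 = edgeD[OF f2]
  have "contracted n \<Theta> (Arc u v {c \<in> labels n. u < c \<and> c < v \<and> inv x u < inv x c}) \<longleftrightarrow> (x, y\<^sub>1) \<in> \<Theta>"
  proof (rule contracted_edge[OF cong e1])
    fix c assume c: "c \<in> labels n" "u < c" "c < v"
    then show "c \<in> {c \<in> labels n. u < c \<and> c < v \<and> inv x u < inv x c} \<longleftrightarrow> inv y\<^sub>1 u < inv y\<^sub>1 c"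
      using pres1(1)[of c] by simp
  qed auto
  then have con: "(x, y\<^sub>1) \<in> \<Theta>" using con by blast
  have join: "(v, u) \<in> inversions n z \<and> (- u, - v) \<in> inversions n z \<and> (w, v) \<in> inversions n z \<and>
      (- v, - w) \<in> inversions n z \<and> (w, u) \<in> inversions n z \<and> (- u, - w) \<in> inversions n z \<and>
      inversions n x \<subseteq> inversions n z"
    if z: "z \<in> signed_perms n" "inversions n y\<^sub>1 \<subseteq> inversions n z" "inversions n y\<^sub>2 \<subseteq> inversions n z" for z
  proof -
    note B = biclosedD(5)[OF biclosed_inversions[OF z(1)]]
    have "inversions n x \<subseteq> inversions n z" "(v, u) \<in> inversions n z" "(- u, - v) \<in> inversions n z"
      "(w, v) \<in> inversions n z" "(- v, - w) \<in> inversions n z"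
      using z(2,3) unfolding D1(5) D2(5) by simp_all
    then show ?thesis using B[of w v u] B[of "- u" "- v" "- w"] by simp
  qed
  have "(y\<^sub>1, d\<^sub>1) \<in> \<Theta>"
  proof (rule polygon[OF cong e1 e2 con D1(2) F1(2)])
    show "inversions n d\<^sub>1 \<subseteq> inversions n z"
      if "z \<in> signed_perms n" "inversions n y\<^sub>1 \<subseteq> inversions n z" "inversions n y\<^sub>2 \<subseteq> inversions n z" for z
      using join[OF that] F1(5) that(2) by blast
    show "(w, v) \<in> inversions n y\<^sub>1 \<or> (w, v) \<notin> inversions n d\<^sub>1"
      using D2(3) D1(5) F1(5) less abs by auto
  qed (use D1(5) F1(5) in auto)
  moreover have "contracted n \<Theta> (Arc u w {c \<in> labels n. u < c \<and> c < w \<and> inv x u < inv x c \<and> c \<noteq> v}) \<longleftrightarrow>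
      (y\<^sub>1, d\<^sub>1) \<in> \<Theta>"
  proof (rule contracted_edge[OF cong f1])
    fix c assume c: "c \<in> labels n" "u < c" "c < w"
    have "inv d\<^sub>1 u < inv d\<^sub>1 c \<longleftrightarrow> inv y\<^sub>1 u < inv y\<^sub>1 c"
      by (rule inv_less_edge[OF f1 l(1) c(1)]) (use c abs nz in auto)
    then show "c \<in> {c \<in> labels n. u < c \<and> c < w \<and> inv x u < inv x c \<and> c \<noteq> v} \<longleftrightarrow> inv d\<^sub>1 u < inv d\<^sub>1 c"
      using c pres1(1)[OF c(1)] v1 by (cases "c = v") auto
  qed auto
  ultimately show "contracted n \<Theta> (Arc u w {c \<in> labels n. u < c \<and> c < w \<and> inv x u < inv x c \<and> c \<noteq> v})"
    by blast
  have "(y\<^sub>2, d\<^sub>2) \<in> \<Theta>"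
  proof (rule polygon[OF cong e1 e2 con D2(2) F2(2)])
    show "inversions n d\<^sub>2 \<subseteq> inversions n z"
      if "z \<in> signed_perms n" "inversions n y\<^sub>1 \<subseteq> inversions n z" "inversions n y\<^sub>2 \<subseteq> inversions n z" for z
      using join[OF that] F2(5) that(3) by blast
  qed (use D2(5) F2(5) in auto)
  moreover have "contracted n \<Theta> (Arc u w {c \<in> labels n. u < c \<and> c < w \<and> inv x u < inv x c}) \<longleftrightarrow>
      (y\<^sub>2, d\<^sub>2) \<in> \<Theta>"
  proof (rule contracted_edge[OF cong f2])
    fix c assume c: "c \<in> labels n" "u < c" "c < w"
    have "inv d\<^sub>2 u < inv d\<^sub>2 c \<longleftrightarrow> inv y\<^sub>2 u < inv y\<^sub>2 c"
      by (rule inv_less_edge[OF f2 l(1) c(1)]) (use c abs nz in auto)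
    then show "c \<in> {c \<in> labels n. u < c \<and> c < w \<and> inv x u < inv x c} \<longleftrightarrow> inv d\<^sub>2 u < inv d\<^sub>2 c"
      using c pres2(1)[OF c(1)] by auto
  qed auto
  ultimately show "contracted n \<Theta> (Arc u w {c \<in> labels n. u < c \<and> c < w \<and> inv x u < inv x c})"
    by blast
qed

text \<open>The octagon starts at a word with the consecutive entries \<open>-b, -a, a, b\<close> in the middle; the other
  words of its two chains that occur below are \<open>-b, a, -a, b\<close> (\<open>y\<^sub>1\<close>), \<open>a, -b, b, -a\<close> (\<open>c\<^sub>1\<close>),
  \<open>a, b, -b, -a\<close> (\<open>c\<^sub>2\<close>) and \<open>-a, -b, b, a\<close> (\<open>y\<^sub>2\<close>), \<open>-a, b, -b, a\<close> (\<open>d\<^sub>1\<close>).\<close>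

lemma octagon:
  assumes cong: "lattice_congruence (weak_order n) \<Theta>" and x: "x \<in> signed_perms n"
    and aa: "consecutive n (inv x (- a)) (inv x a)" and ab: "consecutive n (inv x a) (inv x b)"
    and less: "0 < a" "a < b"
    and con: "contracted n \<Theta> (Arc (- a) a {c \<in> labels n. - a < c \<and> c < a \<and> inv x a < inv x c}) \<or>
      contracted n \<Theta> (Arc a b {c \<in> labels n. a < c \<and> c < b \<and> inv x a < inv x c})"
  shows "contracted n \<Theta> (Arc (- a) b {c \<in> labels n. - a < c \<and> c < b \<and> inv x a < inv x c})"
    "contracted n \<Theta> (Arc (- b) b (insert (- a) {c \<in> labels n. - b < c \<and> c < b \<and> inv x a < inv x c}))"
    "contracted n \<Theta> (Arc (- b) b (insert a {c \<in> labels n. - b < c \<and> c < b \<and> inv x a < inv x c}))"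
proof -
  note A = aa[unfolded consecutive_inv_iff[OF x]] and B = ab[unfolded consecutive_inv_iff[OF x]]
  have l: "a \<in> labels n" "b \<in> labels n" "- a \<in> labels n" "- b \<in> labels n" using A B by auto
  note odd = signed_permsD(4)
  have ord: "inv x (- b) < inv x (- a)" "inv x (- a) < inv x a" "inv x a < inv x b"
    using A B odd[OF x] by auto
  define Q where "Q = labels n - {a, b, - a, - b}"
  have btw: "inv x c < inv x (- b) \<or> inv x b < inv x c" if c: "c \<in> Q" for c
  proof -
    have cl: "c \<in> labels n" "- c \<in> labels n" "c \<noteq> a" "c \<noteq> b" "c \<noteq> - a" "c \<noteq> - b" using c by (auto simp: Q_def)
    have "\<not> (inv x (- a) < inv x c \<and> inv x c < inv x a)" "\<not> (inv x a < inv x c \<and> inv x c < inv x b)"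
      "\<not> (inv x a < inv x (- c) \<and> inv x (- c) < inv x b)"
      using A B cl by auto
    moreover have "inv x c \<noteq> inv x a" "inv x c \<noteq> inv x b" "inv x c \<noteq> inv x (- a)" "inv x c \<noteq> inv x (- b)"
      using inv_signed_perm_eq_iff[OF x] cl by auto
    ultimately show ?thesis by (auto simp: odd[OF x])
  qed
  have lab: "c \<in> labels n \<longleftrightarrow> c \<in> Q \<or> c \<in> {a, b, - a, - b}" for c using l by (auto simp: Q_def)
  have Q: "c \<in> labels n" "c \<noteq> a" "c \<noteq> b" "c \<noteq> - a" "c \<noteq> - b" "- c \<noteq> a" "- c \<noteq> b" if "c \<in> Q" for c
    using that by (auto simp: Q_def)
  obtain y\<^sub>1 where e1: "edge n x y\<^sub>1 a (- a)" by (rule edge_of_consecutive[OF x aa]) (use less in auto)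
  obtain y\<^sub>2 where e2: "edge n x y\<^sub>2 b a" by (rule edge_of_consecutive[OF x ab]) (use less in auto)
  note Y1 = edgeD[OF e1] and Y2 = edgeD[OF e2]
  have keep: "inv y c < inv y e \<longleftrightarrow> inv z c < inv z e" "inv y e < inv y c \<longleftrightarrow> inv z e < inv z c"
    if e: "edge n z y q p" and "p \<in> {a, b, - a, - b}" "q \<in> {a, b, - a, - b}" and c: "c \<in> Q"
      and ee: "e \<in> {a, b, - a, - b}" for y z q p c e
  proof -
    have "c \<noteq> p" "c \<noteq> q" "c \<noteq> - p" "c \<noteq> - q" using that(2,3) Q[OF c] by auto
    moreover have "e \<in> labels n" using lab[of e] ee by blast
    ultimately show "inv y c < inv y e \<longleftrightarrow> inv z c < inv z e" "inv y e < inv y c \<longleftrightarrow> inv z e < inv z c"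
      using inv_less_edge[OF e Q(1)[OF c], of e] inv_less_edge[OF e _ Q(1)[OF c], of e] by simp_all
  qed
  have "inv y\<^sub>1 (- a) < inv y\<^sub>1 b \<longleftrightarrow> inv x (- a) < inv x b" "inv y\<^sub>1 (- b) < inv y\<^sub>1 (- a) \<longleftrightarrow> inv x (- b) < inv x (- a)"
    by (rule inv_less_edge[OF e1]; use l less in auto)+
  then have y1: "inv y\<^sub>1 (- b) < inv y\<^sub>1 (- a)" "inv y\<^sub>1 a < inv y\<^sub>1 (- a)" "inv y\<^sub>1 (- a) < inv y\<^sub>1 b"
    using ord Y1(9) by (auto simp: inversions_def)
  have "consecutive n (inv y\<^sub>1 (- a)) (inv y\<^sub>1 b)"
    unfolding consecutive_inv_iff[OF Y1(2)]
  proof (intro conjI ballI notI)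
    fix c assume c: "c \<in> labels n" "inv y\<^sub>1 (- a) < inv y\<^sub>1 c \<and> inv y\<^sub>1 c < inv y\<^sub>1 b"
    then have "c \<in> Q" using y1 unfolding lab by auto
    then show False using btw[of c] keep[OF e1, of c] c(2) ord by auto
  qed (use l y1 in auto)
  then obtain c\<^sub>1 where f1: "edge n y\<^sub>1 c\<^sub>1 b (- a)"
    by (rule edge_of_consecutive[OF Y1(2)]) (use less in auto)
  note C1 = edgeD[OF f1]
  have "inv c\<^sub>1 (- b) < inv c\<^sub>1 b \<longleftrightarrow> inv y\<^sub>1 (- b) < inv y\<^sub>1 b"
    by (rule inv_less_edge[OF f1]; use l less in auto)
  then have c1: "inv c\<^sub>1 (- b) < inv c\<^sub>1 b" "inv c\<^sub>1 b < inv c\<^sub>1 (- a)" "inv c\<^sub>1 a < inv c\<^sub>1 (- b)"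
    using y1 C1(9) odd[OF C1(2)] by (auto simp: inversions_def)
  have "consecutive n (inv c\<^sub>1 (- b)) (inv c\<^sub>1 b)"
    unfolding consecutive_inv_iff[OF C1(2)]
  proof (intro conjI ballI notI)
    fix c assume c: "c \<in> labels n" "inv c\<^sub>1 (- b) < inv c\<^sub>1 c \<and> inv c\<^sub>1 c < inv c\<^sub>1 b"
    then have "c \<in> Q" using c1 unfolding lab by auto
    then show False using btw[of c] keep[OF e1, of c] keep[OF f1, of c] c(2) ord by auto
  qed (use l c1 in auto)
  then obtain c\<^sub>2 where g1: "edge n c\<^sub>1 c\<^sub>2 b (- b)"
    by (rule edge_of_consecutive[OF C1(2)]) (use less in auto)
  note C2 = edgeD[OF g1]
  have "inv y\<^sub>2 (- b) < inv y\<^sub>2 b \<longleftrightarrow> inv x (- b) < inv x b"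
    by (rule inv_less_edge[OF e2]; use l less in auto)
  then have y2: "inv y\<^sub>2 (- b) < inv y\<^sub>2 b" "inv y\<^sub>2 b < inv y\<^sub>2 a" "inv y\<^sub>2 (- a) < inv y\<^sub>2 (- b)"
    using ord Y2(9) odd[OF Y2(2)] by (auto simp: inversions_def)
  have "consecutive n (inv y\<^sub>2 (- b)) (inv y\<^sub>2 b)"
    unfolding consecutive_inv_iff[OF Y2(2)]
  proof (intro conjI ballI notI)
    fix c assume c: "c \<in> labels n" "inv y\<^sub>2 (- b) < inv y\<^sub>2 c \<and> inv y\<^sub>2 c < inv y\<^sub>2 b"
    then have "c \<in> Q" using y2 unfolding lab by auto
    then show False using btw[of c] keep[OF e2, of c] c(2) ord by auto
  qed (use l y2 in auto)
  then obtain d\<^sub>1 where f2: "edge n y\<^sub>2 d\<^sub>1 b (- b)"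
    by (rule edge_of_consecutive[OF Y2(2)]) (use less in auto)
  note D1 = edgeD[OF f2]
  have k1: "inv y\<^sub>1 e < inv y\<^sub>1 c \<longleftrightarrow> inv x e < inv x c"
    and kc: "inv c\<^sub>1 e < inv c\<^sub>1 c \<longleftrightarrow> inv x e < inv x c"
    and k2: "inv y\<^sub>2 e < inv y\<^sub>2 c \<longleftrightarrow> inv x e < inv x c" if "c \<in> Q" "e \<in> {a, b, - a, - b}" for c e
  proof -
    show k1: "inv y\<^sub>1 e < inv y\<^sub>1 c \<longleftrightarrow> inv x e < inv x c" by (rule keep(2)[OF e1 _ _ that]; simp)
    have "inv c\<^sub>1 e < inv c\<^sub>1 c \<longleftrightarrow> inv y\<^sub>1 e < inv y\<^sub>1 c" by (rule keep(2)[OF f1 _ _ that]; simp)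
    then show "inv c\<^sub>1 e < inv c\<^sub>1 c \<longleftrightarrow> inv x e < inv x c" using k1 by simp
    show "inv y\<^sub>2 e < inv y\<^sub>2 c \<longleftrightarrow> inv x e < inv x c" by (rule keep(2)[OF e2 _ _ that]; simp)
  qed
  \<comment> \<open>All other entries stand outside the middle block, so comparing with any of its
    four entries gives the same answer.\<close>
  have after: "inv x e < inv x c \<longleftrightarrow> inv x a < inv x c" if "c \<in> Q" "e \<in> {a, b, - a, - b}" for c e
    using btw[OF that(1)] that(2) ord by auto
  have join: "(a, - a) \<in> inversions n z \<and> (b, a) \<in> inversions n z \<and> (- a, - b) \<in> inversions n z \<and>
      (b, - a) \<in> inversions n z \<and> (a, - b) \<in> inversions n z \<and> (b, - b) \<in> inversions n z \<and>
      inversions n x \<subseteq> inversions n z"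
    if z: "z \<in> signed_perms n" "inversions n y\<^sub>1 \<subseteq> inversions n z" "inversions n y\<^sub>2 \<subseteq> inversions n z" for z
  proof -
    note B = biclosedD(5)[OF biclosed_inversions[OF z(1)]]
    have "inversions n x \<subseteq> inversions n z" "(a, - a) \<in> inversions n z" "(b, a) \<in> inversions n z"
      "(- a, - b) \<in> inversions n z"
      using z(2,3) unfolding Y1(5) Y2(5) by simp_all
    then show ?thesis using B[of b a "- a"] B[of a "- a" "- b"] B[of b a "- b"] by simp
  qed
  have sets: "inversions n y\<^sub>1 = inversions n x \<union> {(a, - a)}"
    "inversions n c\<^sub>1 = inversions n x \<union> {(a, - a), (b, - a), (a, - b)}"
    "inversions n c\<^sub>2 = inversions n x \<union> {(a, - a), (b, - a), (a, - b), (b, - b)}"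
    "inversions n y\<^sub>2 = inversions n x \<union> {(b, a), (- a, - b)}"
    "inversions n d\<^sub>1 = inversions n x \<union> {(b, a), (- a, - b), (b, - b)}"
    unfolding D1(5) C2(5) C1(5) Y1(5) Y2(5) by auto
  have nin: "(b, a) \<notin> inversions n y\<^sub>1" "(b, a) \<notin> inversions n c\<^sub>1" "(b, a) \<notin> inversions n c\<^sub>2"
    "(a, - a) \<notin> inversions n y\<^sub>2" "(a, - a) \<notin> inversions n d\<^sub>1"
    using Y2(3) Y1(3) less unfolding sets by auto
  have "contracted n \<Theta> (Arc (- a) a {c \<in> labels n. - a < c \<and> c < a \<and> inv x a < inv x c}) \<longleftrightarrow> (x, y\<^sub>1) \<in> \<Theta>"
  proof (rule contracted_edge[OF cong e1])
    fix c assume c: "c \<in> labels n" "- a < c" "c < a"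
    then have "c \<in> Q" using less by (simp add: Q_def)
    then show "c \<in> {c \<in> labels n. - a < c \<and> c < a \<and> inv x a < inv x c} \<longleftrightarrow> inv y\<^sub>1 (- a) < inv y\<^sub>1 c"
      using c k1[of c "- a"] after[of c "- a"] by simp
  qed auto
  moreover have "contracted n \<Theta> (Arc a b {c \<in> labels n. a < c \<and> c < b \<and> inv x a < inv x c}) \<longleftrightarrow> (x, y\<^sub>2) \<in> \<Theta>"
  proof (rule contracted_edge[OF cong e2])
    fix c assume c: "c \<in> labels n" "a < c" "c < b"
    then have "c \<in> Q" using less by (simp add: Q_def)
    then show "c \<in> {c \<in> labels n. a < c \<and> c < b \<and> inv x a < inv x c} \<longleftrightarrow> inv y\<^sub>2 a < inv y\<^sub>2 c"
      using c k2[of c a] by simp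
  qed auto
  ultimately have con: "(x, y\<^sub>1) \<in> \<Theta> \<or> (x, y\<^sub>2) \<in> \<Theta>" using con by blast
  \<comment> \<open>The three side edges used below change neither (b, a) nor (a, -a), so
    \<open>polygon\<close> contracts them whichever of the two bottom edges is contracted.\<close>
  have poly: "(c, d) \<in> \<Theta>"
    if cd: "c \<in> signed_perms n" "d \<in> signed_perms n"
      "inversions n x \<subseteq> inversions n c" "inversions n c \<subseteq> inversions n d"
      and top: "inversions n d \<subseteq> inversions n x \<union> {(a, - a), (b, a), (- a, - b), (b, - a), (a, - b), (b, - b)}"
      and side: "(b, a) \<in> inversions n c \<or> (b, a) \<notin> inversions n d"
        "(a, - a) \<in> inversions n c \<or> (a, - a) \<notin> inversions n d" for c d
    using con
  proof
    assume "(x, y\<^sub>1) \<in> \<Theta>"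
    then show ?thesis
      by (rule polygon[OF cong e1 e2 _ cd _ side(1)]) (use join top in blast)
  next
    assume "(x, y\<^sub>2) \<in> \<Theta>"
    then show ?thesis
      by (rule polygon[OF cong e2 e1 _ cd _ side(2)]) (use join top in blast)
  qed
  have "(y\<^sub>1, c\<^sub>1) \<in> \<Theta>" "(c\<^sub>1, c\<^sub>2) \<in> \<Theta>" "(y\<^sub>2, d\<^sub>1) \<in> \<Theta>"
    by (rule poly; use nin Y1(2) C1(2) C2(2) Y2(2) D1(2) in \<open>auto simp: sets\<close>)+
  moreover have "contracted n \<Theta> (Arc (- a) b {c \<in> labels n. - a < c \<and> c < b \<and> inv x a < inv x c}) \<longleftrightarrow>
      (y\<^sub>1, c\<^sub>1) \<in> \<Theta>"
  proof (rule contracted_edge[OF cong f1])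
    fix c assume c: "c \<in> labels n" "- a < c" "c < b"
    show "c \<in> {c \<in> labels n. - a < c \<and> c < b \<and> inv x a < inv x c} \<longleftrightarrow> inv c\<^sub>1 (- a) < inv c\<^sub>1 c"
    proof (cases "c \<in> Q")
      case True
      then show ?thesis using c kc[of c "- a"] after[of c "- a"] by simp
    next
      case False
      then have "c = a" using c less by (auto simp: Q_def)
      then show ?thesis using c1 by auto
    qed
  qed auto
  moreover have "contracted n \<Theta> (Arc (- b) b (insert (- a) {c \<in> labels n. - b < c \<and> c < b \<and> inv x a < inv x c})) \<longleftrightarrow>
      (c\<^sub>1, c\<^sub>2) \<in> \<Theta>"
  proof (rule contracted_edge[OF cong g1])
    fix c assume c: "c \<in> labels n" "- b < c" "c < b"
    have *: "inv c\<^sub>2 (- b) < inv c\<^sub>2 c \<longleftrightarrow> inv c\<^sub>1 (- b) < inv c\<^sub>1 c"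
      by (rule inv_less_edge[OF g1]) (use c l in auto)
    show "c \<in> insert (- a) {c \<in> labels n. - b < c \<and> c < b \<and> inv x a < inv x c} \<longleftrightarrow>
        inv c\<^sub>2 (- b) < inv c\<^sub>2 c"
    proof (cases "c \<in> Q")
      case True
      then show ?thesis using c kc[of c "- b"] after[of c "- b"] Q(4)[of c] unfolding * by simp
    next
      case False
      then have "c = a \<or> c = - a" using c less by (auto simp: Q_def)
      then show ?thesis using c1 less unfolding * by auto
    qed
  qed (use l less in auto)
  moreover have "contracted n \<Theta> (Arc (- b) b (insert a {c \<in> labels n. - b < c \<and> c < b \<and> inv x a < inv x c})) \<longleftrightarrow>
      (y\<^sub>2, d\<^sub>1) \<in> \<Theta>"
  proof (rule contracted_edge[OF cong f2])
    fix c assume c: "c \<in> labels n" "- b < c" "c < b"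
    have *: "inv d\<^sub>1 (- b) < inv d\<^sub>1 c \<longleftrightarrow> inv y\<^sub>2 (- b) < inv y\<^sub>2 c"
      by (rule inv_less_edge[OF f2]) (use c l in auto)
    show "c \<in> insert a {c \<in> labels n. - b < c \<and> c < b \<and> inv x a < inv x c} \<longleftrightarrow>
        inv d\<^sub>1 (- b) < inv d\<^sub>1 c"
    proof (cases "c \<in> Q")
      case True
      then show ?thesis using c k2[of c "- b"] after[of c "- b"] Q(2)[of c] unfolding * by simp
    next
      case False
      then have "c = a \<or> c = - a" using c less by (auto simp: Q_def)
      then show ?thesis using y2 ord less unfolding * by auto
    qed
  qed (use l less in auto)
  ultimately show "contracted n \<Theta> (Arc (- a) b {c \<in> labels n. - a < c \<and> c < b \<and> inv x a < inv x c})"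
    "contracted n \<Theta> (Arc (- b) b (insert (- a) {c \<in> labels n. - b < c \<and> c < b \<and> inv x a < inv x c}))"
    "contracted n \<Theta> (Arc (- b) b (insert a {c \<in> labels n. - b < c \<and> c < b \<and> inv x a < inv x c}))"
    by blast+
qed

section \<open>Forcing between arcs\<close>

text \<open>P marks the entries at positive positions and m ranks them; the other entries get
  opposite ranks. The inversions of an odd injective ranking are biclosed, so the word
  exists.\<close>

lemma signed_perm_of_word:
  fixes m :: "int \<Rightarrow> int"
  assumes P: "\<And>c. c \<in> labels n \<Longrightarrow> P (- c) \<longleftrightarrow> \<not> P c"
    and pos: "\<And>c. c \<in> labels n \<Longrightarrow> P c \<Longrightarrow> 0 < m c"
    and inj: "\<And>c d. c \<in> labels n \<Longrightarrow> d \<in> labels n \<Longrightarrow> P c \<Longrightarrow> P d \<Longrightarrow> m c = m d \<Longrightarrow> c = d"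
  obtains x where "x \<in> signed_perms n"
    "\<And>c d. c \<in> labels n \<Longrightarrow> d \<in> labels n \<Longrightarrow> inv x c < inv x d \<longleftrightarrow>
       (if P c then m c else - m (- c)) < (if P d then m d else - m (- d))"
proof -
  define K where "K c = (if P c then m c else - m (- c))" for c
  have odd: "K (- c) = - K c" if "c \<in> labels n" for c
    using P[OF that] by (simp add: K_def)
  have Kinj: "c = d" if "c \<in> labels n" "d \<in> labels n" "K c = K d" for c d
    using that inj[of c d] inj[of "- c" "- d"] pos[of c] pos[of d] pos[of "- c"] pos[of "- d"] P[of c] P[of d]
    unfolding K_def by (auto split: if_splits)
  define T where "T = {(q, p). p \<in> labels n \<and> q \<in> labels n \<and> p < q \<and> K q < K p}"
  have "biclosed n T"
    unfolding biclosed_def T_def by (auto simp: odd)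
  then obtain x where x: "x \<in> signed_perms n" "inversions n x = T" by (rule biclosed_realize)
  have less: "inv x d < inv x c \<longleftrightarrow> K d < K c" if "c \<in> labels n" "d \<in> labels n" "c < d" for c d
    using that x(2) by (auto simp: inversions_def T_def set_eq_iff)
  have "inv x c < inv x d \<longleftrightarrow> K c < K d" if "c \<in> labels n" "d \<in> labels n" for c d
  proof -
    consider "c = d" | "d < c" | "c < d" by linarith
    then show ?thesis
    proof cases
      case 3
      then show ?thesis
        using less[OF that] Kinj[OF that] inv_signed_perm_eq_iff[OF x(1), of c d] by linarith
    qed (use less that in auto)
  qed
  then show thesis using that[OF x(1)] unfolding K_def by blast
qed

text \<open>The arcs compared in a forcing step share one set R of right-hand points, cut down to
  the interval between their endpoints; so R stays fixed while the endpoints move.\<close>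

definition restrict_arc :: "int set \<Rightarrow> int \<Rightarrow> int \<Rightarrow> arc" where
  "restrict_arc R p q = Arc p q (R \<inter> {p<..<q})"

lemma restrict_arc_simps [simp]:
  "lower (restrict_arc R p q) = p" "upper (restrict_arc R p q) = q"
  "c \<in> right_pts (restrict_arc R p q) \<longleftrightarrow> c \<in> R \<and> p < c \<and> c < q"
  by (auto simp: restrict_arc_def)

lemma flip_restrict_arc: "flip (restrict_arc R p q) = restrict_arc (uminus ` R) (- q) (- p)"
proof (rule arc_eqI)
  have "- c \<in> R \<longleftrightarrow> c \<in> uminus ` R" for c by force
  then show "right_pts (flip (restrict_arc R p q)) = right_pts (restrict_arc (uminus ` R) (- q) (- p))"
    by auto
qed simp_all

lemma uminus_uminus_image [simp]: "uminus ` uminus ` R = (R :: int set)"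
  by (simp add: image_image)

lemma uminus_image_iff: "c \<in> uminus ` R \<longleftrightarrow> - c \<in> (R :: int set)"
  by force

lemma is_arc_restrict_arc:
  "is_arc n (restrict_arc R p q) \<longleftrightarrow> p \<in> labels n \<and> q \<in> labels n \<and> p < q \<and> \<not> (0 \<in> R \<and> p < 0 \<and> 0 < q)"
  unfolding is_arc_def by auto

lemma labels_between: "p \<in> labels n \<Longrightarrow> q \<in> labels n \<Longrightarrow> p \<le> c \<Longrightarrow> c \<le> q \<Longrightarrow> c \<noteq> 0 \<Longrightarrow> c \<in> labels n"
  by (auto simp: labels_def)

lemma good_restrict_arcD:
  assumes "good_arc n (restrict_arc R p q)"
  shows "p \<in> labels n" "q \<in> labels n" "p < q"
    "c \<in> R \<Longrightarrow> p < c \<Longrightarrow> c < q \<Longrightarrow> c \<in> labels n"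
    "c \<in> R \<Longrightarrow> p < c \<Longrightarrow> c < q \<Longrightarrow> - c \<in> R \<Longrightarrow> p < - c \<Longrightarrow> - c < q \<Longrightarrow> False"
    "- p \<in> R \<Longrightarrow> p < - p \<Longrightarrow> - p < q \<Longrightarrow> False"
    "- q \<in> R \<Longrightarrow> p < - q \<Longrightarrow> - q < q \<Longrightarrow> False"
proof -
  have a: "is_arc n (restrict_arc R p q)" using assms by (simp add: good_arc_def)
  then show "p \<in> labels n" "q \<in> labels n" "p < q" by (auto simp: is_arc_restrict_arc)
  show "c \<in> labels n" if "c \<in> R" "p < c" "c < q"
    using a that labels_between[of p n q c] by (cases "c = 0") (auto simp: is_arc_restrict_arc)
qed (use assms in \<open>auto simp: good_arc_def\<close>)

lemma good_restrict_arcI: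
  assumes "p \<in> labels n" "q \<in> labels n" "p < q" "\<not> (0 \<in> R \<and> p < 0 \<and> 0 < q)"
    and "p = - q \<Longrightarrow> half_turn (restrict_arc R p q) = restrict_arc R p q"
    and "\<And>c. c \<in> R \<Longrightarrow> - c \<in> R \<Longrightarrow> p < c \<Longrightarrow> c < q \<Longrightarrow> p < - c \<Longrightarrow> - c < q \<Longrightarrow> False"
    and "\<not> (- p \<in> R \<and> p < - p \<and> - p < q)" "\<not> (- q \<in> R \<and> p < - q)"
  shows "good_arc n (restrict_arc R p q)"
  unfolding good_arc_def
proof (intro conjI ballI impI)
  show "is_arc n (restrict_arc R p q)" unfolding is_arc_restrict_arc using assms(1-4) by blast
  show "- c \<notin> right_pts (restrict_arc R p q)" if "c \<in> right_pts (restrict_arc R p q)" for c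
    using assms(6)[of c] that by auto
qed (use assms(3,5,7,8) in auto)

text \<open>In the word built here u, v, w are consecutive at positive positions, the other
  right-hand points of the arc follow, and everything else is nearer to the middle. It exists
  because no two of the entries from u on are opposite, by goodness and the hypotheses on u, v,
  w.\<close>

lemma hexagon_forces_top:
  assumes good: "good_arc n (restrict_arc R u w)" and v: "v \<in> labels n" "u < v" "v < w"
    and abs: "u \<noteq> - v" "v \<noteq> - w" "u \<noteq> - w" and vR: "\<not> (- v \<in> R \<and> u < - v \<and> - v < w)"
  shows "arc_forces n (restrict_arc R u v) (restrict_arc R u w)"
proof -
  note G = good_restrict_arcD[OF good]
  define S where "S = R \<inter> {u<..<w}"
  have S: "- c \<notin> S" if "c \<in> S \<or> c \<in> {u, v, w}" for c
    using that G(5)[of c] G(6,7) vR v by (auto simp: S_def)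
  have Slab: "c \<in> labels n" if "c \<in> S" for c using that G(4) by (simp add: S_def)
  define P where "P c \<longleftrightarrow> c \<in> {u, v, w} \<or> - c \<notin> {u, v, w} \<and> (c \<in> S \<or> - c \<notin> S \<and> 0 < c)" for c
  \<comment> \<open>Other entries have ranks up to n, then come u, v, w, and the right-hand points
    have ranks beyond n + 3.\<close>
  define m where "m c = (if c = u then int n + 1 else if c = v then int n + 2 else if c = w then int n + 3
      else if c \<in> S then int n + 3 + \<bar>c\<bar> else \<bar>c\<bar>)" for c
  have nz: "u \<noteq> 0" "v \<noteq> 0" "w \<noteq> 0" using G(1,2) v(1) by auto
  have small: "0 < \<bar>c\<bar>" "\<bar>c\<bar> \<le> int n" if "c \<in> labels n" for c using that by (auto simp: labels_def)
  have Pneg: "P (- c) \<longleftrightarrow> \<not> P c" if c: "c \<in> labels n" for c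
  proof -
    have "c \<noteq> 0" using c by auto
    then have "0 < - c \<longleftrightarrow> \<not> 0 < c" by linarith
    moreover have "\<not> (c \<in> {u, v, w} \<and> - c \<in> {u, v, w})"
      unfolding insert_iff empty_iff using abs nz by presburger
    ultimately show ?thesis
      using S[of c] S[of "- c"] unfolding P_def minus_minus by blast
  qed
  have mpos: "0 < m c" if "c \<in> labels n" for c using small[OF that] unfolding m_def by auto
  have M: "c = u \<and> m c = int n + 1 \<or> c = v \<and> m c = int n + 2 \<or> c = w \<and> m c = int n + 3 \<or>
      m c = int n + 3 + \<bar>c\<bar> \<or> m c = \<bar>c\<bar>" for c
    by (simp add: m_def)
  obtain x where x: "x \<in> signed_perms n" and less: "\<And>c d. c \<in> labels n \<Longrightarrow> d \<in> labels n \<Longrightarrow>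
      inv x c < inv x d \<longleftrightarrow> (if P c then m c else - m (- c)) < (if P d then m d else - m (- d))"
  proof (rule signed_perm_of_word[of n P m])
    show "c = d" if cd: "c \<in> labels n" "d \<in> labels n" "P c" "P d" "m c = m d" for c d
    proof -
      have "\<bar>c\<bar> = \<bar>d\<bar>"
        using M[of c] M[of d] cd(5) small[OF cd(1)] small[OF cd(2)]
        by (elim disjE conjE) (linarith | simp)+
      then have "c = d \<or> c = - d" by linarith
      then show ?thesis using Pneg[OF cd(2)] cd(3,4) by auto
    qed
  qed (use Pneg mpos in auto)
  have PK: "P u" "P v" "P w" "m u = int n + 1" "m v = int n + 2" "m w = int n + 3"
    using v unfolding P_def m_def by auto
  have ku: "inv x u < inv x c \<longleftrightarrow> (if P c then int n + 1 < m c else False)" if "c \<in> labels n" for c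
    using less[OF G(1) that] PK mpos[of "- c"] that by auto
  have kcv: "\<not> (inv x u < inv x c \<and> inv x c < inv x v)" "\<not> (inv x v < inv x c \<and> inv x c < inv x w)"
    if "c \<in> labels n" for c
    using less[OF G(1) that] less[OF that v(1)] less[OF v(1) that] less[OF that G(2)] PK mpos[of "- c"] that
    by auto
  have uv: "consecutive n (inv x u) (inv x v)" and vw: "consecutive n (inv x v) (inv x w)"
    unfolding consecutive_inv_iff[OF x]
    using G(1,2) v(1) kcv less[OF G(1) v(1)] less[OF v(1) G(2)] PK by auto
  have key: "inv x u < inv x c \<longleftrightarrow> c \<in> S" if c: "c \<in> labels n" "c \<noteq> u" "c \<noteq> v" "c \<noteq> w" for c
  proof (cases "c \<in> S")
    case True
    then have "P c" using S[of "- c"] c unfolding P_def by auto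
    then show ?thesis using True c ku[OF c(1)] small[OF c(1)] by (simp add: m_def)
  next
    case False
    then have "m c = \<bar>c\<bar>" using c by (simp add: m_def)
    then show ?thesis using False ku[OF c(1)] small[OF c(1)] by auto
  qed
  have kv: "inv x u < inv x v" using ku[OF v(1)] PK by simp
  have s1: "{c \<in> labels n. u < c \<and> c < v \<and> inv x u < inv x c} = R \<inter> {u<..<v}"
  proof (intro Set.set_eqI)
    fix c show "c \<in> {c \<in> labels n. u < c \<and> c < v \<and> inv x u < inv x c} \<longleftrightarrow> c \<in> R \<inter> {u<..<v}"
      using key[of c] Slab[of c] v unfolding S_def by auto
  qed
  have s2: "{c \<in> labels n. u < c \<and> c < w \<and> inv x u < inv x c \<and> c \<noteq> v} = S - {v}"
  proof (intro Set.set_eqI)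
    fix c show "c \<in> {c \<in> labels n. u < c \<and> c < w \<and> inv x u < inv x c \<and> c \<noteq> v} \<longleftrightarrow> c \<in> S - {v}"
      using key[of c] Slab[of c] unfolding S_def by auto
  qed
  have s3: "{c \<in> labels n. u < c \<and> c < w \<and> inv x u < inv x c} = insert v S"
  proof (intro Set.set_eqI)
    fix c show "c \<in> {c \<in> labels n. u < c \<and> c < w \<and> inv x u < inv x c} \<longleftrightarrow> c \<in> insert v S"
      using key[of c] Slab[of c] kv v unfolding S_def by auto
  qed
  \<comment> \<open>The hexagon has a side edge with v to the left and one with v to the right; the
    arc agrees with one of them.\<close>
  have "restrict_arc R u w = Arc u w (if v \<in> S then insert v S else S - {v})"
    unfolding restrict_arc_def S_def by auto
  then show ?thesis
    unfolding arc_forces_def restrict_arc_def[of R u v]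
    using hexagon[OF _ x uv vw v(2,3) abs, unfolded s1 s2 s3] by (cases "v \<in> S") auto
qed

lemma hexagon_forces_bottom:
  assumes good: "good_arc n (restrict_arc R u w)" and v: "v \<in> labels n" "u < v" "v < w"
    and abs: "u \<noteq> - v" "v \<noteq> - w" "u \<noteq> - w" and vR: "\<not> (- v \<in> R \<and> u < - v \<and> - v < w)"
  shows "arc_forces n (restrict_arc R v w) (restrict_arc R u w)"
proof -
  have "arc_forces n (restrict_arc (uminus ` R) (- w) (- v)) (restrict_arc (uminus ` R) (- w) (- u))"
    by (rule hexagon_forces_top)
      (use good_arc_flip[OF good] v abs vR in \<open>auto simp: flip_restrict_arc uminus_image_iff\<close>)
  from arc_forces_flip[OF this] show ?thesis by (simp add: flip_restrict_arc)
qed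

text \<open>Around the middle block -b, -a, a, b the word can be chosen freely, one of c and -c
  going after the block; R decides for the positive one. Ranks 1 and 2 belong to a and b, hence the
  offset 2 for the rest.\<close>

lemma octagon_word:
  assumes ab: "a \<in> labels n" "b \<in> labels n" "0 < a" "a < b"
  obtains x where "x \<in> signed_perms n" "consecutive n (inv x (- a)) (inv x a)"
    "consecutive n (inv x a) (inv x b)"
    "\<And>c. c \<in> labels n \<Longrightarrow> c \<notin> {a, b, - a, - b} \<Longrightarrow>
       inv x a < inv x c \<longleftrightarrow> (if 0 < c then c \<in> R else - c \<notin> R)"
    "inv x (- a) < inv x a"
proof -
  define P where "P c \<longleftrightarrow> c \<in> {a, b} \<or> - c \<notin> {a, b} \<and> (if 0 < c then c \<in> R else - c \<notin> R)" for c
  define m where "m c = (if c = a then 1 else if c = b then 2 else 2 + \<bar>c\<bar>)" for c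
  have Pneg: "P (- c) \<longleftrightarrow> \<not> P c" if c: "c \<in> labels n" for c
  proof -
    have "c \<noteq> 0" using c by auto
    then have "0 < - c \<longleftrightarrow> \<not> 0 < c" by linarith
    moreover have "\<not> (c \<in> {a, b} \<and> - c \<in> {a, b})"
      unfolding insert_iff empty_iff using ab(3,4) by presburger
    ultimately show ?thesis
      unfolding P_def minus_minus by (cases "0 < c"; simp only: if_True if_False simp_thms; blast)
  qed
  have mpos: "0 < m c" for c unfolding m_def by auto
  obtain x where x: "x \<in> signed_perms n" and less: "\<And>c d. c \<in> labels n \<Longrightarrow> d \<in> labels n \<Longrightarrow>
      inv x c < inv x d \<longleftrightarrow> (if P c then m c else - m (- c)) < (if P d then m d else - m (- d))"
  proof (rule signed_perm_of_word[of n P m])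
    show "c = d" if cd: "c \<in> labels n" "d \<in> labels n" "P c" "P d" "m c = m d" for c d
    proof -
      have "c \<noteq> 0" "d \<noteq> 0" using cd by auto
      then have "\<bar>c\<bar> = \<bar>d\<bar>" using cd(5) unfolding m_def by (auto split: if_splits)
      then have "c = d \<or> c = - d" by linarith
      then show ?thesis using Pneg[OF cd(2)] cd(3,4) by auto
    qed
  qed (use Pneg mpos in auto)
  have PK: "P a" "P b" "\<not> P (- a)" "m a = 1" "m b = 2"
    using ab Pneg[OF ab(1)] unfolding P_def m_def by auto
  have l: "- a \<in> labels n" using ab by simp
  have btw: "\<not> (inv x (- a) < inv x c \<and> inv x c < inv x a)" "\<not> (inv x a < inv x c \<and> inv x c < inv x b)"
    if "c \<in> labels n" for c
    using less[OF ab(1) that] less[OF that ab(1)] less[OF l that] less[OF that ab(2)] PK mpos[of c] mpos[of "- c"]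
    by auto
  have ord: "inv x (- a) < inv x a" "inv x a < inv x b"
    using less[OF l ab(1)] less[OF ab(1,2)] PK by auto
  have key: "inv x a < inv x c \<longleftrightarrow> (if 0 < c then c \<in> R else - c \<notin> R)"
    if c: "c \<in> labels n" "c \<notin> {a, b, - a, - b}" for c
  proof -
    have "P c \<longleftrightarrow> (if 0 < c then c \<in> R else - c \<notin> R)" using c by (auto simp: P_def)
    moreover have "m c = 2 + \<bar>c\<bar>" using c by (simp add: m_def)
    ultimately show ?thesis using less[OF ab(1) c(1)] PK mpos[of "- c"] by auto
  qed
  show thesis
    by (rule that[OF x _ _ key ord(1)]) (use ab l btw ord consecutive_inv_iff[OF x] in auto)
qed

text \<open>In the octagon word all other entries surround the middle block, so exactly one of c and
  -c is on the right. Goodness of the arc gives at most one, the hypothesis \<open>one\<close> at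
  least one.\<close>

lemma octagon_forces_overlapping:
  assumes good: "good_arc n (restrict_arc R (- a) b)" and ab: "0 < a" "a < b"
    and one: "\<And>c. 0 < c \<Longrightarrow> c < a \<Longrightarrow> c \<in> R \<or> - c \<in> R"
  shows "arc_forces n (restrict_arc R (- a) a) (restrict_arc R (- a) b)"
    "arc_forces n (restrict_arc R a b) (restrict_arc R (- a) b)"
proof -
  note G = good_restrict_arcD[OF good]
  have l: "a \<in> labels n" "b \<in> labels n" using G(1,2) by auto
  obtain x where x: "x \<in> signed_perms n" and con: "consecutive n (inv x (- a)) (inv x a)"
    "consecutive n (inv x a) (inv x b)" and key: "\<And>c. c \<in> labels n \<Longrightarrow> c \<notin> {a, b, - a, - b} \<Longrightarrow>
       inv x a < inv x c \<longleftrightarrow> (if 0 < c then c \<in> R else - c \<notin> R)"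
    by (rule octagon_word[OF l ab, of R]) blast
  have mem: "c \<in> labels n \<and> inv x a < inv x c \<longleftrightarrow> c \<in> R" if "- a < c" "c < b" "c \<noteq> a" for c
  proof (cases "c \<in> labels n")
    case True
    have "c \<noteq> 0" using True by auto
    moreover have "- c \<notin> R \<longleftrightarrow> c \<in> R" if "c < 0"
      using G(5)[of c] one[of "- c"] that \<open>- a < c\<close> ab by auto
    ultimately show ?thesis using key[OF True] that True ab by (cases "0 < c") auto
  next
    case False
    then show ?thesis using G(4) that by blast
  qed
  have "a \<notin> R" using G(6) ab by auto
  have "c \<in> {c \<in> labels n. - a < c \<and> c < a \<and> inv x a < inv x c} \<longleftrightarrow> c \<in> R \<inter> {- a<..<a}"
    "c \<in> {c \<in> labels n. a < c \<and> c < b \<and> inv x a < inv x c} \<longleftrightarrow> c \<in> R \<inter> {a<..<b}" for c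
    using mem[of c] ab by auto
  then have s: "{c \<in> labels n. - a < c \<and> c < a \<and> inv x a < inv x c} = R \<inter> {- a<..<a}"
    "{c \<in> labels n. a < c \<and> c < b \<and> inv x a < inv x c} = R \<inter> {a<..<b}"
    by (intro Set.set_eqI; blast)+
  have s3: "{c \<in> labels n. - a < c \<and> c < b \<and> inv x a < inv x c} = R \<inter> {- a<..<b}"
  proof (intro Set.set_eqI)
    fix c show "c \<in> {c \<in> labels n. - a < c \<and> c < b \<and> inv x a < inv x c} \<longleftrightarrow> c \<in> R \<inter> {- a<..<b}"
      using mem[of c] \<open>a \<notin> R\<close> by (cases "c = a") auto
  qed
  show "arc_forces n (restrict_arc R (- a) a) (restrict_arc R (- a) b)"
    "arc_forces n (restrict_arc R a b) (restrict_arc R (- a) b)"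
    using octagon(1)[OF _ x con ab, unfolded s s3] unfolding arc_forces_def restrict_arc_def by blast+
qed

lemma octagon_forces_overlapping':
  assumes good: "good_arc n (restrict_arc R (- b) a)" and ab: "0 < a" "a < b"
    and one: "\<And>c. 0 < c \<Longrightarrow> c < a \<Longrightarrow> c \<in> R \<or> - c \<in> R"
  shows "arc_forces n (restrict_arc R (- a) a) (restrict_arc R (- b) a)"
proof -
  have "arc_forces n (restrict_arc (uminus ` R) (- a) a) (restrict_arc (uminus ` R) (- a) b)"
    by (rule octagon_forces_overlapping)
      (use good_arc_flip[OF good] ab one in \<open>auto simp: flip_restrict_arc uminus_image_iff\<close>)
  from arc_forces_flip[OF this] show ?thesis by (simp add: flip_restrict_arc)
qed

lemma half_turn_restrict_arc_iff:
  assumes "0 \<notin> R"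
  shows "half_turn (restrict_arc R (- b) b) = restrict_arc R (- b) b \<longleftrightarrow>
    (\<forall>c. c \<noteq> 0 \<longrightarrow> - b < c \<longrightarrow> c < b \<longrightarrow> (c \<in> R \<longleftrightarrow> - c \<notin> R))" (is "?l \<longleftrightarrow> ?r")
proof
  assume l: ?l
  show ?r
  proof (intro allI impI)
    fix c :: int assume c: "c \<noteq> 0" "- b < c" "c < b"
    have "c \<in> right_pts (half_turn (restrict_arc R (- b) b)) \<longleftrightarrow> c \<in> right_pts (restrict_arc R (- b) b)"
      using l by simp
    then show "c \<in> R \<longleftrightarrow> - c \<notin> R" using c by auto
  qed
next
  assume r: ?r
  show ?l
  proof (intro arc_eqI Set.set_eqI)
    fix c
    show "c \<in> right_pts (half_turn (restrict_arc R (- b) b)) \<longleftrightarrow> c \<in> right_pts (restrict_arc R (- b) b)"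
      using r[rule_format, of c] assms by (cases "c = 0") auto
  qed simp_all
qed

lemma good_restrict_arc_symmetric:
  assumes "good_arc n (restrict_arc R (- b) b)" "0 \<notin> R" "c \<noteq> 0" "- b < c" "c < b"
  shows "c \<in> R \<longleftrightarrow> - c \<notin> R"
proof -
  have "half_turn (restrict_arc R (- b) b) = restrict_arc R (- b) b"
    using assms(1) by (simp add: good_arc_def)
  then show ?thesis using half_turn_restrict_arc_iff[OF assms(2), of b] assms(3-5) by blast
qed

text \<open>Each chain of the octagon has an edge with a symmetric arc from b to -b, with -a on the
  right in one chain and a in the other. The given arc is symmetric, so it has exactly one of them
  on its right and matches one of these edges.\<close>

lemma octagon_forces_symmetric:
  assumes good: "good_arc n (restrict_arc R (- b) b)" and R: "0 \<notin> R" and ab: "0 < a" "a < b"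
  shows "arc_forces n (restrict_arc R (- a) a) (restrict_arc R (- b) b)"
    "arc_forces n (restrict_arc R a b) (restrict_arc R (- b) b)"
proof -
  note G = good_restrict_arcD[OF good]
  have l: "b \<in> labels n" "a \<in> labels n" using G(1,2) labels_between[of "- b" n b a] ab by auto
  have one: "c \<in> R \<longleftrightarrow> - c \<notin> R" if "c \<noteq> 0" "- b < c" "c < b" for c
    by (rule good_restrict_arc_symmetric[OF good R that])
  obtain x where x: "x \<in> signed_perms n" and con: "consecutive n (inv x (- a)) (inv x a)"
    "consecutive n (inv x a) (inv x b)" and key: "\<And>c. c \<in> labels n \<Longrightarrow> c \<notin> {a, b, - a, - b} \<Longrightarrow>
       inv x a < inv x c \<longleftrightarrow> (if 0 < c then c \<in> R else - c \<notin> R)" and ord: "inv x (- a) < inv x a"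
    by (rule octagon_word[OF l(2,1) ab, of R]) blast
  have mem: "c \<in> labels n \<and> inv x a < inv x c \<longleftrightarrow> c \<in> R" if "- b < c" "c < b" "c \<noteq> a" "c \<noteq> - a" for c
  proof (cases "c \<in> labels n")
    case True
    have "c \<noteq> 0" using True by auto
    then show ?thesis using key[OF True] that True one[of c] ab by auto
  next
    case False
    then show ?thesis using G(4) that by blast
  qed
  have "c \<in> {c \<in> labels n. - a < c \<and> c < a \<and> inv x a < inv x c} \<longleftrightarrow> c \<in> R \<inter> {- a<..<a}"
    "c \<in> {c \<in> labels n. a < c \<and> c < b \<and> inv x a < inv x c} \<longleftrightarrow> c \<in> R \<inter> {a<..<b}" for c
    using mem[of c] ab by auto
  then have s: "{c \<in> labels n. - a < c \<and> c < a \<and> inv x a < inv x c} = R \<inter> {- a<..<a}"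
    "{c \<in> labels n. a < c \<and> c < b \<and> inv x a < inv x c} = R \<inter> {a<..<b}"
    by (intro Set.set_eqI; blast)+
  have s3: "{c \<in> labels n. - b < c \<and> c < b \<and> inv x a < inv x c} = R \<inter> {- b<..<b} - {a, - a}"
  proof (intro Set.set_eqI)
    fix c show "c \<in> {c \<in> labels n. - b < c \<and> c < b \<and> inv x a < inv x c} \<longleftrightarrow> c \<in> R \<inter> {- b<..<b} - {a, - a}"
      using mem[of c] ord by (cases "c = a \<or> c = - a") auto
  qed
  have t: "R \<inter> {- b<..<b} = (if a \<in> R then insert a (R \<inter> {- b<..<b} - {a, - a})
      else insert (- a) (R \<inter> {- b<..<b} - {a, - a}))"
    using one[of a] ab by auto
  have "contracted n \<Theta> (restrict_arc R (- b) b)"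
    if "lattice_congruence (weak_order n) \<Theta>"
      "contracted n \<Theta> (restrict_arc R (- a) a) \<or> contracted n \<Theta> (restrict_arc R a b)" for \<Theta>
    using octagon(2,3)[OF that(1) x con ab, unfolded s s3] that(2) unfolding restrict_arc_def
    by (subst t) auto
  then show "arc_forces n (restrict_arc R (- a) a) (restrict_arc R (- b) b)"
    "arc_forces n (restrict_arc R a b) (restrict_arc R (- b) b)"
    unfolding arc_forces_def by blast+
qed

lemma good_restrict_arc_nonoverlapping:
  "p \<in> labels n \<Longrightarrow> q \<in> labels n \<Longrightarrow> p < q \<Longrightarrow> 0 < p \<or> q < 0 \<Longrightarrow> good_arc n (restrict_arc R p q)"
  by (rule good_arc_nonoverlapping) (auto simp: is_arc_restrict_arc overlapping_def)

text \<open>Arcs on one side of 0 are always good, and labels of one sign are never opposite, so the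
  hexagon applies.\<close>

lemma forces_positive_top:
  assumes "0 < p" "p < q" "q \<le> u" "p \<in> labels n" "u \<in> labels n"
  shows "arc_forces n (restrict_arc R p q) (restrict_arc R p u)"
proof (cases "q = u")
  case False
  show ?thesis
    by (rule hexagon_forces_top)
      (use assms False good_restrict_arc_nonoverlapping[of p n u R] labels_between[of p n u q] in auto)
qed (simp add: arc_forces_refl)

lemma forces_positive_bottom:
  assumes "0 < l" "l \<le> p" "p < u" "l \<in> labels n" "u \<in> labels n"
  shows "arc_forces n (restrict_arc R p u) (restrict_arc R l u)"
proof (cases "p = l")
  case False
  show ?thesis
    by (rule hexagon_forces_bottom)
      (use assms False good_restrict_arc_nonoverlapping[of l n u R] labels_between[of l n u p] in auto)
qed (simp add: arc_forces_refl)

text \<open>The smallest label \<open>c\<close> such that both \<open>c\<close> and \<open>-c\<close> lie to the left of the overlapping arc is the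
  obstruction to a single octagon; the arcs ending at \<open>c\<close> or \<open>-c\<close> serve as intermediate steps.\<close>

lemma symmetric_forces_overlapping:
  assumes good: "good_arc n (restrict_arc R l u)" and R: "0 \<notin> R" and lu: "l < 0" "0 < u" "l \<noteq> - u"
    and q: "0 < q" "q \<le> u" "q \<le> - l" and sym: "good_arc n (restrict_arc R (- q) q)"
  shows "arc_forces n (restrict_arc R (- q) q) (restrict_arc R l u)"
proof -
  note G = good_restrict_arcD[OF good]
  \<comment> \<open>Up to m both c and -c lie within the heights of the arc.\<close>
  define m where "m = min (- l) u"
  \<comment> \<open>The obstructing labels from q on; m is added so that the minimum exists, and k =
    m means that nothing obstructs below m.\<close>
  define S where "S = {c \<in> {q..m}. c = m \<or> c \<notin> R \<and> - c \<notin> R}"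
  have "finite S" by (rule finite_subset[of _ "{q..m}"]) (auto simp: S_def)
  moreover have "m \<in> S" using q by (auto simp: S_def m_def)
  ultimately have "Min S \<in> S" "\<And>c. c \<in> S \<Longrightarrow> Min S \<le> c" by (auto intro: Min_in)
  then obtain k where k: "k \<in> S" and min: "\<And>c. c \<in> S \<Longrightarrow> k \<le> c"
    by blast
  have kb: "q \<le> k" "k \<le> m" "m \<le> - l" "m \<le> u" using k by (auto simp: S_def m_def)
  have one: "c \<in> R \<longleftrightarrow> - c \<notin> R" if c: "c \<noteq> 0" "- k < c" "c < k" for c
  proof (cases "- q < c \<and> c < q")
    case True
    then show ?thesis using good_restrict_arc_symmetric[OF sym R c(1)] by blast
  next
    case False
    have "\<bar>c\<bar> \<notin> S" using min[of "\<bar>c\<bar>"] c by auto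
    then have "c \<in> R \<or> - c \<in> R" using c False kb by (auto simp: S_def abs_if split: if_splits)
    then show ?thesis using G(5)[of c] c kb by auto
  qed
  have kl: "k \<in> labels n" using labels_between[OF _ G(2), of "- u" k] G(2) kb q by auto
  have Gk: "good_arc n (restrict_arc R (- k) k)"
  proof (rule good_restrict_arcI)
    show "half_turn (restrict_arc R (- k) k) = restrict_arc R (- k) k"
      unfolding half_turn_restrict_arc_iff[OF R] using one by blast
    show False if "c \<in> R" "- c \<in> R" "- k < c" "c < k" for c
      using one[of c] that R by (cases "c = 0") auto
  qed (use kl kb q R in auto)
  have s1: "arc_forces n (restrict_arc R (- q) q) (restrict_arc R (- k) k)"
  proof (cases "q = k")
    case False
    then show ?thesis using octagon_forces_symmetric(1)[OF Gk R q(1)] kb by simp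
  qed (simp add: arc_forces_refl)
  have one': "c \<in> R \<or> - c \<in> R" if "0 < c" "c < k" for c using one[of c] that by auto
  have "arc_forces n (restrict_arc R (- k) k) (restrict_arc R l u)"
  proof (cases "k = m")
    case True
    show ?thesis
    proof (cases "- l < u")
      case c: True
      then have k: "k = - l" using True by (simp add: m_def)
      show ?thesis using octagon_forces_overlapping(1)[of n R k u] good one' c lu unfolding k by simp
    next
      case False
      then have k: "k = u" using True by (simp add: m_def)
      show ?thesis using octagon_forces_overlapping'[of n R "- l" k] good one' False lu unfolding k by simp
    qed
  next
    case False
    \<comment> \<open>Both k and -k lie to the left, so the arc from -k to u is good. An octagon
      reaches it, and a hexagon with middle value -k moves the lower endpoint on to l.\<close>
    then have kR: "k \<notin> R" "- k \<notin> R" and km: "k < m" using k kb by (auto simp: S_def)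
    have G1: "good_arc n (restrict_arc R (- k) u)"
    proof (rule good_restrict_arcI)
      show False if "c \<in> R" "- c \<in> R" "- k < c" "c < u" "- k < - c" "- c < u" for c
        using G(5)[of c] that kb by auto
    qed (use kl G(2) km kb kR q R in auto)
    have "arc_forces n (restrict_arc R (- k) k) (restrict_arc R (- k) u)"
      using octagon_forces_overlapping(1)[OF G1 _ _ one'] km kb q by simp
    moreover have "arc_forces n (restrict_arc R (- k) u) (restrict_arc R l u)"
      by (rule hexagon_forces_bottom[OF good]) (use kl kR km kb q lu in auto)
    ultimately show ?thesis by (rule arc_forces_trans)
  qed
  then show ?thesis using s1 arc_forces_trans by blast
qed

text \<open>First the upper endpoint moves to u, then the lower one from p past 0 to l. If some c
  below p has c and -c both to the left, the arc descends to c and passes to l by a hexagon.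
  Otherwise a hexagon does it at once, unless -p is on the right or equals l; in that case p is to
  the left, and an octagon leads to -p, from where a hexagon reaches l if l is lower.\<close>

lemma positive_forces_overlapping:
  assumes good: "good_arc n (restrict_arc R l u)" and lu: "l < 0" "0 < u" "l \<noteq> - u"
    and pq: "0 < p" "p < q" "q \<le> u"
  shows "arc_forces n (restrict_arc R p q) (restrict_arc R l u)"
proof -
  note G = good_restrict_arcD[OF good]
  have lab: "c \<in> labels n" if "0 < c" "c \<le> u" for c
    using labels_between[OF G(1,2), of c] that lu by auto
  have "arc_forces n (restrict_arc R p q) (restrict_arc R p u)"
    by (rule forces_positive_top) (use pq lab in auto)
  moreover have "arc_forces n (restrict_arc R p u) (restrict_arc R l u)"
  proof (cases "\<exists>c. 0 < c \<and> c < p \<and> c < - l \<and> c \<notin> R \<and> - c \<notin> R")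
    case True
    then obtain c where c: "0 < c" "c < p" "c < - l" "c \<notin> R" "- c \<notin> R" by blast
    have "arc_forces n (restrict_arc R p u) (restrict_arc R c u)"
      by (rule forces_positive_bottom) (use c pq lab in auto)
    moreover have "arc_forces n (restrict_arc R c u) (restrict_arc R l u)"
      by (rule hexagon_forces_bottom[OF good]) (use c pq lab lu in auto)
    ultimately show ?thesis by (rule arc_forces_trans)
  next
    case no: False
    show ?thesis
    proof (cases "(- p \<in> R \<and> l < - p) \<or> l = - p")
      case False
      show ?thesis
        by (rule hexagon_forces_bottom[OF good]) (use pq lab lu False in auto)
    next
      case True
      then have lp: "l \<le> - p" by auto
      have pR: "p \<notin> R" using True G(5)[of p] G(6) pq lu lp by auto
      have one: "c \<in> R \<or> - c \<in> R" if "0 < c" "c < p" for c using no that lp by auto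
      have zero: "\<not> (0 \<in> R \<and> l < 0 \<and> 0 < u)" using good by (simp add: good_arc_def is_arc_restrict_arc)
      have G1: "good_arc n (restrict_arc R (- p) u)"
      proof (rule good_restrict_arcI)
        show False if "c \<in> R" "- c \<in> R" "- p < c" "c < u" "- p < - c" "- c < u" for c
          using G(5)[of c] that lp by auto
      qed (use lab[of p] G(2) pq lp lu pR zero in auto)
      have s: "arc_forces n (restrict_arc R p u) (restrict_arc R (- p) u)"
        using octagon_forces_overlapping(2)[OF G1 _ _ one] pq by simp
      show ?thesis
      proof (cases "l = - p")
        case False
        have "arc_forces n (restrict_arc R (- p) u) (restrict_arc R l u)"
          by (rule hexagon_forces_bottom[OF good]) (use pq lab[of p] lu lp pR False in auto)
        then show ?thesis using s arc_forces_trans by blast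
      qed (use s in simp)
    qed
  qed
  ultimately show ?thesis by (rule arc_forces_trans)
qed

text \<open>As -p < q, the label -p lies within the smaller arc and is known to be on its left.
  Moving the upper endpoint first therefore keeps the intermediate arc from p to u good.\<close>

lemma overlapping_forces_overlapping:
  assumes good: "good_arc n (restrict_arc R l u)" and lu: "l \<noteq> - u"
    and good': "good_arc n (restrict_arc R p q)" and pq: "l \<le> p" "p < 0" "0 < q" "q \<le> u" "- p < q"
  shows "arc_forces n (restrict_arc R p q) (restrict_arc R l u)"
proof -
  note G = good_restrict_arcD[OF good] and G' = good_restrict_arcD[OF good']
  have pR: "- p \<notin> R" using G'(6) pq by auto
  have zero: "\<not> (0 \<in> R \<and> l < 0 \<and> 0 < u)" using good by (simp add: good_arc_def is_arc_restrict_arc)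
  have G1: "good_arc n (restrict_arc R p u)"
  proof (rule good_restrict_arcI)
    show False if "c \<in> R" "- c \<in> R" "p < c" "c < u" "p < - c" "- c < u" for c
      using G(5)[of c] that pq by auto
    show "\<not> (- u \<in> R \<and> p < - u)" using G(7) pq by auto
  qed (use G'(1) G(2) pq pR zero in auto)
  have "arc_forces n (restrict_arc R p q) (restrict_arc R p u)"
  proof (cases "q = u")
    case False
    show ?thesis by (rule hexagon_forces_top[OF G1]) (use G'(2) pq False in auto)
  qed (simp add: arc_forces_refl)
  moreover have "arc_forces n (restrict_arc R p u) (restrict_arc R l u)"
  proof (cases "p = l")
    case False
    show ?thesis by (rule hexagon_forces_bottom[OF good]) (use G'(1) pq False pR lu in auto)
  qed (simp add: arc_forces_refl)
  ultimately show ?thesis by (rule arc_forces_trans)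
qed

lemma good_subarc_forces:
  assumes s: "good_subarc n \<beta> \<alpha>"
  shows "arc_forces n \<beta> \<alpha>"
proof -
  define R l u p q where "R = right_pts \<alpha>" and "l = lower \<alpha>" and "u = upper \<alpha>"
    and "p = lower \<beta>" and "q = upper \<beta>"
  note S = good_subarcD[OF s]
  have arcs: "is_arc n \<alpha>" "is_arc n \<beta>" using S(1,2) by (auto simp: good_arc_def)
  note D = is_arcD[OF arcs(1), folded l_def u_def R_def] and D' = is_arcD[OF arcs(2), folded p_def q_def]
  have R0: "0 \<notin> R" using D(8) by blast
  have \<alpha>: "\<alpha> = restrict_arc R l u"
    by (rule arc_eqI) (use D(6,7) in \<open>auto simp: l_def u_def R_def\<close>)
  have \<beta>: "\<beta> = restrict_arc R p q"
  proof (rule arc_eqI)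
    show "right_pts \<beta> = right_pts (restrict_arc R p q)"
      unfolding restrict_arc_def arc.sel R_def p_def q_def by (rule S(5))
  qed (simp_all add: p_def q_def)
  have le: "l \<le> p" "q \<le> u" using S(3,4) by (auto simp: l_def u_def p_def q_def)
  note good = S(2)[unfolded \<alpha>] and good' = S(1)[unfolded \<beta>]
  note good_neg = good_arc_flip[OF good, unfolded flip_restrict_arc]
    and good_neg' = good_arc_flip[OF good', unfolded flip_restrict_arc]
  \<comment> \<open>Arcs below 0, and overlapping arcs whose upper endpoint is nearer to 0, are
    handled by reflection.\<close>
  have unflip: "arc_forces n (restrict_arc R p q) (restrict_arc R l u)"
    if "arc_forces n (restrict_arc (uminus ` R) (- q) (- p)) (restrict_arc (uminus ` R) (- u) (- l))"
    using arc_forces_flip[OF that] by (simp add: flip_restrict_arc)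
  have R0': "0 \<notin> uminus ` R" using R0 by (simp add: uminus_image_iff)
  have positive: "arc_forces n (restrict_arc R p q) (restrict_arc R l u)"
    if good: "good_arc n (restrict_arc R l u)" and "0 \<notin> R" "p \<in> labels n" "0 < p" "p < q" "l \<le> p" "q \<le> u"
    for R l u p q
  proof -
    note G = good_restrict_arcD[OF good]
    consider "0 < l" | "l = - u" | "l < 0" "l \<noteq> - u" using G(1) by (metis linorder_neqE_linordered_idom zero_not_in_labels)
    then show ?thesis
    proof cases
      case 1
      have "arc_forces n (restrict_arc R p q) (restrict_arc R p u)"
        by (rule forces_positive_top) (use that G in auto)
      moreover have "arc_forces n (restrict_arc R p u) (restrict_arc R l u)"
        by (rule forces_positive_bottom) (use that G 1 in auto)
      ultimately show ?thesis by (rule arc_forces_trans)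
    next
      case 2
      have "arc_forces n (restrict_arc R p q) (restrict_arc R p u)"
        by (rule forces_positive_top) (use that G in auto)
      moreover have "arc_forces n (restrict_arc R p u) (restrict_arc R l u)"
        using octagon_forces_symmetric(2)[of n R u p] that 2 by simp
      ultimately show ?thesis by (rule arc_forces_trans)
    next
      case 3
      show ?thesis by (rule positive_forces_overlapping[OF good]) (use that 3 in auto)
    qed
  qed
  consider "0 < p" | "q < 0" | "p < 0" "0 < q" using D'(4,5) by linarith
  then have "arc_forces n (restrict_arc R p q) (restrict_arc R l u)"
  proof cases
    case 1
    then show ?thesis using positive[OF good R0 D'(1)] D'(3) le by simp
  next
    case 2
    then show ?thesis using positive[OF good_neg R0', of "- q" "- p"] D'(2,3) le unflip by simp
  next
    case 3
    then have o: "overlapping \<beta>" by (simp add: overlapping_def p_def q_def)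
    show ?thesis
    proof (cases "l = - u")
      case True
      \<comment> \<open>The last clause of \<open>good_subarc\<close> excludes an overlapping pair
        here, so \<beta> is symmetric and one octagon is enough.\<close>
      then have "half_turn \<alpha> = \<alpha>" using S(2) by (simp add: good_arc_def l_def u_def)
      then have "half_turn \<beta> = \<beta>" using S(6) o by blast
      then have pq: "p = - q" using half_turn_simps(1)[of \<beta>] by (simp add: p_def q_def)
      show ?thesis
      proof (cases "q = u")
        case False
        then show ?thesis
          using octagon_forces_symmetric(1)[of n R u q] good R0 3 le True pq by simp
      qed (use True pq arc_forces_refl in simp)
    next
      case lu: False
      consider "p = - q" | "- p < q" | "q < - p" by linarith
      then show ?thesis
      proof cases
        case 1
        then show ?thesis
          using symmetric_forces_overlapping[OF good R0 _ _ lu, of q] good' 3 le by simp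
      next
        case 2
        then show ?thesis
          using overlapping_forces_overlapping[OF good lu good'] 3 le by simp
      next
        case c: 3
        show ?thesis
          by (rule unflip, rule overlapping_forces_overlapping[OF good_neg _ good_neg'])
            (use c lu 3 le in auto)
      qed
    qed
  qed
  then show ?thesis unfolding \<alpha> \<beta> .
qed

lemma subarc_set_imp_forces:
  assumes "join_irreducible n j\<^sub>1" "join_irreducible n j\<^sub>2"
    and "subarc_set n (delta n j\<^sub>1) (delta n j\<^sub>2)"
  shows "forces n j\<^sub>1 j\<^sub>2"
proof -
  obtain \<beta> \<alpha> where "\<beta> \<in> delta n j\<^sub>1" "\<alpha> \<in> delta n j\<^sub>2" "good_subarc n \<beta> \<alpha>"
    using assms(3) unfolding subarc_set_def by blast
  then show ?thesis
    using good_subarc_forces contracts_iff_contracted assms(1,2)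
    unfolding forces_def arc_forces_def by blast
qed

section \<open>Curves representing arcs\<close>

text \<open>Piecewise linear interpolation as a sum of hat functions: continuity is immediate, and
  two curves are compared term by term.\<close>

definition interpolate :: "nat \<Rightarrow> (int \<Rightarrow> real) \<Rightarrow> real \<Rightarrow> real" where
  "interpolate n F y = (\<Sum>i\<in>{- int n..int n}. F i * max 0 (1 - \<bar>y - real_of_int i\<bar>))"

lemma continuous_on_interpolate: "continuous_on S (interpolate n F)"
  unfolding interpolate_def by (intro continuous_intros)

lemma interpolate_of_int:
  assumes "k \<in> {- int n..int n}"
  shows "interpolate n F (real_of_int k) = F k"
proof -
  have "max 0 (1 - \<bar>real_of_int k - real_of_int i\<bar>) = (if i = k then 1 else 0)" for i
  proof (cases "i = k")
    case False
    then have "1 \<le> \<bar>k - i\<bar>" by linarith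
    then have "1 \<le> \<bar>real_of_int k - real_of_int i\<bar>" by linarith
    then show ?thesis using False by simp
  qed simp
  then have "interpolate n F (real_of_int k) = (\<Sum>i\<in>{- int n..int n}. if i = k then F i else 0)"
    unfolding interpolate_def by (intro sum.cong) auto
  then show ?thesis using assms by (simp add: sum.delta)
qed

text \<open>At y the hat functions outside the integers from a to b vanish, and the one at the
  integer part of y is positive, which makes the inequality strict.\<close>

lemma interpolate_less:
  assumes ab: "- int n \<le> a" "b \<le> int n" and y: "real_of_int a \<le> y" "y \<le> real_of_int b"
    and less: "\<And>i. a \<le> i \<Longrightarrow> i \<le> b \<Longrightarrow> G i < F i"
  shows "interpolate n G y < interpolate n F y"
  unfolding interpolate_def
proof (rule sum_strict_mono_ex1)
  let ?h = "\<lambda>i. max 0 (1 - \<bar>y - real_of_int i\<bar>)"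
  show "\<forall>i\<in>{- int n..int n}. G i * ?h i \<le> F i * ?h i"
  proof
    fix i :: int
    show "G i * ?h i \<le> F i * ?h i"
    proof (cases "a \<le> i \<and> i \<le> b")
      case True
      then show ?thesis using less[of i] by (intro mult_right_mono) auto
    next
      case False
      then have "real_of_int i \<le> real_of_int a - 1 \<or> real_of_int b + 1 \<le> real_of_int i" by linarith
      then have "?h i = 0" using y by auto
      then show ?thesis by simp
    qed
  qed
  have f: "a \<le> \<lfloor>y\<rfloor>" "\<lfloor>y\<rfloor> \<le> b" using y by linarith+
  have "0 < ?h \<lfloor>y\<rfloor>" by linarith
  then have "G \<lfloor>y\<rfloor> * ?h \<lfloor>y\<rfloor> < F \<lfloor>y\<rfloor> * ?h \<lfloor>y\<rfloor>"
    by (intro mult_strict_right_mono less f)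
  then show "\<exists>i\<in>{- int n..int n}. G i * ?h i < F i * ?h i"
    using f ab by (intro bexI[of _ "\<lfloor>y\<rfloor>"]) auto
qed simp

lemma represents_interpolate:
  assumes \<alpha>: "is_arc n \<alpha>" and F: "F (lower \<alpha>) = 0" "F (upper \<alpha>) = 0"
    "\<And>i. i \<in> left_pts \<alpha> \<Longrightarrow> 0 < F i" "\<And>i. i \<in> right_pts \<alpha> \<Longrightarrow> F i < 0"
  shows "represents (interpolate n F) \<alpha>"
proof -
  note D = is_arcD[OF \<alpha>]
  have l: "i \<in> {- int n..int n}" if "lower \<alpha> \<le> i" "i \<le> upper \<alpha>" for i
    using D(1,2) that by (auto simp: labels_def)
  have "i \<in> {- int n..int n}" if "i \<in> left_pts \<alpha> \<or> i \<in> right_pts \<alpha>" for i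
    using that D(6,7)[of i] by (intro l) (auto simp: left_pts_def)
  then show ?thesis
    unfolding represents_def using F l[of "lower \<alpha>"] l[of "upper \<alpha>"] D(3)
    by (simp add: continuous_on_interpolate interpolate_of_int)
qed

lemma good_arc_right_of:
  assumes good: "good_arc n \<alpha>" and o: "overlapping \<alpha>" and ns: "half_turn \<alpha> \<noteq> \<alpha>"
  obtains f g where "represents f \<alpha>" "represents g (half_turn \<alpha>)"
    "\<And>y. y \<in> common_heights \<alpha> (half_turn \<alpha>) \<Longrightarrow> g y < f y"
proof -
  have \<alpha>: "is_arc n \<alpha>" using good by (simp add: good_arc_def)
  note D = is_arcD[OF \<alpha>]
  let ?l = "lower \<alpha>" and ?u = "upper \<alpha>" and ?R = "right_pts \<alpha>"
  have lu: "?l \<noteq> - ?u" "?l < 0" "0 < ?u" using good ns o by (auto simp: good_arc_def overlapping_def)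
  have R: "- c \<notin> ?R" if "c \<in> ?R \<or> c = ?l \<or> c = ?u" for c
    using good that by (auto simp: good_arc_def)
  \<comment> \<open>Where both curves pass a label on the same side, the values -2 < -1 and 1 < 2
    put \<alpha> further right. Goodness excludes the bad combination: at a right-hand point or an
    endpoint of \<alpha> in the common range the other curve has value -2.\<close>
  define F where "F i = (if i = ?l \<or> i = ?u then 0 else if i \<in> ?R then - 1 else 2 :: real)" for i
  define G where "G i = (if i = - ?l \<or> i = - ?u then 0
      else if - ?u < i \<and> i < - ?l \<and> i \<noteq> 0 \<and> - i \<notin> ?R then - 2 else 1 :: real)" for i
  have f: "represents (interpolate n F) \<alpha>"
    by (rule represents_interpolate[OF \<alpha>]) (use D in \<open>auto simp: F_def left_pts_def\<close>)
  have g: "represents (interpolate n G) (half_turn \<alpha>)"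
    by (rule represents_interpolate[OF is_arc_half_turn[OF \<alpha>]])
      (use D in \<open>auto simp: G_def left_pts_def[of "half_turn \<alpha>"]\<close>)
  have less: "G i < F i" if i: "max ?l (- ?u) \<le> i" "i \<le> min ?u (- ?l)" for i
  proof (cases "i \<in> ?R \<or> i = ?l \<or> i = ?u")
    case True
    have "- i \<notin> ?R" using R True by blast
    moreover have "i \<noteq> - ?l" "i \<noteq> - ?u" using True R[of ?l] R[of ?u] lu by auto
    moreover have "i \<noteq> 0" using True D(4,5) D(8)[of i] by auto
    ultimately have "G i = - 2" using i by (simp add: G_def)
    then show ?thesis by (simp add: F_def)
  next
    case False
    then show ?thesis by (auto simp: F_def G_def)
  qed
  have "interpolate n G y < interpolate n F y" if "y \<in> common_heights \<alpha> (half_turn \<alpha>)" for y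
  proof (rule interpolate_less[of n "max ?l (- ?u)" "min ?u (- ?l)"])
    show "- int n \<le> max ?l (- ?u)" "min ?u (- ?l) \<le> int n"
      using D(1,2) by (auto simp: labels_def)
    show "real_of_int (max ?l (- ?u)) \<le> y" "y \<le> real_of_int (min ?u (- ?l))"
      using that by (auto simp: common_heights_def max_def min_def)
  qed (rule less)
  then show thesis using that f g by blast
qed

text \<open>At a right-hand point of \<alpha> in the common range f is negative, hence so is g; thus
  the point is to the right of -\<alpha> as well and is no endpoint of it. This is the condition on
  opposite labels.\<close>

lemma right_of_good_arc:
  assumes \<alpha>: "is_arc n \<alpha>" and r: "right_of \<alpha> (half_turn \<alpha>)" and o: "overlapping \<alpha>"
    and lu: "lower \<alpha> \<noteq> - upper \<alpha>"
  shows "good_arc n \<alpha>"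
proof -
  note D = is_arcD[OF \<alpha>]
  let ?l = "lower \<alpha>" and ?u = "upper \<alpha>" and ?R = "right_pts \<alpha>"
  obtain f g where fg: "represents f \<alpha>" "represents g (half_turn \<alpha>)"
    and less: "\<And>y. y \<in> common_heights \<alpha> (half_turn \<alpha>) \<Longrightarrow> g y < f y"
    using r unfolding right_of_def by blast
  have f: "f (real_of_int c) < 0" if "c \<in> ?R" for c using fg(1) that by (simp add: represents_def)
  have g: "0 \<le> g (real_of_int c)" if "c \<in> left_pts (half_turn \<alpha>) \<or> c = - ?l \<or> c = - ?u" for c
    using fg(2) that unfolding represents_def by fastforce
  have False if c: "c \<in> ?R" "- c \<in> ?R \<or> c = - ?l \<or> c = - ?u" for c
  proof -
    have lc: "?l < c" "c < ?u" "c \<noteq> 0" using c(1) D(6-8) by auto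
    have b: "- ?u \<le> c" "c \<le> - ?l" using c(2) D(3) D(6,7)[of "- c"] by auto
    have "real_of_int c \<in> common_heights \<alpha> (half_turn \<alpha>)"
      using lc b by (simp add: common_heights_def)
    then have "g (real_of_int c) < f (real_of_int c)" by (rule less)
    moreover have "c \<in> left_pts (half_turn \<alpha>) \<or> c = - ?l \<or> c = - ?u"
      using c(2) lc b by (auto simp: left_pts_def)
    ultimately show False using f[OF c(1)] g[of c] by linarith
  qed
  then show ?thesis using \<alpha> lu unfolding good_arc_def by blast
qed

text \<open>An arc on one side of 0 and its half-turn have no height in common, so any two
  representing curves will do.\<close>

lemma nonoverlapping_compatible:
  assumes \<alpha>: "is_arc n \<alpha>" and no: "\<not> overlapping \<alpha>"
  shows "compatible \<alpha> (half_turn \<alpha>)"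
proof -
  note D = is_arcD[OF \<alpha>]
  have rep: "\<exists>f. represents f \<beta>" if \<beta>: "is_arc n \<beta>" for \<beta>
  proof -
    have "represents (interpolate n (\<lambda>i. if i = lower \<beta> \<or> i = upper \<beta> then 0
        else if i \<in> right_pts \<beta> then - 1 else 1)) \<beta>"
      by (rule represents_interpolate[OF \<beta>]) (use is_arcD[OF \<beta>] in \<open>auto simp: left_pts_def\<close>)
    then show ?thesis by blast
  qed
  have sign: "0 < lower \<alpha> \<or> upper \<alpha> < 0" using no D(3-5) by (auto simp: overlapping_def)
  then have "common_heights \<alpha> (half_turn \<alpha>) = {}" using D(3) by (auto simp: common_heights_def)
  then show ?thesis
    using rep[OF \<alpha>] rep[OF is_arc_half_turn[OF \<alpha>]] sign D(3)
    unfolding compatible_def by auto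
qed

section \<open>Comparison with the geometric definitions\<close>

lemma labeled_pair_iff: "labeled_pair n \<alpha> \<longleftrightarrow> good_arc n \<alpha> \<and> half_turn \<alpha> \<noteq> \<alpha>"
proof
  assume l: "labeled_pair n \<alpha>"
  then have \<alpha>: "is_arc n \<alpha>" and ns: "half_turn \<alpha> \<noteq> \<alpha>" and c: "compatible \<alpha> (half_turn \<alpha>)"
    and r: "overlapping \<alpha> \<Longrightarrow> right_of \<alpha> (half_turn \<alpha>)"
    by (auto simp: labeled_pair_def symmetric_pair_def)
  \<comment> \<open>\<open>compatible\<close> requires different lower endpoints, so the endpoints
    are not opposite; in the overlapping case \<open>right_of\<close> then gives the condition on
    right-hand points.\<close>
  have "lower \<alpha> \<noteq> - upper \<alpha>" using c by (simp add: compatible_def)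
  then have "good_arc n \<alpha>"
    using right_of_good_arc[OF \<alpha> r] good_arc_nonoverlapping[OF \<alpha>] by blast
  then show "good_arc n \<alpha> \<and> half_turn \<alpha> \<noteq> \<alpha>" using ns by blast
next
  assume g: "good_arc n \<alpha> \<and> half_turn \<alpha> \<noteq> \<alpha>"
  then have \<alpha>: "is_arc n \<alpha>" by (simp add: good_arc_def)
  show "labeled_pair n \<alpha>"
  proof (cases "overlapping \<alpha>")
    case True
    obtain f g' where fg: "represents f \<alpha>" "represents g' (half_turn \<alpha>)"
      and less: "\<And>y. y \<in> common_heights \<alpha> (half_turn \<alpha>) \<Longrightarrow> g' y < f y"
      using good_arc_right_of[OF _ True] g by blast
    have "lower \<alpha> \<noteq> - upper \<alpha>" using g by (auto simp: good_arc_def)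
    moreover have "\<forall>y\<in>common_heights \<alpha> (half_turn \<alpha>). f y \<noteq> g' y" using less by force
    ultimately have "compatible \<alpha> (half_turn \<alpha>)"
      using fg unfolding compatible_def half_turn_simps by (smt (verit))
    moreover have "right_of \<alpha> (half_turn \<alpha>)" using fg less unfolding right_of_def by blast
    ultimately show ?thesis using \<alpha> g by (simp add: labeled_pair_def symmetric_pair_def)
  next
    case False
    then show ?thesis
      using \<alpha> g nonoverlapping_compatible by (simp add: labeled_pair_def symmetric_pair_def)
  qed
qed

lemma symmetric_arc_iff: "symmetric_arc n \<alpha> \<longleftrightarrow> good_arc n \<alpha> \<and> half_turn \<alpha> = \<alpha>"
proof
  assume s: "symmetric_arc n \<alpha>"
  then have \<alpha>: "is_arc n \<alpha>" and h: "half_turn \<alpha> = \<alpha>" by (auto simp: symmetric_arc_def)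
  have lu: "lower \<alpha> = - upper \<alpha>" using half_turn_simps(1)[of \<alpha>] h by simp
  have "- c \<notin> right_pts \<alpha>" if "c \<in> right_pts \<alpha>" for c
    using half_turn_simps(3)[of c \<alpha>] that h by simp
  then show "good_arc n \<alpha> \<and> half_turn \<alpha> = \<alpha>"
    using \<alpha> h lu is_arcD(6,7)[OF \<alpha>] unfolding good_arc_def by force
qed (simp add: symmetric_arc_def good_arc_def)

lemma symmetric_right_pts:
  assumes "half_turn \<alpha> = \<alpha>" "lower \<alpha> < c" "c < upper \<alpha>" "c \<noteq> 0"
  shows "c \<in> right_pts \<alpha> \<longleftrightarrow> - c \<notin> right_pts \<alpha>"
  using half_turn_simps(1)[of \<alpha>] half_turn_simps(3)[of c \<alpha>] assms by simp

text \<open>The four clauses differ from \<open>good_subarc\<close> in two points: a pair inside a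
  symmetric arc is given by its positive arc, and a symmetric arc inside a pair is a restriction of
  both arcs of the pair. In either case the symmetric arc involved makes up the difference.\<close>

lemma subarc_or_subarc_pair_iff:
  assumes \<beta>\<^sub>0: "is_arc n \<beta>\<^sub>0" and \<alpha>\<^sub>0: "is_arc n \<alpha>\<^sub>0"
  shows "subarc_or_subarc_pair n {\<beta>\<^sub>0, half_turn \<beta>\<^sub>0} {\<alpha>\<^sub>0, half_turn \<alpha>\<^sub>0} \<longleftrightarrow>
    subarc_set n {\<beta>\<^sub>0, half_turn \<beta>\<^sub>0} {\<alpha>\<^sub>0, half_turn \<alpha>\<^sub>0}"
proof
  assume "subarc_or_subarc_pair n {\<beta>\<^sub>0, half_turn \<beta>\<^sub>0} {\<alpha>\<^sub>0, half_turn \<alpha>\<^sub>0}"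
  then obtain \<beta> \<alpha> where eq: "{\<beta>\<^sub>0, half_turn \<beta>\<^sub>0} = {\<beta>, half_turn \<beta>}" "{\<alpha>\<^sub>0, half_turn \<alpha>\<^sub>0} = {\<alpha>, half_turn \<alpha>}"
    and cases: "arc_subarc_of_arc n \<beta> \<alpha> \<or> pair_subarc_of_arc n \<beta> \<alpha> \<or>
         arc_subarc_of_pair n \<beta> \<alpha> \<or> pair_subarc_of_pair n \<beta> \<alpha>"
    unfolding subarc_or_subarc_pair_def by blast
  have sym: "lower \<gamma> = - upper \<gamma>" if "symmetric_arc n \<gamma>" for \<gamma>
    using half_turn_simps(1)[of \<gamma>] that unfolding symmetric_arc_def by metis
  have "good_subarc n \<beta> \<alpha>"
    using cases
  proof (elim disjE)
    assume "arc_subarc_of_arc n \<beta> \<alpha>"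
    then show ?thesis
      using sym[of \<alpha>] sym[of \<beta>] unfolding arc_subarc_of_arc_def good_subarc_def symmetric_arc_iff by auto
  next
    assume p: "pair_subarc_of_arc n \<beta> \<alpha>"
    then have \<alpha>: "symmetric_arc n \<alpha>" and \<beta>: "is_arc n \<beta>" "0 < lower \<beta>"
      by (auto simp: pair_subarc_of_arc_def symmetric_pair_def)
    have no: "\<not> overlapping \<beta>" using \<beta>(2) by (simp add: overlapping_def)
    have "lower \<alpha> \<le> lower \<beta>"
      using sym[OF \<alpha>] \<beta>(2) \<alpha> is_arcD(3)[of n \<alpha>] by (simp add: symmetric_arc_def)
    then show ?thesis
      using p no good_arc_nonoverlapping[OF \<beta>(1) no]
      unfolding pair_subarc_of_arc_def good_subarc_def symmetric_arc_iff by blast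
  next
    assume "arc_subarc_of_pair n \<beta> \<alpha>"
    then show ?thesis
      unfolding arc_subarc_of_pair_def good_subarc_def symmetric_arc_iff labeled_pair_iff by blast
  next
    assume "pair_subarc_of_pair n \<beta> \<alpha>"
    then show ?thesis
      unfolding pair_subarc_of_pair_def good_subarc_def labeled_pair_iff by blast
  qed
  then show "subarc_set n {\<beta>\<^sub>0, half_turn \<beta>\<^sub>0} {\<alpha>\<^sub>0, half_turn \<alpha>\<^sub>0}"
    unfolding eq subarc_set_def by blast
next
  assume "subarc_set n {\<beta>\<^sub>0, half_turn \<beta>\<^sub>0} {\<alpha>\<^sub>0, half_turn \<alpha>\<^sub>0}"
  then obtain \<beta> \<alpha> where mem: "\<beta> \<in> {\<beta>\<^sub>0, half_turn \<beta>\<^sub>0}" "\<alpha> \<in> {\<alpha>\<^sub>0, half_turn \<alpha>\<^sub>0}"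
    and s: "good_subarc n \<beta> \<alpha>"
    unfolding subarc_set_def by blast
  note S = good_subarcD[OF s]
  have \<beta>: "is_arc n \<beta>" and \<alpha>: "is_arc n \<alpha>" using S(1,2) by (auto simp: good_arc_def)
  have eq: "{\<beta>\<^sub>0, half_turn \<beta>\<^sub>0} = {\<beta>, half_turn \<beta>}" "{\<alpha>\<^sub>0, half_turn \<alpha>\<^sub>0} = {\<alpha>, half_turn \<alpha>}"
    using mem half_turn_half_turn[OF \<beta>\<^sub>0] half_turn_half_turn[OF \<alpha>\<^sub>0] by auto
  have R: "c \<in> right_pts \<beta> \<longleftrightarrow> c \<in> right_pts \<alpha>" if "lower \<beta> < c" "c < upper \<beta>" for c
    using that by (subst S(5)) simp
  have goal: "subarc_or_subarc_pair n {\<beta>\<^sub>0, half_turn \<beta>\<^sub>0} {\<alpha>\<^sub>0, half_turn \<alpha>\<^sub>0}"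
    if "arc_subarc_of_arc n \<beta> \<alpha> \<or> pair_subarc_of_arc n \<beta> \<alpha> \<or>
      pair_subarc_of_arc n (half_turn \<beta>) \<alpha> \<or> arc_subarc_of_pair n \<beta> \<alpha> \<or> pair_subarc_of_pair n \<beta> \<alpha>"
  proof -
    have h: "{\<beta>, half_turn \<beta>} = {half_turn \<beta>, half_turn (half_turn \<beta>)}"
      using half_turn_half_turn[OF \<beta>] by auto
    show ?thesis
    proof (cases "pair_subarc_of_arc n (half_turn \<beta>) \<alpha>")
      case True
      then show ?thesis
        unfolding eq subarc_or_subarc_pair_def
        by (intro exI[of _ "half_turn \<beta>"] exI[of _ \<alpha>] conjI h refl disjI2[OF disjI1])
    next
      case False
      then show ?thesis
        using that unfolding eq subarc_or_subarc_pair_def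
        by (intro exI[of _ \<beta>] exI[of _ \<alpha>] conjI refl) blast
    qed
  qed
  show "subarc_or_subarc_pair n {\<beta>\<^sub>0, half_turn \<beta>\<^sub>0} {\<alpha>\<^sub>0, half_turn \<alpha>\<^sub>0}"
  proof (cases "half_turn \<alpha> = \<alpha>")
    case a: True
    have lua: "lower \<alpha> = - upper \<alpha>" using half_turn_simps(1)[of \<alpha>] a by simp
    show ?thesis
    proof (cases "half_turn \<beta> = \<beta>")
      case True
      then have "arc_subarc_of_arc n \<beta> \<alpha>"
        unfolding arc_subarc_of_arc_def symmetric_arc_iff using a S(1,2,4,5) by blast
      then show ?thesis using goal by blast
    next
      case False
      then have no: "\<not> overlapping \<beta>" using S(6) a by blast
      have pair: "symmetric_pair n \<beta>" "nonoverlapping \<beta>" "0 < lower \<beta> \<or> upper \<beta> < 0"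
        using False S(1) labeled_pair_iff[of n \<beta>] no is_arcD(4,5)[OF \<beta>]
        unfolding labeled_pair_def nonoverlapping_def overlapping_def by auto
      show ?thesis
      proof (cases "0 < lower \<beta>")
        case True
        then have "pair_subarc_of_arc n \<beta> \<alpha>"
          unfolding pair_subarc_of_arc_def symmetric_arc_iff using a pair(1,2) S(2,4,5) by blast
        then show ?thesis using goal by blast
      next
        case neg: False
        then have u: "upper \<beta> < 0" using pair(3) by blast
        have "half_turn (half_turn \<beta>) \<noteq> half_turn \<beta>" using False half_turn_half_turn[OF \<beta>] by simp
        moreover have no': "\<not> overlapping (half_turn \<beta>)" using u by (simp add: overlapping_def)
        ultimately have sp: "symmetric_pair n (half_turn \<beta>)"
          using is_arc_half_turn[OF \<beta>] nonoverlapping_compatible[OF is_arc_half_turn[OF \<beta>]]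
          by (simp add: symmetric_pair_def)
        \<comment> \<open>\<beta> lies below 0; by the symmetry of \<alpha> its half-turn, the
          positive arc of the pair, is a restriction of \<alpha> too.\<close>
        have "right_pts (half_turn \<beta>) = right_pts \<alpha> \<inter> {lower (half_turn \<beta>)<..<upper (half_turn \<beta>)}"
        proof (intro Set.set_eqI)
          fix c
          show "c \<in> right_pts (half_turn \<beta>) \<longleftrightarrow>
              c \<in> right_pts \<alpha> \<inter> {lower (half_turn \<beta>)<..<upper (half_turn \<beta>)}"
          proof (cases "- upper \<beta> < c \<and> c < - lower \<beta>")
            case True
            then have "c \<noteq> 0" "lower \<alpha> < c" "c < upper \<alpha>" using u S(3,4) lua is_arcD(3)[OF \<beta>] by auto
            then show ?thesis using symmetric_right_pts[OF a] R[of "- c"] True by auto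
          qed auto
        qed
        moreover have "upper (half_turn \<beta>) \<le> upper \<alpha>" "0 < lower (half_turn \<beta>)" using S(3) lua u by auto
        ultimately have "pair_subarc_of_arc n (half_turn \<beta>) \<alpha>"
          unfolding pair_subarc_of_arc_def symmetric_arc_iff nonoverlapping_def using a sp S(2) by blast
        then show ?thesis using goal by blast
      qed
    qed
  next
    case na: False
    show ?thesis
    proof (cases "half_turn \<beta> = \<beta>")
      case b: True
      have lub: "lower \<beta> = - upper \<beta>" using half_turn_simps(1)[of \<beta>] b by simp
      \<comment> \<open>The restriction condition for \<alpha>, turned by the symmetry of
        \<beta>.\<close>
      have "right_pts \<beta> = right_pts (half_turn \<alpha>) \<inter> {lower \<beta><..<upper \<beta>}"
      proof (intro Set.set_eqI)
        fix c
        show "c \<in> right_pts \<beta> \<longleftrightarrow> c \<in> right_pts (half_turn \<alpha>) \<inter> {lower \<beta><..<upper \<beta>}"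
        proof (cases "lower \<beta> < c \<and> c < upper \<beta> \<and> c \<noteq> 0")
          case True
          then show ?thesis using symmetric_right_pts[OF b, of c] R[of "- c"] lub S(3,4) by auto
        next
          case False
          then show ?thesis using is_arcD(6-8)[OF \<beta>, of c] by auto
        qed
      qed
      then have "arc_subarc_of_pair n \<beta> \<alpha>"
        unfolding arc_subarc_of_pair_def symmetric_arc_iff labeled_pair_iff using na b S(1-5) by blast
      then show ?thesis using goal by blast
    next
      case False
      then have "pair_subarc_of_pair n \<beta> \<alpha>"
        unfolding pair_subarc_of_pair_def labeled_pair_iff using na S(1-5) by blast
      then show ?thesis using goal by blast
    qed
  qed
qed

theorem theorem4p9:
  fixes n :: nat and j\<^sub>1 j\<^sub>2 :: "int \<Rightarrow> int"
  assumes "join_irreducible n j\<^sub>1" and "join_irreducible n j\<^sub>2"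
  shows "forces n j\<^sub>1 j\<^sub>2 \<longleftrightarrow> subarc_or_subarc_pair n (delta n j\<^sub>1) (delta n j\<^sub>2)"
proof -
  obtain \<beta> \<alpha> where "good_arc n \<beta>" "delta n j\<^sub>1 = {\<beta>, half_turn \<beta>}"
    and "good_arc n \<alpha>" "delta n j\<^sub>2 = {\<alpha>, half_turn \<alpha>}"
    using good_arc_join_irreducible[OF assms(1)] good_arc_join_irreducible[OF assms(2)] by metis
  then have "subarc_or_subarc_pair n (delta n j\<^sub>1) (delta n j\<^sub>2) \<longleftrightarrow> subarc_set n (delta n j\<^sub>1) (delta n j\<^sub>2)"
    using subarc_or_subarc_pair_iff by (simp add: good_arc_def)
  then show ?thesis
    using forces_imp_subarc_set[OF assms] subarc_set_imp_forces[OF assms] by blast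
qed

end
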